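(* Let $k$ be an algebraically closed field, let $Q$ be a Dynkin quiver with Euler form $\langle\cdot,\cdot\rangle$, let $M$ be a finite dimensional representation of $Q$ over $k$, and let $\mathbf{e}\in\mathbb{N}Q_0$ be a dimension vector. Then $M$ admits a subrepresentation of dimension vector $\mathbf{e}$ if and only if $$\dim\mathrm{Hom}(U,M)\geq\langle\underline{\dim}\,U,\mathbf{e}\rangle$$ for all representations $U$ of $Q$. Equivalently, $M$ admits a subrepresentation of dimension vector $\mathbf{e}$ if and only if this inequality holds for all indecomposable representations $U$ of $Q$.
   Context: A Dynkin quiver is a finite quiver whose underlying unoriented graph is a simply laced Dynkin diagram (type $A_n$, $D_n$, $E_6$, $E_7$, $E_8$), with arbitrary orientation. $Q_0$ is the set of vertices, and $\mathbb{N}=\{0,1,2,\ldots\}$. Representations are finite dimensional over $k$; $\underline{\dim}\,U\in\mathbb{N}Q_0$ denotes the dimension vector of $U$. The Euler form is $\langle\mathbf{d},\mathbf{e}\rangle=\sum_{i\in Q_0}d_ie_i-\sum_{\alpha:i\to j}d_ie_j$ (second sum over all arrows), so that $\langle\underline{\dim}\,U,\underline{\dim}\,N\rangle=\dim\mathrm{Hom}(U,N)-\dim\mathrm{Ext}^1(U,N)$. *)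

theory Defs
  imports
    "HOL-Computational_Algebra.Polynomial"
    "HOL-Library.Function_Algebras"
    "Graph_Theory.Digraph"
begin

section \<open>Dynkin quivers\<close>

text \<open>
  A quiver is a directed multigraph \<^typ>\<open>('v, 'a) pre_digraph\<close>; an arrow \<open>a\<close> goes from
  \<^term>\<open>tail Q a\<close> to \<^term>\<open>head Q a\<close>.

  The simply laced Dynkin diagrams have vertices \<open>1, \<dots>, n\<close> and are given by their edge sets.
  \<open>Dynkin_D n\<close> is the path \<open>1, \<dots>, n - 1\<close> with the vertex \<open>n\<close> attached to \<open>n - 2\<close>;
  \<open>Dynkin_E n\<close> is the path \<open>1, \<dots>, n - 1\<close> with the vertex \<open>n\<close> attached to \<open>3\<close>
  (arms of lengths \<open>2\<close>, \<open>n - 4\<close> and \<open>1\<close> at the branch vertex).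
\<close>

definition path_edges :: "nat \<Rightarrow> nat set set" where
  "path_edges n = {{i, i + 1} | i. 1 \<le> i \<and> i < n}"

datatype dynkin_type = Dynkin_A nat | Dynkin_D nat | Dynkin_E nat

fun dynkin_admissible :: "dynkin_type \<Rightarrow> bool" where
  "dynkin_admissible (Dynkin_A n) \<longleftrightarrow> n \<ge> 1"
| "dynkin_admissible (Dynkin_D n) \<longleftrightarrow> n \<ge> 4"
| "dynkin_admissible (Dynkin_E n) \<longleftrightarrow> n \<in> {6, 7, 8}"

fun dynkin_verts :: "dynkin_type \<Rightarrow> nat set" where
  "dynkin_verts (Dynkin_A n) = {1..n}"
| "dynkin_verts (Dynkin_D n) = {1..n}"
| "dynkin_verts (Dynkin_E n) = {1..n}"

fun dynkin_edges :: "dynkin_type \<Rightarrow> nat set set" where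
  "dynkin_edges (Dynkin_A n) = path_edges n"
| "dynkin_edges (Dynkin_D n) = path_edges (n - 1) \<union> {{n - 2, n}}"
| "dynkin_edges (Dynkin_E n) = path_edges (n - 1) \<union> {{3, n}}"

text \<open>
  Injectivity on arrows excludes parallel and opposite arrows; loops are excluded because no edge
  of a diagram is a singleton.
\<close>

definition dynkin_quiver :: "('v, 'a) pre_digraph \<Rightarrow> bool" where
  "dynkin_quiver Q \<longleftrightarrow> fin_digraph Q \<and>
     (\<exists>\<Delta> \<sigma>. dynkin_admissible \<Delta> \<and> bij_betw \<sigma> (verts Q) (dynkin_verts \<Delta>) \<and>
        bij_betw (\<lambda>a. {\<sigma> (tail Q a), \<sigma> (head Q a)}) (arcs Q) (dynkin_edges \<Delta>))"

definition euler_form :: "('v, 'a) pre_digraph \<Rightarrow> ('v \<Rightarrow> nat) \<Rightarrow> ('v \<Rightarrow> nat) \<Rightarrow> int" where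
  "euler_form Q d e =
     (\<Sum>i\<in>verts Q. int (d i) * int (e i)) - (\<Sum>a\<in>arcs Q. int (d (tail Q a)) * int (e (head Q a)))"


section \<open>Representations\<close>

text \<open>
  The vector spaces of a representation are subspaces of one ambient vector space, whose scalar
  multiplication is the parameter \<open>s\<close> below. Only the spaces at vertices and the restrictions
  of the maps to these spaces are meaningful; all notions ignore the remaining values.
\<close>

record ('v, 'a, 'b) quiver_rep =
  rep_space :: "'v \<Rightarrow> 'b set"
  rep_map :: "'a \<Rightarrow> 'b \<Rightarrow> 'b"

definition finite_dim :: "('k::field \<Rightarrow> 'b::ab_group_add \<Rightarrow> 'b) \<Rightarrow> 'b set \<Rightarrow> bool" where
  "finite_dim s V \<longleftrightarrow> module.subspace s V \<and> (\<exists>B. finite B \<and> module.span s B = V)"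

definition linear_between ::
  "('k::field \<Rightarrow> 'b::ab_group_add \<Rightarrow> 'b) \<Rightarrow> ('k \<Rightarrow> 'c::ab_group_add \<Rightarrow> 'c) \<Rightarrow>
   'b set \<Rightarrow> 'c set \<Rightarrow> ('b \<Rightarrow> 'c) \<Rightarrow> bool" where
  "linear_between s t V W f \<longleftrightarrow> (\<forall>x\<in>V. f x \<in> W) \<and>
     (\<forall>x\<in>V. \<forall>y\<in>V. f (x + y) = f x + f y) \<and> (\<forall>c. \<forall>x\<in>V. f (s c x) = t c (f x))"

definition fd_rep ::
  "('v, 'a) pre_digraph \<Rightarrow> ('k::field \<Rightarrow> 'b::ab_group_add \<Rightarrow> 'b) \<Rightarrow> ('v, 'a, 'b) quiver_rep \<Rightarrow> bool"
  where
  "fd_rep Q s V \<longleftrightarrow> (\<forall>i\<in>verts Q. finite_dim s (rep_space V i)) \<and>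
     (\<forall>a\<in>arcs Q. linear_between s s (rep_space V (tail Q a)) (rep_space V (head Q a)) (rep_map V a))"

definition dimension_vector ::
  "('k::field \<Rightarrow> 'b::ab_group_add \<Rightarrow> 'b) \<Rightarrow> ('v, 'a, 'b) quiver_rep \<Rightarrow> 'v \<Rightarrow> nat" where
  "dimension_vector s V i = vector_space.dim s (rep_space V i)"

definition subrep ::
  "('v, 'a) pre_digraph \<Rightarrow> ('k::field \<Rightarrow> 'b::ab_group_add \<Rightarrow> 'b) \<Rightarrow>
   ('v, 'a, 'b) quiver_rep \<Rightarrow> ('v, 'a, 'b) quiver_rep \<Rightarrow> bool" where
  "subrep Q s N M \<longleftrightarrow> fd_rep Q s N \<and> (\<forall>i\<in>verts Q. rep_space N i \<subseteq> rep_space M i) \<and>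
     (\<forall>a\<in>arcs Q. \<forall>x\<in>rep_space N (tail Q a). rep_map N a x = rep_map M a x)"

definition zero_rep ::
  "('v, 'a) pre_digraph \<Rightarrow> ('v, 'a, 'b::ab_group_add) quiver_rep \<Rightarrow> bool" where
  "zero_rep Q V \<longleftrightarrow> (\<forall>i\<in>verts Q. rep_space V i = {0})"

definition internal_direct_sum ::
  "('v, 'a) pre_digraph \<Rightarrow> ('k::field \<Rightarrow> 'b::ab_group_add \<Rightarrow> 'b) \<Rightarrow>
   ('v, 'a, 'b) quiver_rep \<Rightarrow> ('v, 'a, 'b) quiver_rep \<Rightarrow> ('v, 'a, 'b) quiver_rep \<Rightarrow> bool" where
  "internal_direct_sum Q s V V1 V2 \<longleftrightarrow> subrep Q s V1 V \<and> subrep Q s V2 V \<and>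
     (\<forall>i\<in>verts Q. rep_space V i = {x + y | x y. x \<in> rep_space V1 i \<and> y \<in> rep_space V2 i} \<and>
        rep_space V1 i \<inter> rep_space V2 i = {0})"

definition indecomposable ::
  "('v, 'a) pre_digraph \<Rightarrow> ('k::field \<Rightarrow> 'b::ab_group_add \<Rightarrow> 'b) \<Rightarrow> ('v, 'a, 'b) quiver_rep \<Rightarrow> bool"
  where
  "indecomposable Q s V \<longleftrightarrow> fd_rep Q s V \<and> \<not> zero_rep Q V \<and>
     (\<forall>V1 V2. internal_direct_sum Q s V V1 V2 \<longrightarrow> zero_rep Q V1 \<or> zero_rep Q V2)"

text \<open>
  A morphism is a family of linear maps, normalised to be \<open>0\<close> where it carries no
  information, so that distinct functions are distinct morphisms and the Hom space is a subspace
  of a function space.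
\<close>

definition rep_hom ::
  "('v, 'a) pre_digraph \<Rightarrow> ('k::field \<Rightarrow> 'b::ab_group_add \<Rightarrow> 'b) \<Rightarrow> ('k \<Rightarrow> 'c::ab_group_add \<Rightarrow> 'c) \<Rightarrow>
   ('v, 'a, 'b) quiver_rep \<Rightarrow> ('v, 'a, 'c) quiver_rep \<Rightarrow> ('v \<Rightarrow> 'b \<Rightarrow> 'c) set" where
  "rep_hom Q s t U V = {\<phi>.
     (\<forall>i\<in>verts Q. linear_between s t (rep_space U i) (rep_space V i) (\<phi> i)) \<and>
     (\<forall>a\<in>arcs Q. \<forall>x\<in>rep_space U (tail Q a).
        \<phi> (head Q a) (rep_map U a x) = rep_map V a (\<phi> (tail Q a) x)) \<and>
     (\<forall>i x. i \<notin> verts Q \<or> x \<notin> rep_space U i \<longrightarrow> \<phi> i x = 0)}"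

definition family_scale :: "('k \<Rightarrow> 'c \<Rightarrow> 'c) \<Rightarrow> 'k \<Rightarrow> ('v \<Rightarrow> 'b \<Rightarrow> 'c) \<Rightarrow> 'v \<Rightarrow> 'b \<Rightarrow> 'c" where
  "family_scale t c \<phi> = (\<lambda>i x. t c (\<phi> i x))"

definition hom_dim ::
  "('v, 'a) pre_digraph \<Rightarrow> ('k::field \<Rightarrow> 'b::ab_group_add \<Rightarrow> 'b) \<Rightarrow> ('k \<Rightarrow> 'c::ab_group_add \<Rightarrow> 'c) \<Rightarrow>
   ('v, 'a, 'b) quiver_rep \<Rightarrow> ('v, 'a, 'c) quiver_rep \<Rightarrow> nat" where
  "hom_dim Q s t U V = vector_space.dim (family_scale t) (rep_hom Q s t U V)"

lemma vector_space_family_scale: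
  "vector_space t \<Longrightarrow> vector_space (family_scale t :: 'k::field \<Rightarrow> ('v \<Rightarrow> 'b \<Rightarrow> 'c::ab_group_add) \<Rightarrow> _)"
  unfolding vector_space_def family_scale_def by (auto simp: fun_eq_iff)

lemma subspace_rep_hom:
  fixes s :: "'k::field \<Rightarrow> 'b::ab_group_add \<Rightarrow> 'b" and t :: "'k \<Rightarrow> 'c::ab_group_add \<Rightarrow> 'c"
    and V :: "('v, 'a, 'c) quiver_rep"
  assumes "wf_digraph Q" and t: "vector_space t" and V: "fd_rep Q t V"
  shows "module.subspace (family_scale t) (rep_hom Q s t U V)"
proof -
  interpret wf_digraph Q by fact
  interpret T: vector_space t by fact
  interpret F: vector_space "family_scale t :: 'k \<Rightarrow> ('v \<Rightarrow> 'b \<Rightarrow> 'c) \<Rightarrow> _"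
    by (rule vector_space_family_scale[OF t])
  have sub: "T.subspace (rep_space V i)" if "i \<in> verts Q" for i
    using V that by (auto simp: fd_rep_def finite_dim_def)
  have lin: "linear_between t t (rep_space V (tail Q a)) (rep_space V (head Q a)) (rep_map V a)"
    if "a \<in> arcs Q" for a using V that by (auto simp: fd_rep_def)
  have zero: "rep_map V a 0 = 0" if "a \<in> arcs Q" for a
  proof -
    have "0 \<in> rep_space V (tail Q a)" using sub that T.subspace_0 by simp
    then show ?thesis using lin[OF that] unfolding linear_between_def by (metis T.scale_zero_left)
  qed
  show ?thesis
    unfolding F.subspace_def
  proof (intro conjI ballI allI)
    show "0 \<in> rep_hom Q s t U V"
      using sub zero by (auto simp: rep_hom_def linear_between_def T.subspace_0)
  next
    fix f g assume "f \<in> rep_hom Q s t U V" "g \<in> rep_hom Q s t U V"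
    then show "f + g \<in> rep_hom Q s t U V"
      using sub lin
      by (auto simp: rep_hom_def linear_between_def T.subspace_add algebra_simps)
  next
    fix c f assume "f \<in> rep_hom Q s t U V"
    then show "family_scale t c f \<in> rep_hom Q s t U V"
      using sub lin
      by (auto simp: rep_hom_def linear_between_def family_scale_def T.subspace_scale
          T.scale_right_distrib T.scale_left_commute)
  qed
qed


section \<open>Representations up to isomorphism\<close>

text \<open>
  An infinite dimensional ambient space is large enough to contain an isomorphic copy of every
  finite dimensional representation, in whatever ambient space the latter lives. Hence quantifying
  over the representations in one such space covers all finite dimensional representations.
\<close>

definition rep_iso ::
  "('v, 'a) pre_digraph \<Rightarrow> ('k::field \<Rightarrow> 'b::ab_group_add \<Rightarrow> 'b) \<Rightarrow> ('k \<Rightarrow> 'c::ab_group_add \<Rightarrow> 'c) \<Rightarrow>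
   ('v, 'a, 'b) quiver_rep \<Rightarrow> ('v, 'a, 'c) quiver_rep \<Rightarrow> bool" where
  "rep_iso Q s t U V \<longleftrightarrow>
     (\<exists>\<phi>\<in>rep_hom Q s t U V. \<forall>i\<in>verts Q. bij_betw (\<phi> i) (rep_space U i) (rep_space V i))"

lemma finite_dim_copy:
  fixes s :: "'k::field \<Rightarrow> 'b::ab_group_add \<Rightarrow> 'b" and t :: "'k \<Rightarrow> 'c::ab_group_add \<Rightarrow> 'c"
  assumes s: "vector_space s" and t: "vector_space t" and inf: "\<not> finite_dim t UNIV"
    and V: "finite_dim s V"
  shows "\<exists>f. Vector_Spaces.linear s t f \<and> inj_on f V \<and> finite_dim t (f ` V)"
proof -
  interpret S: vector_space s by fact
  interpret T: vector_space t by fact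
  interpret P: vector_space_pair s t by unfold_locales
  obtain B0 where B0: "finite B0" "S.span B0 = V" using V by (auto simp: finite_dim_def)
  obtain B where B: "B \<subseteq> B0" "S.independent B" "B0 \<subseteq> S.span B"
    by (rule S.maximal_independent_subset)
  have finB: "finite B" using B(1) B0(1) finite_subset by blast
  have spanB: "S.span B = V"
    using B B0 by (metis S.span_mono S.span_span subset_antisym)
  obtain C0 where C0: "T.independent C0" "UNIV \<subseteq> T.span C0"
    by (rule T.maximal_independent_subset[of UNIV]) auto
  have "infinite C0"
    using C0 inf by (auto simp: finite_dim_def)
  then obtain C where C: "C \<subseteq> C0" "finite C" "card C = card B"
    using infinite_arbitrarily_large by blast
  have indC: "T.independent C" using C C0 T.independent_mono by blast
  obtain g where g: "bij_betw g B C"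
    using finite_same_card_bij[OF finB C(2)] C(3) by auto
  obtain f where f: "Vector_Spaces.linear s t f" "\<forall>x\<in>B. f x = g x"
    using P.linear_independent_extend[OF B(2), of g] by blast
  have fB: "f ` B = C" "inj_on f B"
    using g f(2) by (auto simp: bij_betw_def inj_on_def image_def)
  have "inj_on f V"
    using P.linear_inj_on_span_independent_image[OF f(1), of B] fB indC spanB by simp
  moreover have "f ` V = T.span C"
    using P.linear_span_image[OF f(1), of B] fB spanB by simp
  ultimately have "finite_dim t (f ` V)"
    using C(2) T.subspace_span[of C] unfolding finite_dim_def by auto
  then show ?thesis using f(1) \<open>inj_on f V\<close> by blast
qed

lemma fd_rep_copy:
  fixes s :: "'k::field \<Rightarrow> 'b::ab_group_add \<Rightarrow> 'b" and t :: "'k \<Rightarrow> 'c::ab_group_add \<Rightarrow> 'c"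
    and U :: "('v, 'a, 'b) quiver_rep"
  assumes "wf_digraph Q" and s: "vector_space s" and t: "vector_space t"
    and inf: "\<not> finite_dim t UNIV" and U: "fd_rep Q s U"
  shows "\<exists>V. fd_rep Q t V \<and> rep_iso Q s t U V"
proof -
  interpret wf_digraph Q by fact
  have "\<forall>i\<in>verts Q. \<exists>f. Vector_Spaces.linear s t f \<and> inj_on f (rep_space U i) \<and> finite_dim t (f ` rep_space U i)"
    using finite_dim_copy[OF s t inf] U by (auto simp: fd_rep_def)
  then obtain f where f: "\<And>i. i \<in> verts Q \<Longrightarrow> Vector_Spaces.linear s t (f i)"
    "\<And>i. i \<in> verts Q \<Longrightarrow> inj_on (f i) (rep_space U i)"
    "\<And>i. i \<in> verts Q \<Longrightarrow> finite_dim t (f i ` rep_space U i)"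
    by metis
  define g where "g i = the_inv_into (rep_space U i) (f i)" for i
  have gf: "g i (f i x) = x" if "i \<in> verts Q" "x \<in> rep_space U i" for i x
    unfolding g_def using f(2)[OF that(1)] that(2) by (rule the_inv_into_f_f)
  define V :: "('v, 'a, 'c) quiver_rep" where
    "V = \<lparr>rep_space = (\<lambda>i. f i ` rep_space U i),
          rep_map = (\<lambda>a y. f (head Q a) (rep_map U a (g (tail Q a) y)))\<rparr>"
  define \<phi> where "\<phi> i x = (if i \<in> verts Q \<and> x \<in> rep_space U i then f i x else 0)" for i x
  have add: "f i (x + y) = f i x + f i y" and scale: "f i (s c x) = t c (f i x)"
    if "i \<in> verts Q" for i x y c
    using f(1)[OF that] by (simp_all add: module_hom_iff_linear[symmetric] module_hom.add module_hom.scale)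
  have sub: "x + y \<in> rep_space U i" "s c x \<in> rep_space U i"
    if "i \<in> verts Q" "x \<in> rep_space U i" "y \<in> rep_space U i" for i x y c
  proof -
    interpret S: vector_space s by fact
    have "S.subspace (rep_space U i)" using U that(1) by (auto simp: fd_rep_def finite_dim_def)
    then show "x + y \<in> rep_space U i" "s c x \<in> rep_space U i"
      using that S.subspace_add S.subspace_scale by blast+
  qed
  have lin: "linear_between s s (rep_space U (tail Q a)) (rep_space U (head Q a)) (rep_map U a)"
    if "a \<in> arcs Q" for a using U that by (auto simp: fd_rep_def)
  have "linear_between t t (rep_space V (tail Q a)) (rep_space V (head Q a)) (rep_map V a)"
    if a: "a \<in> arcs Q" for a
  proof -
    have v: "tail Q a \<in> verts Q" "head Q a \<in> verts Q" using a by auto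
    show ?thesis
      using lin[OF a] v
      by (auto simp: linear_between_def V_def gf sub add[symmetric] scale[symmetric])
  qed
  then have "fd_rep Q t V" using f(3) by (auto simp: fd_rep_def V_def)
  moreover have "\<phi> \<in> rep_hom Q s t U V"
    using lin by (auto simp: rep_hom_def linear_between_def V_def \<phi>_def gf add scale sub)
  moreover have "bij_betw (\<phi> i) (rep_space U i) (rep_space V i)" if "i \<in> verts Q" for i
    using f(2)[OF that] that by (auto simp: bij_betw_def V_def \<phi>_def inj_on_def)
  ultimately show ?thesis unfolding rep_iso_def by blast
qed

text \<open>Such ambient spaces exist over every field.\<close>

lemma infinite_dim_poly:
  shows "vector_space (smult :: 'k::field \<Rightarrow> 'k poly \<Rightarrow> 'k poly)"
    and "\<not> finite_dim (smult :: 'k \<Rightarrow> 'k poly \<Rightarrow> 'k poly) UNIV"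
proof -
  show vs: "vector_space (smult :: 'k \<Rightarrow> 'k poly \<Rightarrow> 'k poly)"
    by unfold_locales (auto simp: smult_add_right smult_add_left)
  interpret P: vector_space "smult :: 'k \<Rightarrow> 'k poly \<Rightarrow> 'k poly" by (rule vs)
  show "\<not> finite_dim (smult :: 'k \<Rightarrow> 'k poly \<Rightarrow> 'k poly) UNIV"
  proof
    assume "finite_dim (smult :: 'k \<Rightarrow> 'k poly \<Rightarrow> 'k poly) UNIV"
    then obtain B :: "'k poly set" where B: "finite B" "P.span B = UNIV"
      by (auto simp: finite_dim_def)
    define n where "n = Max (insert 0 (degree ` B))"
    have "P.subspace {p. degree p \<le> n}"
      by (auto simp: P.subspace_def intro: degree_add_le order.trans[OF degree_smult_le])
    moreover have "B \<subseteq> {p. degree p \<le> n}"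
      using B(1) by (auto simp: n_def)
    ultimately have "P.span B \<subseteq> {p. degree p \<le> n}" by (rule P.span_minimal[rotated])
    then have "monom 1 (Suc n) \<in> {p :: 'k poly. degree p \<le> n}" using B(2) by blast
    then show False by (simp add: degree_monom_eq)
  qed
qed

end

theory Submission
  imports Defs
begin

text \<open>
  The condition is necessary because \<open>dim Hom(U, M) \<ge> dim Hom(U, N) \<ge> \<langle>dim U, dim N\<rangle>\<close> for
  \<open>N \<subseteq> M\<close>. For sufficiency choose a sink \<open>i\<close> and replace \<open>M\<close> by its reflection \<open>M'\<close>, whose space at
  \<open>i\<close> is the kernel of the map from the direct sum of the neighbouring spaces to \<open>M\<^sub>i\<close>. The left
  adjoint \<open>U \<mapsto> U'\<close> (the reflection by cokernels) gives
  \<open>dim Hom(U, M') = dim Hom(U', M) \<ge> \<langle>dim U', e\<rangle> \<ge> \<langle>dim U, s\<^sub>i e\<rangle>\<close>, so the condition passes to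
  \<open>(M', s\<^sub>i e)\<close>. If the \<open>i\<close>-th coordinate of \<open>s\<^sub>i e\<close> is nonpositive, then \<open>e\<^sub>i\<close> is so large that the
  vertex \<open>i\<close> imposes no restriction on a subrepresentation and can be deleted, the bound being
  inherited through the representations \<open>U\<close> with \<open>U\<^sub>i = 0\<close>; otherwise one continues with
  \<open>(M', s\<^sub>i e)\<close>. In both cases the subrepresentation found extends to \<open>M\<close>, because its image in
  \<open>M\<^sub>i\<close> has dimension at most \<open>e\<^sub>i \<le> dim M\<^sub>i\<close>. The recursion ends since, the Tits form being
  positive definite, cyclic reflections cannot keep a nonzero vector nonnegative forever.
\<close>

section \<open>Finite dimensional subspaces\<close>

text \<open>The delicate point of reflection arguments is the simple module at the sink, for which
  the dimension formula of a reflection fails. It is absorbed by inequalities: the cokernel always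
  satisfies dim U'_i >= (sum of the neighbouring dimensions) - dim U_i, and multiplying by e_i >= 0
  gives the last inequality of the chain. So neither \<open>U\<close> nor \<open>M\<close> is
  decomposed along the way, and of the adjunction only an injection from Hom(U', M) into Hom(U, M')
  enters. A second obstacle is that quiver, representation and dimension vector all change at each
  step. The neighbour sums that define the reflections ignore the orientation, however, so the
  vectors occurring are determined by \<open>e\<close> and the cyclic order of the vertices;
  termination becomes a statement about vectors alone. A third one is that kernels and cokernels of
  direct sums live in function spaces, whereas the bound is assumed only for test representations in
  one ambient space. Everything is therefore copied back into that space, which must be infinite
  dimensional, and \<open>M\<close> is moved there first.\<close>

context vector_space
begin

lemma finite_dim_basis:
  assumes "finite_dim scale V"
  obtains B where "finite B" "independent B" "span B = V" "card B = dim V"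
proof -
  obtain B0 where B0: "finite B0" "span B0 = V" using assms by (auto simp: finite_dim_def)
  obtain B where B: "B \<subseteq> V" "independent B" "V \<subseteq> span B" "card B = dim V"
    by (rule basis_exists)
  have "finite B" using independent_span_bound[OF B0(1) B(2)] B(1) B0(2) by simp
  moreover have "span B = V"
    using B assms span_minimal unfolding finite_dim_def by (metis subset_antisym)
  ultimately show thesis using that B by blast
qed

lemma finite_dim_span: "finite B \<Longrightarrow> finite_dim scale (span B)"
  unfolding finite_dim_def using subspace_span by blast

lemma finite_dim_imp_subspace: "finite_dim scale V \<Longrightarrow> subspace V"
  unfolding finite_dim_def by blast

lemma independent_finite_dim:
  assumes W: "finite_dim scale W" and B: "independent B" "B \<subseteq> W"
  shows "finite B \<and> card B \<le> dim W"
proof -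
  obtain C where C: "finite C" "independent C" "span C = W" "card C = dim W"
    using W by (rule finite_dim_basis)
  show ?thesis using independent_span_bound[OF C(1) B(1)] B(2) C by simp
qed

lemma finite_dim_subspace:
  assumes W: "finite_dim scale W" and V: "subspace V" "V \<subseteq> W"
  shows "finite_dim scale V" and "dim V \<le> dim W"
proof -
  obtain B where B: "B \<subseteq> V" "independent B" "V \<subseteq> span B" "card B = dim V"
    by (rule basis_exists)
  have fin: "finite B \<and> card B \<le> dim W" using independent_finite_dim[OF W B(2)] B(1) V(2) by blast
  have "span B = V" using B span_minimal[OF B(1) V(1)] by blast
  then show "finite_dim scale V" using fin finite_dim_span[of B] by simp
  show "dim V \<le> dim W" using fin B(4) by simp
qed

lemma basis_extend:
  assumes W: "finite_dim scale W" and V: "subspace V" "V \<subseteq> W"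
  obtains B C where "finite C" "B \<subseteq> C" "independent C" "span B = V" "span C = W"
    "card B = dim V" "card C = dim W"
proof -
  obtain B where B: "finite B" "independent B" "span B = V" "card B = dim V"
    using finite_dim_subspace(1)[OF W V] by (rule finite_dim_basis)
  have "B \<subseteq> W" using B(3) V(2) span_superset by blast
  then obtain C where C: "B \<subseteq> C" "C \<subseteq> W" "independent C" "W \<subseteq> span C"
    using maximal_independent_subset_extend[OF _ B(2)] by blast
  have "finite C" using independent_finite_dim[OF W C(3,2)] by blast
  moreover have "span C = W"
    using C span_minimal[OF C(2) finite_dim_imp_subspace[OF W]] by blast
  moreover have "card C = dim W" using dim_eq_card_independent[OF C(3)] dim_span[of C] calculation(2) by simp
  ultimately show thesis using that B C by blast
qed

text \<open>A basis of \<open>V\<close> is completed by part of a basis of \<open>W\<close>. This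
  supplies the space at the sink when a subrepresentation is extended: it has to contain a given
  image and to have a prescribed dimension.\<close>

lemma intermediate_subspace:
  assumes W: "finite_dim scale W" and V: "subspace V" "V \<subseteq> W" and n: "dim V \<le> n" "n \<le> dim W"
  obtains Z where "V \<subseteq> Z" "Z \<subseteq> W" "finite_dim scale Z" "dim Z = n"
proof -
  obtain B C where BC: "finite C" "B \<subseteq> C" "independent C" "span B = V" "span C = W"
    "card B = dim V" "card C = dim W" using W V by (rule basis_extend)
  have finB: "finite B" using BC finite_subset by blast
  have "n - card B \<le> card (C - B)" using BC n finB by (simp add: card_Diff_subset)
  then obtain D where D: "D \<subseteq> C - B" "card D = n - card B"
    by (rule obtain_subset_with_card_n)
  have sub: "B \<union> D \<subseteq> C" using BC D by blast
  have "card (B \<union> D) = n"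
    using card_Un_disjoint[of B D] finB D BC(1) n(1) BC(6) finite_subset[of D C] by auto
  then have "dim (span (B \<union> D)) = n"
    using independent_mono[OF BC(3) sub] dim_eq_card_independent dim_span by metis
  moreover have "V \<subseteq> span (B \<union> D)" "span (B \<union> D) \<subseteq> W"
    using span_mono[of B "B \<union> D"] span_mono[OF sub] BC by auto
  moreover have "finite_dim scale (span (B \<union> D))"
    using finite_dim_span finite_subset[OF sub BC(1)] by blast
  ultimately show thesis using that by blast
qed

lemma finite_dim_sum:
  assumes V: "finite_dim scale V" and W: "finite_dim scale W" and Z: "subspace Z"
    and "Z \<subseteq> {x + y | x y. x \<in> V \<and> y \<in> W}"
  shows "finite_dim scale Z"
proof -
  obtain B C where "finite B" "span B = V" "finite C" "span C = W"
    using V W unfolding finite_dim_def by blast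
  then have "finite_dim scale {x + y | x y. x \<in> V \<and> y \<in> W}"
    using finite_dim_span[of "B \<union> C"] span_Un[of B C] by simp
  then show ?thesis using finite_dim_subspace(1) Z assms(4) by blast
qed

end

section \<open>Linear maps that are meaningful only on a subspace\<close>

lemma linear_between_0:
  assumes "vector_space s" "vector_space t" "linear_between s t V W f" "module.subspace s V"
  shows "f 0 = 0"
proof -
  interpret S: vector_space s by fact
  interpret T: vector_space t by fact
  have "0 \<in> V" using S.subspace_0 assms(4) .
  then show ?thesis using assms(3) unfolding linear_between_def
    by (metis S.scale_zero_left T.scale_zero_left)
qed

lemma linear_between_diff:
  assumes "vector_space s" "vector_space t" "linear_between s t V W f" "module.subspace s V"
    and "x \<in> V" "y \<in> V"
  shows "f (x - y) = f x - f y"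
proof -
  interpret S: vector_space s by fact
  have "x - y \<in> V" using S.subspace_diff assms by blast
  then have "f (x - y + y) = f (x - y) + f y"
    using assms(3,6) unfolding linear_between_def by blast
  then show ?thesis by simp
qed

lemma linear_between_sum:
  assumes "vector_space s" "vector_space t" "linear_between s t V W f" "module.subspace s V"
    and "\<And>i. i \<in> I \<Longrightarrow> g i \<in> V"
  shows "f (\<Sum>i\<in>I. g i) = (\<Sum>i\<in>I. f (g i))"
proof -
  interpret S: vector_space s by fact
  have "(\<forall>i\<in>J. g i \<in> V) \<Longrightarrow> f (\<Sum>i\<in>J. g i) = (\<Sum>i\<in>J. f (g i))" for J
  proof (induction J rule: infinite_finite_induct)
    case (insert x F)
    then have "(\<Sum>i\<in>F. g i) \<in> V" by (intro S.subspace_sum[OF assms(4)]) auto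
    then show ?case using insert assms(3) by (auto simp: linear_between_def)
  qed (auto simp: linear_between_0[OF assms(1-4)])
  then show ?thesis using assms(5) by blast
qed

lemma linear_between_kernel:
  assumes "vector_space s" "vector_space t" "linear_between s t V W f" "module.subspace s V"
  shows "module.subspace s {x\<in>V. f x = 0}"
proof -
  interpret S: vector_space s by fact
  interpret T: vector_space t by fact
  show ?thesis
    using assms(3,4) linear_between_0[OF assms]
    by (auto simp: linear_between_def S.subspace_def)
qed

lemma linear_between_image_subspace:
  assumes "vector_space s" "vector_space t" "linear_between s t V W f" "module.subspace s V"
  shows "module.subspace t (f ` V)"
proof -
  interpret S: vector_space s by fact
  interpret T: vector_space t by fact
  show ?thesis
    unfolding T.subspace_def
  proof (intro conjI ballI allI)
    show "0 \<in> f ` V" using linear_between_0[OF assms] S.subspace_0[OF assms(4)] by force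
  next
    fix x y assume "x \<in> f ` V" "y \<in> f ` V"
    then obtain a b where "a \<in> V" "b \<in> V" "x = f a" "y = f b" by blast
    then show "x + y \<in> f ` V"
      using assms(3) S.subspace_add[OF assms(4)] by (intro image_eqI[of _ _ "a + b"]) (auto simp: linear_between_def)
  next
    fix c x assume "x \<in> f ` V"
    then obtain a where "a \<in> V" "x = f a" by blast
    then show "t c x \<in> f ` V"
      using assms(3) S.subspace_scale[OF assms(4)] by (intro image_eqI[of _ _ "s c a"]) (auto simp: linear_between_def)
  qed
qed

text \<open>The maps of a representation are arbitrary outside their domain. Replacing them by
  globally linear ones makes the library facts about spans and independent sets applicable.\<close>

lemma linear_between_extend:
  assumes "vector_space s" "vector_space t" "linear_between s t V W f" "finite_dim s V"
  obtains g where "Vector_Spaces.linear s t g" "\<And>x. x \<in> V \<Longrightarrow> g x = f x"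
proof -
  interpret S: vector_space s by fact
  interpret T: vector_space t by fact
  interpret P: vector_space_pair s t by unfold_locales
  have sub: "S.subspace V" using S.finite_dim_imp_subspace assms(4) .
  obtain B where B: "finite B" "S.independent B" "S.span B = V"
    using assms(4) by (rule S.finite_dim_basis)
  obtain g where g: "Vector_Spaces.linear s t g" "\<forall>x\<in>B. g x = f x"
    using P.linear_independent_extend[OF B(2), of f] by blast
  have "g x = f x" if "x \<in> V" for x
  proof -
    have "x \<in> S.span B" using that B by simp
    \<comment> \<open>Membership is carried through the induction because \<open>f\<close> is
      additive only on \<open>V\<close>.\<close>
    then have "x \<in> V \<and> g x = f x"
    proof (induction rule: S.span_induct_alt)
      case base
      show ?case using P.linear_0[OF g(1)] linear_between_0[OF assms(1-3) sub] S.subspace_0[OF sub] by simp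
    next
      case (step c b y)
      have b: "b \<in> V" using step(1) B(3) S.span_base by blast
      moreover have "s c b \<in> V" using b S.subspace_scale[OF sub] by blast
      ultimately show ?case
        using step assms(3) g(2) S.subspace_add[OF sub]
        by (auto simp: P.linear_add[OF g(1)] P.linear_scale[OF g(1)] linear_between_def)
    qed
    then show ?thesis by blast
  qed
  then show thesis using that g(1) by blast
qed

text \<open>A basis \<open>B\<close> of the kernel extends to a basis \<open>C\<close> of
  \<open>V\<close>, and \<open>C - B\<close> is mapped injectively onto a basis of the
  image.\<close>

lemma rank_nullity:
  assumes "vector_space s" "vector_space t" "linear_between s t V W f" "finite_dim s V"
  shows "finite_dim t (f ` V)"
    and "vector_space.dim s V = vector_space.dim s {x\<in>V. f x = 0} + vector_space.dim t (f ` V)"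
proof -
  interpret S: vector_space s by fact
  interpret T: vector_space t by fact
  interpret P: vector_space_pair s t by unfold_locales
  have sub: "S.subspace V" using S.finite_dim_imp_subspace assms(4) .
  obtain g where g: "Vector_Spaces.linear s t g" "\<And>x. x \<in> V \<Longrightarrow> g x = f x"
    using linear_between_extend[OF assms] by blast
  let ?K = "{x\<in>V. f x = 0}"
  have K: "S.subspace ?K" using linear_between_kernel[OF assms(1-3) sub] .
  obtain B C where BC: "finite C" "B \<subseteq> C" "S.independent C" "S.span B = ?K" "S.span C = V"
    "card B = S.dim ?K" "card C = S.dim V"
    using assms(4) K by (rule S.basis_extend) blast
  let ?D = "C - B"
  have inj: "inj_on g (S.span ?D)"
  proof -
    have "x = 0" if x: "x \<in> S.span ?D" "g x = 0" for x
    proof -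
      have "x \<in> V" using x(1) S.span_mono[of ?D C] BC(5) by blast
      then have "x \<in> S.span B" using x(2) g(2) BC(4) by auto
      \<comment> \<open>The coordinates of \<open>x\<close> in the basis \<open>C\<close> are
        supported both in \<open>B\<close> and in \<open>C - B\<close>, so they all vanish.\<close>
      then have "S.representation C x = S.representation B x" "S.representation C x = S.representation ?D x"
        using BC(2) x(1) by (auto intro!: S.representation_extend[OF BC(3)])
      then have "S.representation C x b = 0" for b
        using S.representation_ne_zero[of B x b] S.representation_ne_zero[of ?D x b] by auto
      then show "x = 0"
        using S.sum_nonzero_representation_eq[OF BC(3), of x] \<open>x \<in> V\<close> BC(5) by simp
    qed
    then show ?thesis
      by (intro inj_onI) (metis P.linear_diff[OF g(1)] S.span_diff eq_iff_diff_eq_0)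
  qed
  have img: "f ` V = T.span (g ` ?D)"
  proof -
    have "f ` V = g ` S.span C" using g(2) BC(5) by simp
    also have "\<dots> = T.span (g ` C)" using P.linear_span_image[OF g(1)] by simp
    also have "\<dots> = T.span (g ` ?D)"
    proof (rule subset_antisym)
      have "g x = 0" if "x \<in> B" for x
        using that BC(4) g(2) S.span_base[OF that] by force
      then have "g ` C \<subseteq> T.span (g ` ?D)"
        by (metis (no_types, lifting) DiffI T.span_base T.span_zero image_eqI image_subsetI)
      then show "T.span (g ` C) \<subseteq> T.span (g ` ?D)" using T.span_minimal by blast
      show "T.span (g ` ?D) \<subseteq> T.span (g ` C)" by (intro T.span_mono) blast
    qed
    finally show ?thesis .
  qed
  have ind: "T.independent (g ` ?D)"
    using P.linear_independent_injective_image[OF g(1) _ inj] S.independent_mono[OF BC(3), of ?D] by blast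
  show "finite_dim t (f ` V)" unfolding img using BC(1) by (intro T.finite_dim_span) simp
  have "T.dim (f ` V) = card (g ` ?D)" unfolding img using T.dim_eq_card_independent[OF ind] by simp
  also have "\<dots> = card ?D" using inj inj_on_subset S.span_superset by (intro card_image) blast
  also have "\<dots> = S.dim V - S.dim ?K" using card_Diff_subset[OF finite_subset[OF BC(2,1)] BC(2)] BC(6,7) by simp
  finally show "S.dim V = S.dim ?K + T.dim (f ` V)"
    using S.finite_dim_subspace(2)[OF assms(4) K] by auto
qed

lemma dim_le_injective:
  assumes "vector_space s" "vector_space t" "linear_between s t V W f" "finite_dim s V"
    and "finite_dim t W" and "\<And>x. x \<in> V \<Longrightarrow> f x = 0 \<Longrightarrow> x = 0"
  shows "vector_space.dim s V \<le> vector_space.dim t W"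
proof -
  interpret S: vector_space s by fact
  interpret T: vector_space t by fact
  have sub: "S.subspace V" using S.finite_dim_imp_subspace assms(4) .
  have "{x\<in>V. f x = 0} = {0}"
    using assms(6) linear_between_0[OF assms(1-3) sub] S.subspace_0[OF sub] by auto
  moreover have "S.dim {0} = 0" using S.dim_le_card[of "{0}" "{}"] by simp
  ultimately have "S.dim V = T.dim (f ` V)" using rank_nullity(2)[OF assms(1-4)] by simp
  also have "\<dots> \<le> T.dim W"
    using T.finite_dim_subspace(2)[OF assms(5)] linear_between_image_subspace[OF assms(1-3) sub] assms(3)
    by (auto simp: linear_between_def image_subset_iff)
  finally show ?thesis .
qed

text \<open>This realises the quotient of \<open>D\<close> by \<open>L\<close> inside the target
  space: \<open>p\<close> projects \<open>D\<close> onto a complement of \<open>L\<close> by killing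
  a basis of \<open>L\<close>, and the complement is then embedded, for which there is room by
  infinite dimension. Cokernels are formed in this way.\<close>

lemma obtain_linear_with_kernel:
  fixes s :: "'k::field \<Rightarrow> 'b::ab_group_add \<Rightarrow> 'b" and t :: "'k \<Rightarrow> 'c::ab_group_add \<Rightarrow> 'c"
  assumes "vector_space s" "vector_space t" "\<not> finite_dim t UNIV"
    and D: "finite_dim s D" and L: "module.subspace s L" "L \<subseteq> D"
  obtains c where "Vector_Spaces.linear s t c" "{x\<in>D. c x = 0} = L"
proof -
  interpret S: vector_space s by fact
  interpret T: vector_space t by fact
  interpret P: vector_space_pair s t by unfold_locales
  interpret PS: vector_space_pair s s by unfold_locales
  obtain B C where BC: "finite C" "B \<subseteq> C" "S.independent C" "S.span B = L" "S.span C = D"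
    using D L by (rule S.basis_extend)
  obtain p where p: "Vector_Spaces.linear s s p" "\<forall>x\<in>C. p x = (if x \<in> B then 0 else x)"
    using PS.linear_independent_extend[OF BC(3), of "\<lambda>x. if x \<in> B then 0 else x"] by blast
  \<comment> \<open>\<open>p x\<close> is a representative of the class of \<open>x\<close> modulo
    \<open>L\<close>; hence \<open>p x = 0\<close> forces \<open>x\<close> into
    \<open>L\<close>.\<close>
  have pD: "p x \<in> D \<and> x - p x \<in> L" if "x \<in> D" for x
  proof -
    have "x \<in> S.span C" using that BC(5) by simp
    then show ?thesis
    proof (induction rule: S.span_induct_alt)
      case base
      show ?case using PS.linear_0[OF p(1)] S.subspace_0[OF L(1)] L(2) by auto
    next
      case (step c b y)
      have b: "p b \<in> D" "b - p b \<in> L"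
        using p(2) step(1) BC(4,5) S.span_base[of b B] S.span_base[of b C] S.span_zero[of C] S.span_zero[of B] by auto
      have e: "p (s c b + y) = s c (p b) + p y"
        by (simp add: PS.linear_add[OF p(1)] PS.linear_scale[OF p(1)])
      then have e': "s c b + y - p (s c b + y) = s c (b - p b) + (y - p y)"
        by (simp add: S.scale_right_diff_distrib)
      have D': "S.subspace D" using S.finite_dim_imp_subspace[OF D] .
      show ?case
      proof
        show "p (s c b + y) \<in> D"
          unfolding e using step(2) b S.subspace_add[OF D'] S.subspace_scale[OF D'] by simp
        show "s c b + y - p (s c b + y) \<in> L"
          unfolding e' using step(2) b S.subspace_add[OF L(1)] S.subspace_scale[OF L(1)] by simp
      qed
    qed
  qed
  have p0: "p x = 0" if "x \<in> L" for x
  proof (rule PS.linear_eq_0_on_span[OF p(1)])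
    show "x \<in> S.span B" using that BC(4) by simp
    show "p b = 0" if "b \<in> B" for b using p(2) that BC(2) by auto
  qed
  obtain f where f: "Vector_Spaces.linear s t f" "inj_on f D"
    using finite_dim_copy[OF assms(1-3) D] by blast
  show thesis
  proof (rule that)
    show "Vector_Spaces.linear s t (f \<circ> p)" using p(1) f(1) by (rule Vector_Spaces.linear_compose)
    show "{x\<in>D. (f \<circ> p) x = 0} = L"
    proof (intro subset_antisym subsetI)
      fix x assume x: "x \<in> {x\<in>D. (f \<circ> p) x = 0}"
      then have "f (p x) = f 0" using P.linear_0[OF f(1)] by simp
      then have "p x = 0"
        using inj_onD[OF f(2), of "p x" 0] pD[of x] x S.subspace_0[OF S.finite_dim_imp_subspace[OF D]] by simp
      then show "x \<in> L" using pD[of x] x by simp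
    next
      fix x assume "x \<in> L"
      then show "x \<in> {x\<in>D. (f \<circ> p) x = 0}" using p0 L(2) P.linear_0[OF f(1)] by auto
    qed
  qed
qed

section \<open>Finite direct sums as function spaces\<close>

definition fun_scale :: "('k \<Rightarrow> 'b \<Rightarrow> 'b) \<Rightarrow> 'k \<Rightarrow> ('i \<Rightarrow> 'b) \<Rightarrow> 'i \<Rightarrow> 'b" where
  "fun_scale s c f = (\<lambda>i. s c (f i))"

lemma fun_scale_apply: "fun_scale s c f i = s c (f i)"
  by (simp add: fun_scale_def)

text \<open>The external direct sum of the \<open>W i\<close> for finite \<open>I\<close>. The value
  0 off \<open>I\<close> makes distinct functions distinct tuples.\<close>

definition pi_space :: "'i set \<Rightarrow> ('i \<Rightarrow> 'b::zero set) \<Rightarrow> ('i \<Rightarrow> 'b) set" where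
  "pi_space I W = {f. (\<forall>i\<in>I. f i \<in> W i) \<and> (\<forall>i. i \<notin> I \<longrightarrow> f i = 0)}"

definition single :: "'i \<Rightarrow> 'b::zero \<Rightarrow> 'i \<Rightarrow> 'b" where
  "single i x = (\<lambda>j. if j = i then x else 0)"

lemma vector_space_fun_scale:
  "vector_space s \<Longrightarrow> vector_space (fun_scale s :: 'k::field \<Rightarrow> ('i \<Rightarrow> 'b::ab_group_add) \<Rightarrow> _)"
  unfolding vector_space_def fun_scale_def by (auto simp: fun_eq_iff)

lemma subspace_pi_space:
  assumes "vector_space s" "\<And>i. i \<in> I \<Longrightarrow> module.subspace s (W i)"
  shows "module.subspace (fun_scale s) (pi_space I W)"
proof -
  interpret S: vector_space s by fact
  interpret F: vector_space "fun_scale s :: 'a \<Rightarrow> ('i \<Rightarrow> 'b) \<Rightarrow> _"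
    by (rule vector_space_fun_scale[OF assms(1)])
  show ?thesis
    unfolding F.subspace_def
    using assms(2) by (auto simp: pi_space_def fun_scale_def S.subspace_0 S.subspace_add S.subspace_scale)
qed

lemma pi_space_single: "i \<in> I \<Longrightarrow> x \<in> W i \<Longrightarrow> (\<And>j. j \<in> I \<Longrightarrow> 0 \<in> W j) \<Longrightarrow> single i x \<in> pi_space I W"
  by (auto simp: pi_space_def single_def)

lemma pi_space_decompose:
  assumes "finite I" "g \<in> pi_space I (W :: 'i \<Rightarrow> 'b::comm_monoid_add set)"
  shows "(\<Sum>i\<in>I. single i (g i)) = g"
proof
  fix j
  have "(\<Sum>i\<in>I. single i (g i)) j = (\<Sum>i\<in>I. single i (g i) j)"
    by (induction I rule: infinite_finite_induct) auto
  also have "\<dots> = g j" using assms by (auto simp: single_def pi_space_def)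
  finally show "(\<Sum>i\<in>I. single i (g i)) j = g j" .
qed

lemma linear_between_single:
  assumes "vector_space s"
  shows "linear_between s (fun_scale s) UNIV UNIV (single i)"
proof -
  interpret S: vector_space s by fact
  show ?thesis by (auto simp: linear_between_def single_def fun_scale_def fun_eq_iff)
qed

lemma linear_between_subset:
  "linear_between s t V W f \<Longrightarrow> V' \<subseteq> V \<Longrightarrow> (\<And>x. x \<in> V' \<Longrightarrow> f x \<in> W') \<Longrightarrow> linear_between s t V' W' f"
  unfolding linear_between_def by blast

lemma pi_space_dim:
  fixes W :: "'i \<Rightarrow> 'b::ab_group_add set"
  assumes "vector_space s" "finite I" "\<And>i. i \<in> I \<Longrightarrow> finite_dim s (W i)"
  shows "finite_dim (fun_scale s) (pi_space I W) \<and>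
    vector_space.dim (fun_scale s) (pi_space I W) = (\<Sum>i\<in>I. vector_space.dim s (W i))"
proof -
  interpret S: vector_space s by fact
  interpret F: vector_space "fun_scale s :: 'a \<Rightarrow> ('i \<Rightarrow> 'b) \<Rightarrow> _"
    by (rule vector_space_fun_scale[OF assms(1)])
  show ?thesis using assms(2,3)
  proof (induction I rule: finite_induct)
    case empty
    have "pi_space {} W = F.span {}" by (auto simp: pi_space_def fun_eq_iff)
    then show ?case using F.finite_dim_span[of "{}"] F.dim_eq_card_independent[of "{}"] F.dim_span[of "{}"]
      by (simp add: F.independent_empty)
  next
    case (insert j I)
    let ?P = "pi_space (insert j I) W"
    have W: "S.subspace (W i)" if "i \<in> insert j I" for i
      using insert.prems[OF that] S.finite_dim_imp_subspace by blast
    have sub: "F.subspace ?P" using subspace_pi_space[OF assms(1)] W by blast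
    have W0: "0 \<in> W i" if "i \<in> insert j I" for i using W[OF that] S.subspace_0 by blast
    have single: "linear_between s (fun_scale s) (W j) ?P (single j)"
      by (rule linear_between_subset[OF linear_between_single[OF assms(1)]])
        (auto intro!: pi_space_single W0)
    \<comment> \<open>Finiteness has to come first: the dimension is obtained below by rank and
      nullity of the evaluation at \<open>j\<close>, which presuppose it.\<close>
    have fin: "finite_dim (fun_scale s) ?P"
    proof (rule F.finite_dim_sum[OF _ _ sub])
      show "finite_dim (fun_scale s) (pi_space I W)" using insert by blast
      show "finite_dim (fun_scale s) (single j ` W j)"
        using rank_nullity(1)[OF assms(1) F.vector_space_axioms single] insert.prems by blast
      show "?P \<subseteq> {x + y |x y. x \<in> pi_space I W \<and> y \<in> single j ` W j}"
      proof
        fix f assume f: "f \<in> ?P"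
        have "f = f(j := 0) + single j (f j)" by (auto simp: single_def)
        moreover have "f(j := 0) \<in> pi_space I W" "f j \<in> W j"
          using f insert.hyps(2) by (auto simp: pi_space_def)
        ultimately show "f \<in> {x + y |x y. x \<in> pi_space I W \<and> y \<in> single j ` W j}" by blast
      qed
    qed
    have ev: "linear_between (fun_scale s) s ?P (W j) (\<lambda>f. f j)"
      by (auto simp: linear_between_def pi_space_def fun_scale_def)
    have "{f \<in> ?P. f j = 0} = pi_space I W"
      using insert.hyps(2) W0[of j] by (auto simp: pi_space_def)
    moreover have "(\<lambda>f. f j) ` ?P = W j"
    proof
      show "(\<lambda>f. f j) ` ?P \<subseteq> W j" by (auto simp: pi_space_def)
      show "W j \<subseteq> (\<lambda>f. f j) ` ?P"
      proof
        fix x assume "x \<in> W j"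
        then have "single j x \<in> ?P" using single unfolding linear_between_def by blast
        then show "x \<in> (\<lambda>f. f j) ` ?P" by (rule rev_image_eqI) (simp add: single_def)
      qed
    qed
    ultimately have "F.dim ?P = F.dim (pi_space I W) + S.dim (W j)"
      using rank_nullity(2)[OF F.vector_space_axioms assms(1) ev fin] by simp
    then show ?case using insert fin by simp
  qed
qed

section \<open>Homomorphism spaces\<close>

lemma sum_Sigma_fst:
  fixes h :: "'i \<Rightarrow> nat"
  assumes "finite A" "\<And>i. i \<in> A \<Longrightarrow> finite (B i)"
  shows "(\<Sum>p\<in>Sigma A B. h (fst p)) = (\<Sum>i\<in>A. card (B i) * h i)"
  using sum.Sigma[of A B "\<lambda>i _. h i"] assms by (simp add: case_prod_beta)

lemma fd_repD:
  assumes "fd_rep Q s V"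
  shows "i \<in> verts Q \<Longrightarrow> finite_dim s (rep_space V i)"
    and "i \<in> verts Q \<Longrightarrow> module.subspace s (rep_space V i)"
    and "a \<in> arcs Q \<Longrightarrow> linear_between s s (rep_space V (tail Q a)) (rep_space V (head Q a)) (rep_map V a)"
  using assms by (auto simp: fd_rep_def finite_dim_def)

text \<open>
  A morphism is determined by its values on bases of the spaces at the vertices; this identifies
  the Hom space with the kernel of a linear map between finite direct sums, whose dimensions are
  the two sums in the Euler form.
\<close>

lemma hom_dim_euler_form:
  fixes s :: "'k::field \<Rightarrow> 'b::ab_group_add \<Rightarrow> 'b" and t :: "'k \<Rightarrow> 'c::ab_group_add \<Rightarrow> 'c"
    and U :: "('v, 'a, 'b) quiver_rep"
  assumes Q: "fin_digraph Q" and s: "vector_space s" and t: "vector_space t"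
    and U: "fd_rep Q s U" and V: "fd_rep Q t V"
  shows "finite_dim (family_scale t) (rep_hom Q s t U V)"
    and "euler_form Q (dimension_vector s U) (dimension_vector t V) \<le> int (hom_dim Q s t U V)"
proof -
  interpret fin_digraph Q by fact
  interpret S: vector_space s by fact
  interpret T: vector_space t by fact
  interpret F: vector_space "fun_scale t :: 'k \<Rightarrow> ('i \<Rightarrow> 'c) \<Rightarrow> _"
    by (rule vector_space_fun_scale[OF t])
  interpret H: vector_space "family_scale t :: 'k \<Rightarrow> ('v \<Rightarrow> 'b \<Rightarrow> 'c) \<Rightarrow> _"
    by (rule vector_space_family_scale[OF t])
  have "\<forall>i\<in>verts Q. \<exists>B. finite B \<and> S.independent B \<and> S.span B = rep_space U i \<and> card B = S.dim (rep_space U i)"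
    using S.finite_dim_basis fd_repD(1)[OF U] by metis
  then obtain B where B: "\<And>i. i \<in> verts Q \<Longrightarrow> finite (B i)" "\<And>i. i \<in> verts Q \<Longrightarrow> S.independent (B i)"
    "\<And>i. i \<in> verts Q \<Longrightarrow> S.span (B i) = rep_space U i"
    "\<And>i. i \<in> verts Q \<Longrightarrow> card (B i) = S.dim (rep_space U i)"
    by metis
  have BU: "b \<in> rep_space U i" if "i \<in> verts Q" "b \<in> B i" for i b
    using that B(3) S.span_base by blast
  \<comment> \<open>\<open>\<phi> g\<close> is the linear extension of an assignment
    \<open>g\<close> of vectors to the basis elements; it ignores the arrows, so it need not be a
    morphism.\<close>
  define \<phi> where "\<phi> g i x = (if i \<in> verts Q \<and> x \<in> rep_space U i
      then \<Sum>b\<in>B i. t (S.representation (B i) x b) (g (i, b)) else 0)" for g :: "'v \<times> 'b \<Rightarrow> 'c" and i x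
  have \<phi>B: "\<phi> g i b = g (i, b)" if "i \<in> verts Q" "b \<in> B i" for g i b
  proof -
    have "\<phi> g i b = (\<Sum>b'\<in>B i. t (if b = b' then 1 else 0) (g (i, b')))"
      using that BU S.representation_basis[OF B(2)[OF that(1)] that(2)]
      by (auto simp: \<phi>_def intro!: sum.cong)
    also have "\<dots> = (\<Sum>b'\<in>B i. if b = b' then g (i, b') else 0)" by (intro sum.cong) auto
    also have "\<dots> = g (i, b)" using that B(1) by simp
    finally show ?thesis .
  qed
  let ?X = "Sigma (verts Q) B"
  let ?Y = "Sigma (arcs Q) (\<lambda>a. B (tail Q a))"
  let ?PX = "pi_space ?X (\<lambda>p. rep_space V (fst p))"
  let ?PY = "pi_space ?Y (\<lambda>p. rep_space V (head Q (fst p)))"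
  have fX: "finite ?X" and fY: "finite ?Y" using B(1) by (auto intro!: finite_SigmaI)
  have dX: "finite_dim (fun_scale t) ?PX"
    "F.dim ?PX = (\<Sum>i\<in>verts Q. S.dim (rep_space U i) * T.dim (rep_space V i))"
    using pi_space_dim[OF t fX, of "\<lambda>p. rep_space V (fst p)"] fd_repD(1)[OF V] B(1,4)
      sum_Sigma_fst[of "verts Q" B "\<lambda>i. T.dim (rep_space V i)"] by auto
  have dY: "finite_dim (fun_scale t) ?PY"
    "F.dim ?PY = (\<Sum>a\<in>arcs Q. S.dim (rep_space U (tail Q a)) * T.dim (rep_space V (head Q a)))"
    using pi_space_dim[OF t fY, of "\<lambda>p. rep_space V (head Q (fst p))"] fd_repD(1)[OF V] B(1,4)
      sum_Sigma_fst[of "arcs Q" "\<lambda>a. B (tail Q a)" "\<lambda>a. T.dim (rep_space V (head Q a))"] by auto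
  have lin\<phi>: "linear_between s t (rep_space U i) (rep_space V i) (\<phi> g i)"
    if "i \<in> verts Q" "g \<in> ?PX" for g i
    unfolding linear_between_def
  proof (intro conjI ballI allI)
    fix x assume x: "x \<in> rep_space U i"
    have "g (i, b) \<in> rep_space V i" if "b \<in> B i" for b
      using \<open>g \<in> ?PX\<close> \<open>i \<in> verts Q\<close> that by (auto simp: pi_space_def)
    then show "\<phi> g i x \<in> rep_space V i"
      using that(1) x fd_repD(2)[OF V that(1)]
      by (auto simp: \<phi>_def intro!: T.subspace_sum T.subspace_scale)
    fix c
    show "\<phi> g i (s c x) = t c (\<phi> g i x)"
      using that(1) x S.subspace_scale[OF fd_repD(2)[OF U that(1)] x]
        S.representation_scale[OF B(2)[OF that(1)]] B(3)[OF that(1)]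
      by (auto simp: \<phi>_def T.scale_sum_right)
  next
    fix x y assume "x \<in> rep_space U i" "y \<in> rep_space U i"
    then show "\<phi> g i (x + y) = \<phi> g i x + \<phi> g i y"
      using that(1) S.subspace_add[OF fd_repD(2)[OF U that(1)]]
        S.representation_add[OF B(2)[OF that(1)]] B(3)[OF that(1)]
      by (auto simp: \<phi>_def T.scale_left_distrib sum.distrib)
  qed
  have \<phi>add: "\<phi> (g + h) = \<phi> g + \<phi> h" and \<phi>scale: "\<phi> (fun_scale t c g) = family_scale t c (\<phi> g)" for g h c
    by (auto simp: \<phi>_def fun_eq_iff T.scale_right_distrib sum.distrib fun_scale_def family_scale_def
        T.scale_sum_right mult.commute)
  have lin_eq: "f x = h x"
    if i: "i \<in> verts Q" and j: "j \<in> verts Q" and f: "linear_between s t (rep_space U i) (rep_space V j) f"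
      and h: "linear_between s t (rep_space U i) (rep_space V j) h"
      and eq: "\<And>b. b \<in> B i \<Longrightarrow> f b = h b" and x: "x \<in> rep_space U i" for f h i j x
  proof -
    have "x \<in> S.span (B i)" using x B(3) i by simp
    then have "x \<in> rep_space U i \<and> f x = h x"
    proof (induction rule: S.span_induct_alt)
      case base
      show ?case using linear_between_0[OF s t] f h fd_repD(2)[OF U i] S.subspace_0 by metis
    next
      case (step c b y)
      have "s c b \<in> rep_space U i" using BU[OF i step(1)] S.subspace_scale[OF fd_repD(2)[OF U i]] by blast
      then show ?case
        using step eq f h BU[OF i step(1)] S.subspace_add[OF fd_repD(2)[OF U i]]
        by (auto simp: linear_between_def)
    qed
    then show ?thesis by blast
  qed
  have hom_sub: "rep_hom Q s t U V \<subseteq> \<phi> ` ?PX"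
  proof
    fix \<psi> assume \<psi>: "\<psi> \<in> rep_hom Q s t U V"
    define g where "g = (\<lambda>(i, b). if (i, b) \<in> ?X then \<psi> i b else 0)"
    have g: "g \<in> ?PX" using \<psi> BU by (auto simp: g_def pi_space_def rep_hom_def linear_between_def)
    have "\<phi> g i x = \<psi> i x" for i x
    proof (cases "i \<in> verts Q \<and> x \<in> rep_space U i")
      case True
      show ?thesis
      proof (rule lin_eq)
        show "linear_between s t (rep_space U i) (rep_space V i) (\<phi> g i)" using lin\<phi> g True by blast
        show "linear_between s t (rep_space U i) (rep_space V i) (\<psi> i)" using \<psi> True by (auto simp: rep_hom_def)
        show "\<phi> g i b = \<psi> i b" if "b \<in> B i" for b using \<phi>B that True by (simp add: g_def)
      qed (use True in auto)
    next
      case False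
      then show ?thesis using \<psi> by (auto simp: \<phi>_def rep_hom_def)
    qed
    then have "\<psi> = \<phi> g" by (auto simp: fun_eq_iff)
    then show "\<psi> \<in> \<phi> ` ?PX" using g by blast
  qed
  have l\<phi>: "linear_between (fun_scale t) (family_scale t) ?PX (\<phi> ` ?PX) \<phi>"
    by (auto simp: linear_between_def \<phi>add \<phi>scale)
  have fin: "finite_dim (family_scale t) (\<phi> ` ?PX)"
    using rank_nullity(1)[OF F.vector_space_axioms H.vector_space_axioms l\<phi> dX(1)] .
  show finH: "finite_dim (family_scale t) (rep_hom Q s t U V)"
    using H.finite_dim_subspace(1)[OF fin _ hom_sub] subspace_rep_hom[OF wf_digraph_axioms t V] by blast
  \<comment> \<open>\<open>\<omega> g\<close> records on basis vectors by how much the squares of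
    \<open>\<phi> g\<close> fail to commute. Its kernel is the Hom space and its cokernel is Ext^1;
    bounding the rank by the dimension of the target discards the latter and leaves an
    inequality.\<close>
  define \<omega> where "\<omega> g = (\<lambda>(a, b). if (a, b) \<in> ?Y
      then \<phi> g (head Q a) (rep_map U a b) - rep_map V a (\<phi> g (tail Q a) b) else 0)" for g
  have Ub: "rep_map U a b \<in> rep_space U (head Q a)" if "a \<in> arcs Q" "b \<in> rep_space U (tail Q a)" for a b
    using fd_repD(3)[OF U that(1)] that(2) by (auto simp: linear_between_def)
  have \<phi>in: "\<phi> g i x \<in> rep_space V i" if "g \<in> ?PX" "i \<in> verts Q" "x \<in> rep_space U i" for g i x
    using lin\<phi>[OF that(2,1)] that(3) by (auto simp: linear_between_def)
  have Vadd: "rep_map V a (x + y) = rep_map V a x + rep_map V a y"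
    if "a \<in> arcs Q" "x \<in> rep_space V (tail Q a)" "y \<in> rep_space V (tail Q a)" for a x y
    using fd_repD(3)[OF V that(1)] that(2,3) by (auto simp: linear_between_def)
  have Vscale: "rep_map V a (t c x) = t c (rep_map V a x)"
    and Vin: "rep_map V a x \<in> rep_space V (head Q a)"
    if "a \<in> arcs Q" "x \<in> rep_space V (tail Q a)" for a x c
    using fd_repD(3)[OF V that(1)] that(2) by (auto simp: linear_between_def)
  have l\<omega>: "linear_between (fun_scale t) (fun_scale t) ?PX ?PY \<omega>"
    unfolding linear_between_def
  proof (intro conjI ballI allI)
    fix g assume g: "g \<in> ?PX"
    have "\<phi> g (head Q a) (rep_map U a b) - rep_map V a (\<phi> g (tail Q a) b) \<in> rep_space V (head Q a)"
      if "a \<in> arcs Q" "b \<in> B (tail Q a)" for a b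
      using that g BU[of "tail Q a" b] by (auto intro!: T.subspace_diff fd_repD(2)[OF V] \<phi>in Vin Ub)
    then show "\<omega> g \<in> ?PY" by (auto simp: \<omega>_def pi_space_def)
    fix c
    show "\<omega> (fun_scale t c g) = fun_scale t c (\<omega> g)"
      using g BU by (auto simp: \<omega>_def fun_eq_iff \<phi>scale fun_scale_apply
          family_scale_def T.scale_right_diff_distrib Vscale \<phi>in)
  next
    fix g h assume "g \<in> ?PX" "h \<in> ?PX"
    then show "\<omega> (g + h) = \<omega> g + \<omega> h"
      using BU by (auto simp: \<omega>_def fun_eq_iff \<phi>add Vadd \<phi>in)
  qed
  let ?K = "{g \<in> ?PX. \<omega> g = 0}"
  have "\<phi> g \<in> rep_hom Q s t U V" if g: "g \<in> ?K" for g
  proof -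
    have "\<phi> g (head Q a) (rep_map U a x) = rep_map V a (\<phi> g (tail Q a) x)"
      if a: "a \<in> arcs Q" and x: "x \<in> rep_space U (tail Q a)" for a x
    proof (rule lin_eq[of "tail Q a" "head Q a" "\<lambda>x. \<phi> g (head Q a) (rep_map U a x)"
          "\<lambda>x. rep_map V a (\<phi> g (tail Q a) x)"])
      have v: "tail Q a \<in> verts Q" "head Q a \<in> verts Q" using a by auto
      have l1: "linear_between s t (rep_space U (head Q a)) (rep_space V (head Q a)) (\<phi> g (head Q a))"
        "linear_between s t (rep_space U (tail Q a)) (rep_space V (tail Q a)) (\<phi> g (tail Q a))"
        using lin\<phi> g v by blast+
      show "linear_between s t (rep_space U (tail Q a)) (rep_space V (head Q a)) (\<lambda>x. \<phi> g (head Q a) (rep_map U a x))"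
        using l1(1) fd_repD(3)[OF U a] by (auto simp: linear_between_def)
      show "linear_between s t (rep_space U (tail Q a)) (rep_space V (head Q a)) (\<lambda>x. rep_map V a (\<phi> g (tail Q a) x))"
        using l1(2) fd_repD(3)[OF V a] by (auto simp: linear_between_def)
      fix b assume "b \<in> B (tail Q a)"
      then have "\<omega> g (a, b) = \<phi> g (head Q a) (rep_map U a b) - rep_map V a (\<phi> g (tail Q a) b)"
        using a by (simp add: \<omega>_def)
      then show "\<phi> g (head Q a) (rep_map U a b) = rep_map V a (\<phi> g (tail Q a) b)" using g by simp
    qed (use a x in auto)
    then show ?thesis using g lin\<phi> by (auto simp: rep_hom_def \<phi>_def)
  qed
  then have lK: "linear_between (fun_scale t) (family_scale t) ?K (rep_hom Q s t U V) \<phi>"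
    by (auto simp: linear_between_def \<phi>add \<phi>scale)
  have subX: "F.subspace ?PX" using F.finite_dim_imp_subspace[OF dX(1)] .
  have finK: "finite_dim (fun_scale t) ?K"
    using F.finite_dim_subspace(1)[OF dX(1)]
      linear_between_kernel[OF F.vector_space_axioms F.vector_space_axioms l\<omega> subX] by blast
  have "F.dim ?K \<le> hom_dim Q s t U V"
    unfolding hom_dim_def
  proof (rule dim_le_injective[OF F.vector_space_axioms H.vector_space_axioms lK finK finH])
    fix g assume g: "g \<in> ?K" "\<phi> g = 0"
    show "g = 0"
    proof
      fix p show "g p = 0 p"
      proof (cases "p \<in> ?X")
        case True
        then show ?thesis using \<phi>B[of "fst p" "snd p" g] g(2) by auto
      next
        case False
        then show ?thesis using g(1) by (cases p) (auto simp: pi_space_def)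
      qed
    qed
  qed
  moreover have "F.dim (\<omega> ` ?PX) \<le> F.dim ?PY"
    using F.finite_dim_subspace(2)[OF dY(1)]
      linear_between_image_subspace[OF F.vector_space_axioms F.vector_space_axioms l\<omega> subX] l\<omega>
    by (auto simp: linear_between_def image_subset_iff)
  moreover have "F.dim ?PX = F.dim ?K + F.dim (\<omega> ` ?PX)"
    using rank_nullity(2)[OF F.vector_space_axioms F.vector_space_axioms l\<omega> dX(1)] .
  ultimately have "int (F.dim ?PX) - int (F.dim ?PY) \<le> int (hom_dim Q s t U V)" by linarith
  then show "euler_form Q (dimension_vector s U) (dimension_vector t V) \<le> int (hom_dim Q s t U V)"
    by (simp add: dX(2) dY(2) euler_form_def dimension_vector_def)
qed

section \<open>Reflections of dimension vectors\<close>

text \<open>The adjacency operator of the underlying graph, with parallel arrows counted separately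
  and a loop counted twice. Being blind to the orientation, it is unchanged when arrows are
  reversed. Integer and real values both occur.\<close>

definition nbr_sum :: "('v, 'a) pre_digraph \<Rightarrow> ('v \<Rightarrow> 'n::comm_monoid_add) \<Rightarrow> 'v \<Rightarrow> 'n" where
  "nbr_sum Q x v = (\<Sum>a\<in>arcs Q. (if head Q a = v then x (tail Q a) else 0) + (if tail Q a = v then x (head Q a) else 0))"

text \<open>
  Such a weight is a certificate for the positive definiteness of the Tits form; in contrast to
  the Dynkin property itself it obviously survives the deletion of vertices.
\<close>

definition subadditive_weight :: "('v, 'a) pre_digraph \<Rightarrow> ('v \<Rightarrow> int) \<Rightarrow> bool" where
  "subadditive_weight Q y \<longleftrightarrow> (\<forall>v\<in>verts Q. y v > 0 \<and> nbr_sum Q y v < 2 * y v)"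

lemma nbr_sum_add: "nbr_sum Q (x + z) v = nbr_sum Q x v + nbr_sum Q z v"
proof -
  have "nbr_sum Q (x + z) v = (\<Sum>a\<in>arcs Q.
      ((if head Q a = v then x (tail Q a) else 0) + (if tail Q a = v then x (head Q a) else 0)) +
      ((if head Q a = v then z (tail Q a) else 0) + (if tail Q a = v then z (head Q a) else 0)))"
    unfolding nbr_sum_def by (rule sum.cong) (auto simp: add_ac)
  then show ?thesis by (simp add: nbr_sum_def sum.distrib)
qed

lemma nbr_sum_zero: "nbr_sum Q (\<lambda>v. 0) v = 0"
  unfolding nbr_sum_def by (rule sum.neutral) auto

lemma nbr_sum_of_int: "nbr_sum Q (\<lambda>v. of_int (x v)) v = of_int (nbr_sum Q x v)"
  unfolding nbr_sum_def of_int_sum by (rule sum.cong) auto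

lemma nbr_sum_cong:
  assumes "wf_digraph Q" "\<And>u. u \<in> verts Q \<Longrightarrow> x u = z u"
  shows "nbr_sum Q x v = nbr_sum Q z v"
proof -
  interpret wf_digraph Q by fact
  show ?thesis unfolding nbr_sum_def using assms(2) by (intro sum.cong) auto
qed

lemma sum_nbr_sum:
  fixes g x :: "'v \<Rightarrow> 'n::comm_semiring_1"
  assumes "fin_digraph Q"
  shows "(\<Sum>v\<in>verts Q. g v * nbr_sum Q x v) = (\<Sum>a\<in>arcs Q. g (head Q a) * x (tail Q a) + g (tail Q a) * x (head Q a))"
proof -
  interpret fin_digraph Q by fact
  have "(\<Sum>v\<in>verts Q. g v * nbr_sum Q x v) = (\<Sum>a\<in>arcs Q. \<Sum>v\<in>verts Q.
      (if head Q a = v then g v * x (tail Q a) else 0) + (if tail Q a = v then g v * x (head Q a) else 0))"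
    unfolding nbr_sum_def sum_distrib_left
    by (subst sum.swap) (auto intro!: sum.cong simp: algebra_simps)
  also have "\<dots> = (\<Sum>a\<in>arcs Q. g (head Q a) * x (tail Q a) + g (tail Q a) * x (head Q a))"
    by (intro sum.cong) (auto simp: sum.distrib)
  finally show ?thesis .
qed

text \<open>The simple reflection at \<open>v\<close>, with the neighbour sum as a parameter
  \<open>N\<close>: one and the same \<open>N\<close> serves for all the quivers obtained by
  reversing arrows.\<close>

definition reflect :: "(('v \<Rightarrow> int) \<Rightarrow> 'v \<Rightarrow> int) \<Rightarrow> 'v \<Rightarrow> ('v \<Rightarrow> int) \<Rightarrow> 'v \<Rightarrow> int" where
  "reflect N v x = x(v := N x v - x v)"

text \<open>Twice the usual Tits form, that is, the symmetrised Euler form of \<open>x\<close> with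
  itself.\<close>

definition tits_form :: "('v, 'a) pre_digraph \<Rightarrow> ('v \<Rightarrow> int) \<Rightarrow> int" where
  "tits_form Q x = (\<Sum>v\<in>verts Q. x v * (2 * x v - nbr_sum Q x v))"

lemma subadditive_weight_no_loops:
  assumes Q: "fin_digraph Q" and y: "subadditive_weight Q y" and a: "a \<in> arcs Q"
  shows "tail Q a \<noteq> head Q a"
proof
  interpret fin_digraph Q by fact
  assume eq: "tail Q a = head Q a"
  let ?v = "head Q a"
  have pos: "0 \<le> y (tail Q a)" "0 \<le> y (head Q a)" if "a \<in> arcs Q" for a
    using y that by (auto simp: subadditive_weight_def intro: less_imp_le)
  \<comment> \<open>The loop alone contributes the weight of its vertex twice, against the strict
    subadditivity there.\<close>
  have "2 * y ?v \<le> nbr_sum Q y ?v"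
  proof -
    have "2 * y ?v = (if head Q a = ?v then y (tail Q a) else 0) + (if tail Q a = ?v then y (head Q a) else 0)"
      using eq by simp
    also have "\<dots> \<le> nbr_sum Q y ?v"
      unfolding nbr_sum_def
      using pos by (intro member_le_sum[OF a]) (auto intro!: add_nonneg_nonneg)
    finally show ?thesis .
  qed
  then show False using y head_in_verts[OF a] by (force simp: subadditive_weight_def)
qed

text \<open>The reflected vector is \<open>x + r \<delta>\<close> with \<open>\<delta>\<close> the
  simple root at \<open>v\<close>. In the symmetric form, \<open>x\<close> pairs with
  \<open>\<delta>\<close> to \<open>- r\<close> and \<open>\<delta>\<close> with itself to 2, there
  being no loop; so the changes \<open>- 2 r r\<close> and \<open>2 r r\<close> cancel.\<close>

lemma tits_form_reflect:
  assumes Q: "fin_digraph Q" and v: "v \<in> verts Q" and noloop: "\<And>a. a \<in> arcs Q \<Longrightarrow> tail Q a \<noteq> head Q a"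
  shows "tits_form Q (reflect (nbr_sum Q) v x) = tits_form Q x"
proof -
  interpret fin_digraph Q by fact
  define r where "r = nbr_sum Q x v - 2 * x v"
  define \<delta> :: "'a \<Rightarrow> int" where "\<delta> u = (if u = v then 1 else 0)" for u
  have N\<delta>: "nbr_sum Q \<delta> v = 0"
    unfolding nbr_sum_def \<delta>_def using noloop by (intro sum.neutral) auto
  have N: "nbr_sum Q (reflect (nbr_sum Q) v x) u = nbr_sum Q x u + r * nbr_sum Q \<delta> u" for u
  proof -
    have "reflect (nbr_sum Q) v x = x + (\<lambda>u. r * \<delta> u)"
      by (auto simp: reflect_def r_def \<delta>_def)
    moreover have "nbr_sum Q (\<lambda>u. r * \<delta> u) u = r * nbr_sum Q \<delta> u"
      unfolding nbr_sum_def sum_distrib_left by (intro sum.cong) (auto simp: algebra_simps)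
    ultimately show ?thesis by (simp add: nbr_sum_add)
  qed
  have sym: "(\<Sum>u\<in>verts Q. x u * nbr_sum Q \<delta> u) = nbr_sum Q x v"
  proof -
    have "(\<Sum>u\<in>verts Q. x u * nbr_sum Q \<delta> u) = (\<Sum>u\<in>verts Q. \<delta> u * nbr_sum Q x u)"
      unfolding sum_nbr_sum[OF Q] by (intro sum.cong) (auto simp: algebra_simps)
    also have "\<dots> = nbr_sum Q x v"
      using v by (auto simp: \<delta>_def if_distrib[of "\<lambda>z. z * _"] cong: if_cong)
    finally show ?thesis .
  qed
  have "tits_form Q (reflect (nbr_sum Q) v x) =
      (\<Sum>u\<in>verts Q. (x u + r * \<delta> u) * (2 * (x u + r * \<delta> u) - (nbr_sum Q x u + r * nbr_sum Q \<delta> u)))"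
    unfolding tits_form_def N by (intro sum.cong) (auto simp: reflect_def r_def \<delta>_def)
  also have "\<dots> = (\<Sum>u\<in>verts Q. x u * (2 * x u - nbr_sum Q x u)
      + \<delta> u * (4 * r * x u - r * nbr_sum Q x u + 2 * r * r * \<delta> u - r * r * nbr_sum Q \<delta> u)
      - r * (x u * nbr_sum Q \<delta> u))"
    by (intro sum.cong) (auto simp: algebra_simps)
  also have "\<dots> = tits_form Q x + (4 * r * x v - r * nbr_sum Q x v + 2 * r * r - r * r * nbr_sum Q \<delta> v)
      - r * nbr_sum Q x v"
    using v sym by (simp add: sum.distrib sum_subtractf tits_form_def sum_distrib_left[symmetric])
      (auto simp: \<delta>_def if_distrib[of "\<lambda>z. z * _"] cong: if_cong)
  also have "\<dots> = tits_form Q x"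
    unfolding N\<delta> by (simp add: r_def algebra_simps)
  finally show ?thesis .
qed

text \<open>Along each arrow the mixed term \<open>2 X_u X_v\<close> is at most
  \<open>(Y_v / Y_u) X_u^2 + (Y_u / Y_v) X_v^2\<close>, by expanding the square of
  \<open>X_u / Y_u - X_v / Y_v\<close>. Summation turns the right side into neighbour sums of the
  weight, and strict subadditivity makes the remaining diagonal form positive.\<close>

lemma tits_form_lower_bound:
  assumes Q: "fin_digraph Q" and y: "subadditive_weight Q y"
  shows "(\<Sum>v\<in>verts Q. real_of_int (2 * y v - nbr_sum Q y v) / real_of_int (y v) * (real_of_int (x v))\<^sup>2) \<le> real_of_int (tits_form Q x)"
proof -
  interpret fin_digraph Q by fact
  define Y X where "Y v = real_of_int (y v)" and "X v = real_of_int (x v)" for v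
  have pos: "Y v > 0" if "v \<in> verts Q" for v using y that by (auto simp: subadditive_weight_def Y_def)
  have amgm: "2 * (X u * X v) \<le> Y v / Y u * (X u)\<^sup>2 + Y u / Y v * (X v)\<^sup>2" if "u \<in> verts Q" "v \<in> verts Q" for u v
  proof -
    have "0 \<le> Y u * Y v * (X u / Y u - X v / Y v)\<^sup>2" using pos that by (simp add: less_imp_le)
    also have "\<dots> = Y v / Y u * (X u)\<^sup>2 + Y u / Y v * (X v)\<^sup>2 - 2 * (X u * X v)"
      using pos[OF that(1)] pos[OF that(2)] by (simp add: field_simps power2_eq_square)
    finally show ?thesis by simp
  qed
  have "(\<Sum>v\<in>verts Q. X v * nbr_sum Q X v) = (\<Sum>a\<in>arcs Q. 2 * (X (head Q a) * X (tail Q a)))"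
    unfolding sum_nbr_sum[OF Q] by (intro sum.cong) auto
  also have "\<dots> \<le> (\<Sum>a\<in>arcs Q. (X (head Q a))\<^sup>2 / Y (head Q a) * Y (tail Q a) + (X (tail Q a))\<^sup>2 / Y (tail Q a) * Y (head Q a))"
  proof (rule sum_mono)
    fix a assume "a \<in> arcs Q"
    then show "2 * (X (head Q a) * X (tail Q a)) \<le> (X (head Q a))\<^sup>2 / Y (head Q a) * Y (tail Q a) + (X (tail Q a))\<^sup>2 / Y (tail Q a) * Y (head Q a)"
      using amgm[of "head Q a" "tail Q a"] by (simp add: mult.commute)
  qed
  also have "\<dots> = (\<Sum>v\<in>verts Q. (X v)\<^sup>2 / Y v * nbr_sum Q Y v)" unfolding sum_nbr_sum[OF Q] ..
  finally have *: "(\<Sum>v\<in>verts Q. X v * nbr_sum Q X v) \<le> (\<Sum>v\<in>verts Q. (X v)\<^sup>2 / Y v * nbr_sum Q Y v)" .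
  have "(\<Sum>v\<in>verts Q. (2 * Y v - nbr_sum Q Y v) / Y v * (X v)\<^sup>2)
      = (\<Sum>v\<in>verts Q. 2 * (X v)\<^sup>2 - (X v)\<^sup>2 / Y v * nbr_sum Q Y v)"
    using pos by (intro sum.cong) (force simp: field_simps)+
  also have "\<dots> \<le> (\<Sum>v\<in>verts Q. 2 * (X v)\<^sup>2 - X v * nbr_sum Q X v)"
    using * by (simp add: sum_subtractf)
  also have "\<dots> = real_of_int (tits_form Q x)"
    unfolding tits_form_def X_def nbr_sum_of_int of_int_sum
    by (intro sum.cong) (auto simp: algebra_simps power2_eq_square)
  finally show ?thesis by (simp add: Y_def[abs_def] X_def nbr_sum_of_int)
qed

text \<open>Each coordinate is controlled by its own term of the diagonal lower bound; for integers
  the absolute value is at most the square, which avoids square roots.\<close>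

lemma tits_form_bound:
  assumes Q: "fin_digraph Q" and y: "subadditive_weight Q y"
  obtains C where "\<And>x v. tits_form Q x \<le> c \<Longrightarrow> v \<in> verts Q \<Longrightarrow> \<bar>x v\<bar> \<le> (C :: int)"
proof -
  interpret fin_digraph Q by fact
  define p where "p v = real_of_int (2 * y v - nbr_sum Q y v) / real_of_int (y v)" for v
  have p: "p v > 0" if "v \<in> verts Q" for v using y that by (auto simp: subadditive_weight_def p_def)
  have b: "\<bar>x v\<bar> \<le> \<lceil>real_of_int c / p v\<rceil>" if x: "tits_form Q x \<le> c" and v: "v \<in> verts Q" for x v
  proof -
    have "p v * (real_of_int (x v))\<^sup>2 \<le> (\<Sum>v\<in>verts Q. p v * (real_of_int (x v))\<^sup>2)"
      using p by (intro member_le_sum[OF v]) (auto simp: less_imp_le)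
    also have "\<dots> \<le> real_of_int c"
      using tits_form_lower_bound[OF Q y, of x] x unfolding p_def by linarith
    finally have "(real_of_int (x v))\<^sup>2 \<le> real_of_int c / p v"
      using p[OF v] by (simp add: field_simps)
    moreover have "\<bar>x v\<bar> \<le> (x v)\<^sup>2"
      using self_le_power[of "\<bar>x v\<bar>" 2] by (cases "x v = 0") auto
    then have "real_of_int \<bar>x v\<bar> \<le> (real_of_int (x v))\<^sup>2"
      by (metis of_int_le_iff of_int_power)
    ultimately show ?thesis by linarith
  qed
  \<comment> \<open>The sum serves as a bound that is uniform in the vertex.\<close>
  define C where "C = (\<Sum>v\<in>verts Q. \<bar>\<lceil>real_of_int c / p v\<rceil>\<bar>)"
  show thesis
  proof (rule that[of C])
    fix x v assume "tits_form Q x \<le> c" and v: "v \<in> verts Q"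
    then have "\<bar>x v\<bar> \<le> \<bar>\<lceil>real_of_int c / p v\<rceil>\<bar>" using b by fastforce
    also have "\<dots> \<le> C" unfolding C_def by (rule member_le_sum[OF v]) auto
    finally show "\<bar>x v\<bar> \<le> C" .
  qed
qed

section \<open>Reflecting repeatedly leaves the positive cone\<close>

text \<open>
  The reflections are made cyclically in the vertices \<open>vs\<close>; it is not required that
  \<open>t\<close> is the first time at which a new coordinate is nonpositive.
\<close>

primrec stops :: "(('v \<Rightarrow> int) \<Rightarrow> 'v \<Rightarrow> int) \<Rightarrow> 'v list \<Rightarrow> ('v \<Rightarrow> int) \<Rightarrow> nat \<Rightarrow> bool" where
  "stops N vs x 0 \<longleftrightarrow> reflect N (hd vs) x (hd vs) \<le> 0"
| "stops N vs x (Suc t) \<longleftrightarrow> stops N (rotate1 vs) (reflect N (hd vs) x) t"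

text \<open>Each reflection changes one coordinate, and not stopping at time 0 says that this
  coordinate is positive. So nonnegativity survives the reflections in \<open>us\<close>, after
  which the cyclic list has been rotated by \<open>us\<close>.\<close>

lemma not_stops_fold:
  assumes "\<And>t. \<not> stops N (us @ ws) x t" "\<forall>v\<in>V. x v \<ge> 0"
  shows "(\<forall>t. \<not> stops N (ws @ us) (fold (reflect N) us x) t) \<and> (\<forall>v\<in>V. fold (reflect N) us x v \<ge> 0)"
  using assms
proof (induction us arbitrary: ws x)
  case (Cons u us)
  let ?x = "reflect N u x"
  have "\<not> stops N (us @ (ws @ [u])) ?x t" for t using Cons.prems(1)[of "Suc t"] by simp
  moreover have "\<forall>v\<in>V. ?x v \<ge> 0"
    using Cons.prems(1)[of 0] Cons.prems(2) by (auto simp: reflect_def)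
  ultimately have "(\<forall>t. \<not> stops N ((ws @ [u]) @ us) (fold (reflect N) us ?x) t)
      \<and> (\<forall>v\<in>V. fold (reflect N) us ?x v \<ge> 0)" by (rule Cons.IH)
  then show ?case by simp
qed auto

lemma fold_reflect_outside: "v \<notin> set us \<Longrightarrow> fold (reflect N) us x v = x v"
  by (induction us arbitrary: x) (auto simp: reflect_def)

text \<open>In a list without repetitions the coordinate changed by the first reflection is not
  touched again. A fixed vector of the product is thus fixed by the first factor, and inductively by
  all others.\<close>

lemma fold_reflect_fixed:
  assumes "distinct us" "fold (reflect N) us x = x" "v \<in> set us"
  shows "reflect N v x = x"
  using assms
proof (induction us)
  case (Cons u us)
  have "reflect N u x u = x u"
    using fold_reflect_outside[of u us N "reflect N u x"] Cons.prems(1,2) by simp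
  then have "reflect N u x = x" by (auto simp: reflect_def fun_eq_iff)
  then show ?case using Cons by (cases "v = u") auto
qed simp

lemma fold_reflect_add:
  "fold (reflect (nbr_sum Q)) us (x + z) = fold (reflect (nbr_sum Q)) us x + fold (reflect (nbr_sum Q)) us z"
proof (induction us arbitrary: x z)
  case (Cons u us)
  have "reflect (nbr_sum Q) u (x + z) = reflect (nbr_sum Q) u x + reflect (nbr_sum Q) u z"
    by (auto simp: reflect_def nbr_sum_add fun_eq_iff)
  then show ?case by (simp only: fold_simps Cons.IH)
qed simp

lemma fold_reflect_0: "fold (reflect (nbr_sum Q)) us (\<lambda>v. 0) = (\<lambda>v. 0)"
proof (induction us)
  case (Cons u us)
  have "reflect (nbr_sum Q) u (\<lambda>v. 0) = (\<lambda>v. 0)" by (auto simp: reflect_def nbr_sum_zero)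
  then show ?case using Cons by (simp only: fold_simps)
qed simp

text \<open>
  The powers of the Coxeter transformation on a dimension vector stay bounded because they preserve
  the Tits form. If they all were nonnegative, the sum over a period would be a nonnegative fixed
  vector, hence orthogonal to all simple roots, and pairing it with the weight shows that it is zero.
\<close>

lemma reflections_stop:
  fixes x :: "'v \<Rightarrow> int"
  assumes Q: "fin_digraph Q" and y: "subadditive_weight Q y"
    and vs: "distinct vs" "set vs = verts Q" "vs \<noteq> []" and x: "\<forall>v\<in>verts Q. x v \<ge> 0"
  shows "\<exists>t. stops (nbr_sum Q) vs x t"
proof (rule ccontr)
  assume ns: "\<not> ?thesis"
  interpret fin_digraph Q by fact
  let ?N = "nbr_sum Q :: ('v \<Rightarrow> int) \<Rightarrow> 'v \<Rightarrow> int"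
  define C where "C = fold (reflect ?N) vs"
  define z where "z k = (C ^^ k) x" for k
  have z_Suc: "z (Suc k) = C (z k)" for k by (simp add: z_def)
  have inv: "(\<forall>t. \<not> stops ?N vs (z k) t) \<and> (\<forall>v\<in>verts Q. z k v \<ge> 0)" for k
  proof (induction k)
    case (Suc k)
    then show ?case using not_stops_fold[of ?N vs "[]" "z k" "verts Q"] by (simp add: z_Suc C_def)
  qed (use ns x in \<open>simp add: z_def\<close>)
  have noloop: "tail Q a \<noteq> head Q a" if "a \<in> arcs Q" for a
    using subadditive_weight_no_loops[OF Q y that] .
  have "tits_form Q (fold (reflect ?N) us w) = tits_form Q w" if "set us \<subseteq> verts Q" for us w
    using that by (induction us arbitrary: w) (auto simp: tits_form_reflect[OF Q _ noloop])
  then have tits: "tits_form Q (z k) = tits_form Q x" for k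
    using vs(2) by (induction k) (auto simp: z_Suc C_def, simp add: z_def)
  obtain B where B: "\<And>w v. tits_form Q w \<le> tits_form Q x \<Longrightarrow> v \<in> verts Q \<Longrightarrow> \<bar>w v\<bar> \<le> (B :: int)"
    using tits_form_bound[OF Q y] by blast
  have out: "z k v = x v" if "v \<notin> verts Q" for k v
    using that vs(2) by (induction k) (auto simp: z_Suc C_def fold_reflect_outside, simp add: z_def)
  \<comment> \<open>Outside the vertices \<open>z k\<close> never changes but may be arbitrary.
    Cutting it off places all \<open>g k\<close> in a finite set of functions, and a repetition
    among them is one among the \<open>z k\<close>.\<close>
  define g where "g k v = (if v \<in> verts Q then z k v else 0)" for k v
  have "range g \<subseteq> {f. \<forall>v. (v \<in> verts Q \<longrightarrow> f v \<in> {-B..B}) \<and> (v \<notin> verts Q \<longrightarrow> f v = 0)}"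
  proof -
    have "z k v \<in> {-B..B}" if "v \<in> verts Q" for k v using B[of "z k" v] tits that by (simp add: abs_le_iff)
    then show ?thesis by (auto simp: g_def)
  qed
  moreover have "finite {f. \<forall>v. (v \<in> verts Q \<longrightarrow> f v \<in> {-B..B}) \<and> (v \<notin> verts Q \<longrightarrow> f v = 0)}"
    by (rule finite_set_of_finite_funs) auto
  ultimately have "finite (range g)" by (rule finite_subset)
  then have "\<not> inj g" using finite_imageD infinite_UNIV_nat by blast
  then obtain k l where kl: "k < l" "g k = g l" unfolding inj_def by (metis linorder_neqE_nat)
  have zkl: "z k = z l"
  proof
    fix v show "z k v = z l v" using fun_cong[OF kl(2), of v] out[of v] by (cases "v \<in> verts Q") (auto simp: g_def)
  qed
  \<comment> \<open>The sum over one period: \<open>C\<close> permutes the summands cyclically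
    because \<open>z k = z l\<close>.\<close>
  define S where "S v = (\<Sum>j\<in>{k..<l}. z j v)" for v
  have Csum: "C (\<lambda>v. \<Sum>j\<in>J. w j v) = (\<lambda>v. \<Sum>j\<in>J. C (w j) v)" for J :: "nat set" and w
  proof (induction J rule: infinite_finite_induct)
    case (insert j J)
    have "(\<lambda>v. \<Sum>j\<in>insert j J. w j v) = w j + (\<lambda>v. \<Sum>j\<in>J. w j v)" using insert(1,2) by (auto simp: fun_eq_iff)
    then have "C (\<lambda>v. \<Sum>j\<in>insert j J. w j v) = C (w j) + C (\<lambda>v. \<Sum>j\<in>J. w j v)"
      by (simp only: C_def fold_reflect_add)
    then show ?case using insert by (simp add: fun_eq_iff)
  qed (auto simp: C_def fold_reflect_0)
  have "C S = (\<lambda>v. \<Sum>j\<in>{k..<l}. z (Suc j) v)" unfolding S_def[abs_def] Csum z_Suc ..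
  also have "\<dots> = S"
  proof
    fix v
    have "(\<Sum>j\<in>{k..<l}. z (Suc j) v) - (\<Sum>j\<in>{k..<l}. z j v) = z l v - z k v"
      unfolding sum_subtractf[symmetric] using kl(1) by (intro sum_Suc_diff') simp
    then show "(\<Sum>j\<in>{k..<l}. z (Suc j) v) = S v" using zkl by (simp add: S_def)
  qed
  finally have CS: "C S = S" .
  have NS: "?N S v = 2 * S v" if "v \<in> verts Q" for v
    using fold_reflect_fixed[OF vs(1) CS[unfolded C_def], of v] that vs(2)
    by (auto simp: reflect_def dest: fun_cong[of _ _ v])
  have S0: "S v \<ge> 0" if "v \<in> verts Q" for v using inv that by (auto simp: S_def intro!: sum_nonneg)
  have "(\<Sum>v\<in>verts Q. S v * (2 * y v - ?N y v)) = (\<Sum>v\<in>verts Q. y v * (2 * S v - ?N S v))"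
  proof -
    have "(\<Sum>v\<in>verts Q. S v * ?N y v) = (\<Sum>v\<in>verts Q. y v * ?N S v)"
      unfolding sum_nbr_sum[OF Q] by (intro sum.cong) auto
    then show ?thesis by (simp add: right_diff_distrib sum_subtractf mult.commute mult.left_commute)
  qed
  also have "\<dots> = 0" using NS by simp
  finally have "(\<Sum>v\<in>verts Q. S v * (2 * y v - ?N y v)) = 0" .
  moreover have "S v * (2 * y v - ?N y v) \<ge> 0" if "v \<in> verts Q" for v
    using S0 y that by (auto simp: subadditive_weight_def intro!: mult_nonneg_nonneg)
  ultimately have "\<forall>v\<in>verts Q. S v * (2 * y v - ?N y v) = 0" by (subst sum_nonneg_eq_0_iff[symmetric]) auto
  then have "S v = 0" if "v \<in> verts Q" for v using y that by (force simp: subadditive_weight_def)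
  then have "z k v = 0" if "v \<in> verts Q" for v
    using that kl(1) inv sum_nonneg_eq_0_iff[of "{k..<l}" "\<lambda>j. z j v"] by (auto simp: S_def)
  \<comment> \<open>The zero vector stops at once, because a new coordinate equal to 0 already
    counts as nonpositive.\<close>
  then have "?N (z k) (hd vs) = 0" "z k (hd vs) \<ge> 0"
    using nbr_sum_cong[of Q "z k" "\<lambda>v. 0"] vs hd_in_set[OF vs(3)] nbr_sum_zero[of Q] inv
    by (auto simp: wf_digraph_axioms)
  then have "stops ?N vs (z k) 0" by (simp add: reflect_def)
  then show False using inv by blast
qed

section \<open>Dynkin quivers\<close>

text \<open>For an edge \<open>E\<close> through \<open>k\<close>, the difference
  \<open>sum y E - y k\<close> is the value of \<open>y\<close> at the other end. So this is the
  neighbour sum on a path, read off from edge sets.\<close>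

lemma sum_path_edges:
  fixes y :: "nat \<Rightarrow> int"
  assumes "k \<ge> 1"
  shows "(\<Sum>E\<in>path_edges n. if k \<in> E then sum y E - y k else 0)
    = (if k < n then y (k + 1) else 0) + (if 2 \<le> k \<and> k \<le> n then y (k - 1) else 0)"
proof -
  have p: "path_edges n = (\<lambda>i. {i, i + 1}) ` {1..<n}" by (auto simp: path_edges_def)
  have inj: "inj_on (\<lambda>i::nat. {i, i + 1}) {1..<n}" by (auto simp: inj_on_def doubleton_eq_iff)
  have "(\<Sum>E\<in>path_edges n. if k \<in> E then sum y E - y k else 0)
      = (\<Sum>i\<in>{1..<n}. (if i = k then y (k + 1) else 0) + (if i = k - 1 then y (k - 1) else 0))"
    unfolding p sum.reindex[OF inj] using assms by (intro sum.cong) (auto simp: o_def)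
  also have "\<dots> = (if k \<in> {1..<n} then y (k + 1) else 0) + (if k - 1 \<in> {1..<n} then y (k - 1) else 0)"
    unfolding sum.distrib by simp
  also have "\<dots> = (if k < n then y (k + 1) else 0) + (if 2 \<le> k \<and> k \<le> n then y (k - 1) else 0)"
    using assms by auto
  finally show ?thesis .
qed

lemma sum_branch_edges:
  fixes y :: "nat \<Rightarrow> int"
  assumes "k \<ge> 1" "1 \<le> b" "b < n"
  shows "(\<Sum>E\<in>path_edges (n - 1) \<union> {{b, n}}. if k \<in> E then sum y E - y k else 0)
    = (if k < n - 1 then y (k + 1) else 0) + (if 2 \<le> k \<and> k \<le> n - 1 then y (k - 1) else 0)
      + (if k = b then y n else 0) + (if k = n then y b else 0)"
proof -
  have fin: "finite (path_edges m)" for m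
    by (rule finite_subset[of _ "(\<lambda>i. {i, i + 1}) ` {..m}"]) (auto simp: path_edges_def)
  have "{b, n} \<notin> path_edges (n - 1)" using assms by (auto simp: path_edges_def doubleton_eq_iff)
  then have "(\<Sum>E\<in>path_edges (n - 1) \<union> {{b, n}}. if k \<in> E then sum y E - y k else 0)
      = (\<Sum>E\<in>path_edges (n - 1). if k \<in> E then sum y E - y k else 0)
        + (if k \<in> {b, n} then sum y {b, n} - y k else 0)"
    using fin by simp
  then show ?thesis unfolding sum_path_edges[OF assms(1)] using assms by auto
qed

text \<open>
  The weights are, up to a factor, the coefficients of the sum of the positive roots; those for
  \<open>E\<^sub>8\<close> also serve for the subdiagrams \<open>E\<^sub>6\<close> and \<open>E\<^sub>7\<close>.
\<close>

lemma dynkin_diagram_weight: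
  assumes "dynkin_admissible \<Delta>"
  obtains y :: "nat \<Rightarrow> int" where "\<And>k. k \<in> dynkin_verts \<Delta> \<Longrightarrow>
    y k > 0 \<and> (\<Sum>E\<in>dynkin_edges \<Delta>. if k \<in> E then sum y E - y k else 0) < 2 * y k"
proof (cases \<Delta>)
  case (Dynkin_A n)
  \<comment> \<open>The second difference of this quadratic is -2, and it vanishes at 0 and
    \<open>n + 1\<close>, so the missing neighbours of the end vertices may be added without
    harm.\<close>
  define y where "y k = int k * (int n + 1 - int k)" for k
  have "y k > 0 \<and> (\<Sum>E\<in>dynkin_edges \<Delta>. if k \<in> E then sum y E - y k else 0) < 2 * y k"
    if "k \<in> dynkin_verts \<Delta>" for k
  proof -
    have k: "1 \<le> k" "k \<le> n" using that Dynkin_A by auto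
    have "(if k < n then y (k + 1) else 0) = y (k + 1)" "(if 2 \<le> k \<and> k \<le> n then y (k - 1) else 0) = y (k - 1)"
      using k by (auto simp: y_def)
    moreover have "y (k + 1) + y (k - 1) < 2 * y k"
      using k by (simp add: y_def of_nat_diff algebra_simps)
    ultimately show ?thesis using k Dynkin_A sum_path_edges[OF k(1), where n = n and y = y] by (simp add: y_def)
  qed
  then show thesis using that by blast
next
  case (Dynkin_D n)
  have n: "n \<ge> 4" using assms Dynkin_D by simp
  \<comment> \<open>Twice the coefficients of the sum of the positive roots, which removes the
    division from \<open>n (n - 1) / 2\<close> at the two short ends \<open>n - 1\<close> and
    \<open>n\<close>.\<close>
  define y where "y k = (if k \<le> n - 2 then 2 * int k * (2 * int n - 1 - int k) else int n * (int n - 1))" for k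
  have "y k > 0 \<and> (\<Sum>E\<in>dynkin_edges \<Delta>. if k \<in> E then sum y E - y k else 0) < 2 * y k"
    if "k \<in> dynkin_verts \<Delta>" for k
  proof -
    have k: "1 \<le> k" "k \<le> n" using that Dynkin_D by auto
    have "y k > 0" using k n by (auto simp: y_def intro!: mult_pos_pos)
    have b: "1 \<le> n - 2" "n - 2 < n" using n by auto
    have e: "(\<Sum>E\<in>dynkin_edges \<Delta>. if k \<in> E then sum y E - y k else 0)
      = (if k < n - 1 then y (k + 1) else 0) + (if 2 \<le> k \<and> k \<le> n - 1 then y (k - 1) else 0)
      + (if k = n - 2 then y n else 0) + (if k = n then y (n - 2) else 0)"
      using sum_branch_edges[OF k(1) b, of y] Dynkin_D by simp
    consider "k < n - 2" | "k = n - 2" | "k = n - 1" | "k = n" using k by linarith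
    then have "(\<Sum>E\<in>dynkin_edges \<Delta>. if k \<in> E then sum y E - y k else 0) < 2 * y k"
    proof cases
      case 1
      \<comment> \<open>Writing \<open>k = j + 1\<close> and \<open>n = j + 4 + m\<close> eliminates
        the truncated subtractions; for \<open>k = 1\<close> the missing neighbour is harmless since
        \<open>y 0 = 0\<close>.\<close>
      obtain j where j: "k = Suc j" using k by (cases k) auto
      have "j + 4 \<le> n" using 1 j by simp
      then obtain m where m: "n = j + 4 + m" by (auto simp: le_iff_add)
      have "(if 2 \<le> k \<and> k \<le> n - 1 then y (k - 1) else 0) = y j" using j m by (auto simp: y_def)
      then show ?thesis unfolding e using j m by (simp add: y_def algebra_simps)
    next
      case 2
      obtain m where m: "n = m + 4" using n by (metis add.commute le_Suc_ex)
      show ?thesis unfolding e using 2 by (simp add: y_def m algebra_simps)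
    next
      case 3
      obtain m where m: "n = m + 4" using n by (metis add.commute le_Suc_ex)
      show ?thesis unfolding e using 3 by (simp add: y_def m algebra_simps)
    next
      case 4
      obtain m where m: "n = m + 4" using n by (metis add.commute le_Suc_ex)
      show ?thesis unfolding e using 4 by (simp add: y_def m algebra_simps)
    qed
    then show ?thesis using \<open>y k > 0\<close> by simp
  qed
  then show thesis using that by blast
next
  case (Dynkin_E n)
  have n: "n = 6 \<or> n = 7 \<or> n = 8" using assms Dynkin_E by simp
  \<comment> \<open>\<open>k = n\<close> is tested first because the last vertex is always the short
    arm at 3. For \<open>n\<close> equal to 6 or 7 the long arm 4, 5, ... is merely cut off earlier,
    which only lowers a neighbour sum.\<close>
  define y :: "nat \<Rightarrow> int" where "y k = (if k = n then 136 else if k = 1 then 92 else if k = 2 then 182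
    else if k = 3 then 270 else if k = 4 then 220 else if k = 5 then 168 else if k = 6 then 114 else 58)" for k
  have "y k > 0 \<and> (\<Sum>E\<in>dynkin_edges \<Delta>. if k \<in> E then sum y E - y k else 0) < 2 * y k"
    if "k \<in> dynkin_verts \<Delta>" for k
  proof -
    have k: "1 \<le> k" "k \<le> n" using that Dynkin_E by auto
    have b: "1 \<le> (3::nat)" "3 < n" using n by auto
    have e: "(\<Sum>E\<in>dynkin_edges \<Delta>. if k \<in> E then sum y E - y k else 0)
      = (if k < n - 1 then y (k + 1) else 0) + (if 2 \<le> k \<and> k \<le> n - 1 then y (k - 1) else 0)
      + (if k = 3 then y n else 0) + (if k = n then y 3 else 0)"
      using sum_branch_edges[OF k(1) b, of y] Dynkin_E by simp
    have "k = 1 \<or> k = 2 \<or> k = 3 \<or> k = 4 \<or> k = 5 \<or> k = 6 \<or> k = 7 \<or> k = 8" using k n by linarith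
    then show ?thesis unfolding e using n k by (elim disjE) (auto simp: y_def)
  qed
  then show thesis using that by blast
qed

text \<open>The weight of the diagram is pulled back along \<open>\<sigma>\<close>. The bijection
  between arrows and edges turns the sum over arrows into the sum over edges; that edges are not
  singletons is what identifies the other end of an edge.\<close>

lemma dynkin_quiver_weight:
  assumes "dynkin_quiver Q"
  obtains y where "subadditive_weight Q y"
proof -
  obtain \<Delta> \<sigma> where D: "fin_digraph Q" "dynkin_admissible \<Delta>" "bij_betw \<sigma> (verts Q) (dynkin_verts \<Delta>)"
    "bij_betw (\<lambda>a. {\<sigma> (tail Q a), \<sigma> (head Q a)}) (arcs Q) (dynkin_edges \<Delta>)"
    using assms unfolding dynkin_quiver_def by blast
  interpret fin_digraph Q by fact
  obtain y :: "nat \<Rightarrow> int" where y: "\<And>k. k \<in> dynkin_verts \<Delta> \<Longrightarrow>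
    y k > 0 \<and> (\<Sum>E\<in>dynkin_edges \<Delta>. if k \<in> E then sum y E - y k else 0) < 2 * y k"
    using dynkin_diagram_weight[OF D(2)] by blast
  have inj: "\<sigma> u = \<sigma> v \<longleftrightarrow> u = v" if "u \<in> verts Q" "v \<in> verts Q" for u v
    using D(3) that by (auto simp: bij_betw_def inj_on_def)
  have nd: "\<sigma> (tail Q a) \<noteq> \<sigma> (head Q a)" if "a \<in> arcs Q" for a
  proof
    assume "\<sigma> (tail Q a) = \<sigma> (head Q a)"
    moreover have "{\<sigma> (tail Q a), \<sigma> (head Q a)} \<in> dynkin_edges \<Delta>" using D(4) that by (auto simp: bij_betw_def)
    moreover have "{m} \<notin> dynkin_edges \<Delta>" for m
      using D(2) by (cases \<Delta>) (auto simp: path_edges_def dest!: arg_cong[of "{_}" _ card])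
    ultimately show False by simp
  qed
  have "nbr_sum Q (y \<circ> \<sigma>) v = (\<Sum>E\<in>dynkin_edges \<Delta>. if \<sigma> v \<in> E then sum y E - y (\<sigma> v) else 0)"
    if "v \<in> verts Q" for v
    unfolding nbr_sum_def sum.reindex_bij_betw[OF D(4), symmetric]
    using nd nd[symmetric] inj that by (intro sum.cong) auto
  then have "subadditive_weight Q (y \<circ> \<sigma>)"
    using y D(3) by (auto simp: subadditive_weight_def bij_betw_def)
  then show thesis using that by blast
qed

section \<open>Reflection functors at a sink\<close>

definition delete_vertex :: "('v, 'a) pre_digraph \<Rightarrow> 'v \<Rightarrow> ('v, 'a) pre_digraph" where
  "delete_vertex Q i = \<lparr>verts = verts Q - {i}, arcs = {a\<in>arcs Q. tail Q a \<noteq> i \<and> head Q a \<noteq> i},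
     tail = tail Q, head = head Q\<rparr>"

text \<open>Meaningful only when \<open>i\<close> is a sink.\<close>

definition reverse_at :: "('v, 'a) pre_digraph \<Rightarrow> 'v \<Rightarrow> ('v, 'a) pre_digraph" where
  "reverse_at Q i = \<lparr>verts = verts Q, arcs = arcs Q,
     tail = (\<lambda>a. if head Q a = i then i else tail Q a),
     head = (\<lambda>a. if head Q a = i then tail Q a else head Q a)\<rparr>"

text \<open>Test representations and \<open>M\<close> may have different ambient spaces, as in the
  theorem; the reflections are carried out with a single one.\<close>

definition hom_bounded ::
  "('v, 'a) pre_digraph \<Rightarrow> ('k::field \<Rightarrow> 'b::ab_group_add \<Rightarrow> 'b) \<Rightarrow> ('k \<Rightarrow> 'c::ab_group_add \<Rightarrow> 'c) \<Rightarrow>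
   ('v, 'a, 'c) quiver_rep \<Rightarrow> ('v \<Rightarrow> nat) \<Rightarrow> bool" where
  "hom_bounded Q s t M e \<longleftrightarrow>
     (\<forall>U. fd_rep Q s U \<longrightarrow> euler_form Q (dimension_vector s U) e \<le> int (hom_dim Q s t U M))"

lemma fin_digraph_delete_vertex: "fin_digraph Q \<Longrightarrow> fin_digraph (delete_vertex Q i)"
  unfolding fin_digraph_def fin_digraph_axioms_def wf_digraph_def delete_vertex_def by auto

lemma fin_digraph_reverse_at: "fin_digraph Q \<Longrightarrow> fin_digraph (reverse_at Q i)"
  unfolding fin_digraph_def fin_digraph_axioms_def wf_digraph_def reverse_at_def by auto

lemma nbr_sum_reverse_at: "nbr_sum (reverse_at Q i) = nbr_sum Q"
  unfolding nbr_sum_def reverse_at_def fun_eq_iff by (auto intro!: sum.cong simp: add.commute)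

lemma subadditive_weight_reverse_at: "subadditive_weight Q y \<Longrightarrow> subadditive_weight (reverse_at Q i) y"
  by (simp add: subadditive_weight_def nbr_sum_reverse_at) (simp add: reverse_at_def)

text \<open>Removing arrows drops nonnegative summands from every neighbour sum.\<close>

lemma subadditive_weight_delete_vertex:
  assumes Q: "fin_digraph Q" and y: "subadditive_weight Q y"
  shows "subadditive_weight (delete_vertex Q i) y"
proof -
  interpret fin_digraph Q by fact
  have pos: "0 \<le> y (tail Q a)" "0 \<le> y (head Q a)" if "a \<in> arcs Q" for a
    using y that by (auto simp: subadditive_weight_def intro: less_imp_le)
  have "nbr_sum (delete_vertex Q i) y v \<le> nbr_sum Q y v" for v
  proof -
    let ?h = "\<lambda>a. (if head Q a = v then y (tail Q a) else 0) + (if tail Q a = v then y (head Q a) else 0)"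
    have "nbr_sum (delete_vertex Q i) y v = (\<Sum>a\<in>arcs (delete_vertex Q i). ?h a)"
      by (simp add: nbr_sum_def delete_vertex_def cong: if_cong)
    also have "\<dots> \<le> (\<Sum>a\<in>arcs Q. ?h a)"
      using pos by (intro sum_mono2) (auto simp: delete_vertex_def intro!: add_nonneg_nonneg)
    finally show ?thesis by (simp add: nbr_sum_def)
  qed
  then show ?thesis using y unfolding subadditive_weight_def
    by (auto simp: delete_vertex_def intro: le_less_trans)
qed

text \<open>The assumption \<open>inf\<close> leaves room to copy into the ambient space the kernels
  and cokernels that reflections create in the function space
  \<open>'a \<Rightarrow> 'b\<close>.\<close>

locale sink_reflection = fin_digraph Q + vector_space s
  for Q :: "('v, 'a) pre_digraph" and s :: "'k::field \<Rightarrow> 'b::ab_group_add \<Rightarrow> 'b" +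
  fixes i :: 'v
  assumes i: "i \<in> verts Q" and sink: "\<And>a. a \<in> arcs Q \<Longrightarrow> tail Q a \<noteq> i"
    and inf: "\<not> finite_dim s UNIV"
begin

sublocale F: vector_space "fun_scale s :: 'k \<Rightarrow> ('a \<Rightarrow> 'b) \<Rightarrow> 'a \<Rightarrow> 'b"
  by (rule vector_space_fun_scale[OF vector_space_axioms])

definition In :: "'a set" where "In = {a\<in>arcs Q. head Q a = i}"

abbreviation Q' where "Q' \<equiv> reverse_at Q i"
abbreviation Qd where "Qd \<equiv> delete_vertex Q i"

definition incoming :: "('v \<Rightarrow> 'b set) \<Rightarrow> ('a \<Rightarrow> 'b) set" where
  "incoming W = pi_space In (\<lambda>a. W (tail Q a))"

definition \<sigma> :: "('v, 'a, 'b) quiver_rep \<Rightarrow> ('a \<Rightarrow> 'b) \<Rightarrow> 'b" where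
  "\<sigma> M g = (\<Sum>a\<in>In. rep_map M a (g a))"

text \<open>For a representation of the reversed quiver, where \<open>i\<close> is a source; its
  cokernel is the new space at \<open>i\<close>, dually to the kernel of
  \<open>\<sigma> M\<close>.\<close>

definition \<delta> :: "('v, 'a, 'b) quiver_rep \<Rightarrow> 'b \<Rightarrow> 'a \<Rightarrow> 'b" where
  "\<delta> U x = (\<lambda>a. if a \<in> In then rep_map U a x else 0)"

text \<open>\<open>f\<close> is to be an embedding of the direct sum into the ambient space. The new
  maps undo it and take the coordinate at the arrow.\<close>

definition kernel_rep :: "(('a \<Rightarrow> 'b) \<Rightarrow> 'b) \<Rightarrow> ('v, 'a, 'b) quiver_rep \<Rightarrow> ('v, 'a, 'b) quiver_rep" where
  "kernel_rep f M =
     \<lparr>rep_space = (\<lambda>j. if j = i then f ` {g\<in>incoming (rep_space M). \<sigma> M g = 0} else rep_space M j),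
      rep_map = (\<lambda>a x. if a \<in> In then the_inv_into (incoming (rep_space M)) f x a else rep_map M a x)\<rparr>"

text \<open>\<open>c\<close> is to be a quotient map by the image of \<open>\<delta> U\<close>,
  realised within the ambient space; the new maps are the inclusions of the summands followed by
  \<open>c\<close>.\<close>

definition coker_rep :: "(('a \<Rightarrow> 'b) \<Rightarrow> 'b) \<Rightarrow> ('v, 'a, 'b) quiver_rep \<Rightarrow> ('v, 'a, 'b) quiver_rep" where
  "coker_rep c U =
     \<lparr>rep_space = (\<lambda>j. if j = i then c ` incoming (rep_space U) else rep_space U j),
      rep_map = (\<lambda>a x. if a \<in> In then c (single a x) else rep_map U a x)\<rparr>"

lemma finite_In: "finite In"
  by (simp add: In_def)

lemma In_arcs: "a \<in> In \<Longrightarrow> a \<in> arcs Q" "a \<in> In \<Longrightarrow> head Q a = i" "a \<in> In \<Longrightarrow> tail Q a \<in> verts Q"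
  "a \<in> In \<Longrightarrow> tail Q a \<noteq> i"
  using sink by (auto simp: In_def)

lemma Q'_simps [simp]:
  "verts Q' = verts Q" "arcs Q' = arcs Q"
  "a \<in> In \<Longrightarrow> tail Q' a = i" "a \<in> In \<Longrightarrow> head Q' a = tail Q a"
  "a \<in> arcs Q \<Longrightarrow> a \<notin> In \<Longrightarrow> tail Q' a = tail Q a" "a \<in> arcs Q \<Longrightarrow> a \<notin> In \<Longrightarrow> head Q' a = head Q a"
  by (auto simp: reverse_at_def In_def)

lemma Qd_simps [simp]:
  "verts Qd = verts Q - {i}" "arcs Qd = arcs Q - In" "tail Qd = tail Q" "head Qd = head Q"
  using sink by (auto simp: delete_vertex_def In_def)

lemma not_In: "a \<in> arcs Q \<Longrightarrow> a \<notin> In \<Longrightarrow> head Q a \<noteq> i"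
  by (auto simp: In_def)

lemma nbr_sum_sink: "nbr_sum Q x i = (\<Sum>a\<in>In. x (tail Q a))"
proof -
  have "nbr_sum Q x i = (\<Sum>a\<in>arcs Q. if head Q a = i then x (tail Q a) else 0)"
    unfolding nbr_sum_def using sink by (intro sum.cong) auto
  then show ?thesis by (simp add: In_def sum.inter_filter)
qed

text \<open>The forms before and after the reversal are compared through their common part, the
  quiver without \<open>i\<close>. This needs no reflected vector and hence no sign condition on its
  coordinate at \<open>i\<close>.\<close>

lemma euler_form_sink:
  "euler_form Q d e = euler_form Qd d e + int (d i) * int (e i) - (\<Sum>a\<in>In. int (d (tail Q a))) * int (e i)"
  "euler_form Q' d e = euler_form Qd d e + int (d i) * int (e i) - int (d i) * (\<Sum>a\<in>In. int (e (tail Q a)))"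
proof -
  have v: "(\<Sum>j\<in>verts Q. int (d j) * int (e j)) = int (d i) * int (e i) + (\<Sum>j\<in>verts Q - {i}. int (d j) * int (e j))"
    using i by (simp add: sum.remove)
  have a: "(\<Sum>a\<in>arcs Q. h a) = (\<Sum>a\<in>In. h a) + (\<Sum>a\<in>arcs Q - In. h a)" for h :: "'a \<Rightarrow> int"
    using sum.subset_diff[of In "arcs Q" h] by (auto simp: In_def)
  have "(\<Sum>a\<in>In. int (d (tail Q a)) * int (e (head Q a))) = (\<Sum>a\<in>In. int (d (tail Q a))) * int (e i)"
    unfolding sum_distrib_right by (intro sum.cong) (auto simp: In_arcs)
  then show "euler_form Q d e = euler_form Qd d e + int (d i) * int (e i) - (\<Sum>a\<in>In. int (d (tail Q a))) * int (e i)"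
    by (simp add: euler_form_def v a)
  have "(\<Sum>a\<in>In. int (d (tail Q' a)) * int (e (head Q' a))) = int (d i) * (\<Sum>a\<in>In. int (e (tail Q a)))"
    unfolding sum_distrib_left by (intro sum.cong) auto
  moreover have "(\<Sum>a\<in>arcs Q - In. int (d (tail Q' a)) * int (e (head Q' a)))
      = (\<Sum>a\<in>arcs Q - In. int (d (tail Q a)) * int (e (head Q a)))"
    by (intro sum.cong) auto
  ultimately show "euler_form Q' d e = euler_form Qd d e + int (d i) * int (e i) - int (d i) * (\<Sum>a\<in>In. int (e (tail Q a)))"
    by (simp add: euler_form_def v a)
qed

lemma incoming_dim:
  assumes "\<And>j. j \<in> verts Q \<Longrightarrow> j \<noteq> i \<Longrightarrow> finite_dim s (W j)"
  shows "finite_dim (fun_scale s) (incoming W)" "F.dim (incoming W) = (\<Sum>a\<in>In. dim (W (tail Q a)))"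
    "F.subspace (incoming W)"
proof -
  show fin: "finite_dim (fun_scale s) (incoming W)" and "F.dim (incoming W) = (\<Sum>a\<in>In. dim (W (tail Q a)))"
    using pi_space_dim[OF vector_space_axioms finite_In, of "\<lambda>a. W (tail Q a)"] assms In_arcs
    by (auto simp: incoming_def)
  show "F.subspace (incoming W)" using F.finite_dim_imp_subspace[OF fin] .
qed

lemma incoming_mono: "(\<And>j. j \<in> verts Q \<Longrightarrow> j \<noteq> i \<Longrightarrow> W j \<subseteq> W' j) \<Longrightarrow> incoming W \<subseteq> incoming W'"
  unfolding incoming_def pi_space_def using In_arcs(3,4) by blast

lemma \<sigma>_linear:
  assumes M: "fd_rep Q s M"
  shows "linear_between (fun_scale s) s (incoming (rep_space M)) (rep_space M i) (\<sigma> M)"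
proof -
  have map: "linear_between s s (rep_space M (tail Q a)) (rep_space M i) (rep_map M a)" if "a \<in> In" for a
    using fd_repD(3)[OF M, of a] In_arcs[OF that] by simp
  have "\<sigma> M g \<in> rep_space M i" if "g \<in> incoming (rep_space M)" for g
    unfolding \<sigma>_def using map that
    by (intro subspace_sum fd_repD(2)[OF M i]) (auto simp: linear_between_def incoming_def pi_space_def)
  moreover have "\<sigma> M (g + h) = \<sigma> M g + \<sigma> M h"
    if "g \<in> incoming (rep_space M)" "h \<in> incoming (rep_space M)" for g h
    unfolding \<sigma>_def sum.distrib[symmetric] using map that
    by (intro sum.cong) (auto simp: linear_between_def incoming_def pi_space_def)
  moreover have "\<sigma> M (fun_scale s c g) = s c (\<sigma> M g)" if "g \<in> incoming (rep_space M)" for g c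
    unfolding \<sigma>_def scale_sum_right using map that
    by (intro sum.cong) (auto simp: linear_between_def incoming_def pi_space_def fun_scale_apply)
  ultimately show ?thesis unfolding linear_between_def by blast
qed

text \<open>\<open>M\<close> is its own restriction, since values at absent vertices and arrows are
  ignored.\<close>

lemma fd_rep_delete_vertex: "fd_rep Q s M \<Longrightarrow> fd_rep Qd s M"
  by (simp add: fd_rep_def)

text \<open>As \<open>i\<close> is a sink, its space is only required to contain the images of the
  incoming maps. Any space \<open>Z\<close> between their sum and \<open>M\<close> at
  \<open>i\<close>, of dimension \<open>e i\<close>, will do.\<close>

lemma extend_to_sink:
  assumes M: "fd_rep Q s M" and N: "subrep Qd s N M"
    and e: "\<forall>j\<in>verts Qd. dimension_vector s N j = e j"
    and low: "dim (\<sigma> M ` incoming (rep_space N)) \<le> e i" and up: "e i \<le> dim (rep_space M i)"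
  shows "\<exists>N. subrep Q s N M \<and> (\<forall>j\<in>verts Q. dimension_vector s N j = e j)"
proof -
  have sub: "rep_space N j \<subseteq> rep_space M j" "finite_dim s (rep_space N j)" if "j \<in> verts Q" "j \<noteq> i" for j
    using N that by (auto simp: subrep_def fd_rep_def)
  have inc: "incoming (rep_space N) \<subseteq> incoming (rep_space M)" using sub by (intro incoming_mono) auto
  note \<sigma>lin = \<sigma>_linear[OF M]
  have \<sigma>N: "linear_between (fun_scale s) s (incoming (rep_space N)) (rep_space M i) (\<sigma> M)"
    using linear_between_subset[OF \<sigma>lin inc] inc \<sigma>lin by (auto simp: linear_between_def)
  have X: "subspace (\<sigma> M ` incoming (rep_space N))"
    using linear_between_image_subspace[OF F.vector_space_axioms vector_space_axioms \<sigma>N incoming_dim(3)] sub by blast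
  have XM: "\<sigma> M ` incoming (rep_space N) \<subseteq> rep_space M i" using \<sigma>N by (auto simp: linear_between_def)
  obtain Z where Z: "\<sigma> M ` incoming (rep_space N) \<subseteq> Z" "Z \<subseteq> rep_space M i" "finite_dim s Z" "dim Z = e i"
    using intermediate_subspace[OF fd_repD(1)[OF M i] X XM low up] by blast
  define N' :: "('v, 'a, 'b) quiver_rep" where
    "N' = \<lparr>rep_space = (rep_space N)(i := Z), rep_map = rep_map M\<rparr>"
  have inZ: "rep_map M a x \<in> Z" if a: "a \<in> In" and x: "x \<in> rep_space N (tail Q a)" for a x
  proof -
    have "0 \<in> rep_space N (tail Q b)" if "b \<in> In" for b
      using sub(2)[of "tail Q b"] In_arcs[OF that] finite_dim_imp_subspace subspace_0 by blast
    then have g: "single a x \<in> incoming (rep_space N)"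
      unfolding incoming_def using a x by (intro pi_space_single) auto
    have "rep_map M b 0 = 0" if "b \<in> In" for b
      using linear_between_0[OF vector_space_axioms vector_space_axioms fd_repD(3)[OF M] fd_repD(2)[OF M]] In_arcs[OF that]
      by blast
    \<comment> \<open>The image of a single arrow lies in that of \<open>\<sigma> M\<close>: all
      other summands are images of 0.\<close>
    then have "\<sigma> M (single a x) = (\<Sum>b\<in>In. if b = a then rep_map M a x else 0)"
      unfolding \<sigma>_def by (intro sum.cong) (auto simp: single_def)
    also have "\<dots> = rep_map M a x" using a finite_In by simp
    finally show ?thesis using g Z(1) by force
  qed
  have Nin: "rep_map M a x \<in> rep_space N (head Q a)" if "a \<in> arcs Q" "a \<notin> In" "x \<in> rep_space N (tail Q a)" for a x
    using N that by (auto simp: subrep_def fd_rep_def linear_between_def)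
  have "linear_between s s (rep_space N' (tail Q a)) (rep_space N' (head Q a)) (rep_map N' a)" if a: "a \<in> arcs Q" for a
  proof -
    have t: "tail Q a \<in> verts Q" "tail Q a \<noteq> i" using a sink by auto
    have "linear_between s s (rep_space N (tail Q a)) (rep_space N' (head Q a)) (rep_map M a)"
    proof (rule linear_between_subset[OF fd_repD(3)[OF M a] sub(1)[OF t]])
      fix x assume "x \<in> rep_space N (tail Q a)"
      then show "rep_map M a x \<in> rep_space N' (head Q a)"
        using inZ[of a x] Nin[OF a, of x] not_In[OF a] In_arcs(2)[of a] by (cases "a \<in> In") (auto simp: N'_def)
    qed
    then show ?thesis using t by (simp add: N'_def)
  qed
  then have "fd_rep Q s N'" using sub(2) Z(3) by (auto simp: fd_rep_def N'_def)
  then have "subrep Q s N' M" using sub(1) Z(2) by (auto simp: subrep_def N'_def)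
  moreover have "\<forall>j\<in>verts Q. dimension_vector s N' j = e j"
    using e Z(4) by (auto simp: dimension_vector_def N'_def)
  ultimately show ?thesis by blast
qed

lemma linear_imp_linear_between:
  assumes "Vector_Spaces.linear s1 s2 f" "\<And>x. x \<in> V \<Longrightarrow> f x \<in> W"
  shows "linear_between s1 s2 V W f"
proof -
  interpret L: Vector_Spaces.linear s1 s2 f by fact
  show ?thesis using assms(2) by (simp add: linear_between_def L.add L.scale)
qed

lemma fd_rep_kernel_rep:
  assumes M: "fd_rep Q s M" and f: "Vector_Spaces.linear (fun_scale s) s f" "inj_on f (incoming (rep_space M))"
  shows "fd_rep Q' s (kernel_rep f M)"
proof -
  interpret L: Vector_Spaces.linear "fun_scale s" s f by fact
  let ?I = "incoming (rep_space M)" and ?K = "{g\<in>incoming (rep_space M). \<sigma> M g = 0}"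
  have I: "finite_dim (fun_scale s) ?I" "F.subspace ?I"
    using incoming_dim[of "rep_space M"] fd_repD(1)[OF M] by blast+
  have K: "F.subspace ?K"
    using linear_between_kernel[OF F.vector_space_axioms vector_space_axioms \<sigma>_linear[OF M] I(2)] .
  have fin: "finite_dim s (f ` ?K)"
    using rank_nullity(1)[OF F.vector_space_axioms vector_space_axioms linear_imp_linear_between[OF f(1)]]
      F.finite_dim_subspace(1)[OF I(1) K] by blast
  have lin: "linear_between s s (f ` ?K) (rep_space M (tail Q a)) (\<lambda>x. the_inv_into ?I f x a)" if "a \<in> In" for a
  proof -
    have inv: "the_inv_into ?I f (f g) = g" if "g \<in> ?I" for g using the_inv_into_f_f[OF f(2) that] .
    have "g a \<in> rep_space M (tail Q a)" if "g \<in> ?I" for g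
      using that \<open>a \<in> In\<close> by (auto simp: incoming_def pi_space_def)
    moreover have "the_inv_into ?I f (f g + f h) = g + h" if "g \<in> ?I" "h \<in> ?I" for g h
      using inv[OF F.subspace_add[OF I(2) that]] by (simp add: L.add)
    moreover have "the_inv_into ?I f (s c (f g)) = fun_scale s c g" if "g \<in> ?I" for g c
      using inv[OF F.subspace_scale[OF I(2) that]] by (simp add: L.scale)
    ultimately show ?thesis by (auto simp: linear_between_def inv fun_scale_apply)
  qed
  show ?thesis
    unfolding fd_rep_def Q'_simps(1,2)
  proof (intro conjI ballI)
    fix j assume "j \<in> verts Q"
    then show "finite_dim s (rep_space (kernel_rep f M) j)"
      using fin fd_repD(1)[OF M] by (simp add: kernel_rep_def)
  next
    fix a assume a: "a \<in> arcs Q"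
    show "linear_between s s (rep_space (kernel_rep f M) (tail Q' a)) (rep_space (kernel_rep f M) (head Q' a))
        (rep_map (kernel_rep f M) a)"
    proof (cases "a \<in> In")
      case True
      then show ?thesis using lin In_arcs(4) by (simp add: kernel_rep_def)
    next
      case False
      then show ?thesis using fd_repD(3)[OF M a] a sink[OF a] not_In[OF a] by (simp add: kernel_rep_def)
    qed
  qed
qed

lemma \<delta>_linear:
  assumes U: "fd_rep Q' s U"
  shows "linear_between s (fun_scale s) (rep_space U i) (incoming (rep_space U)) (\<delta> U)"
proof -
  have "linear_between s s (rep_space U i) (rep_space U (tail Q a)) (rep_map U a)" if "a \<in> In" for a
    using fd_repD(3)[OF U, of a] In_arcs[OF that] that by simp
  then show ?thesis
    by (auto simp: linear_between_def \<delta>_def incoming_def pi_space_def fun_eq_iff fun_scale_apply)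
qed

lemma fd_rep_coker_rep:
  assumes U: "fd_rep Q' s U" and c: "Vector_Spaces.linear (fun_scale s) s c"
  shows "fd_rep Q s (coker_rep c U)"
proof -
  interpret L: Vector_Spaces.linear "fun_scale s" s c by fact
  let ?I = "incoming (rep_space U)"
  have I: "finite_dim (fun_scale s) ?I"
    using incoming_dim[of "rep_space U"] fd_repD(1)[OF U] by simp
  have fin: "finite_dim s (c ` ?I)"
    using rank_nullity(1)[OF F.vector_space_axioms vector_space_axioms linear_imp_linear_between[OF c]] I by blast
  have lin: "linear_between s s (rep_space U (tail Q a)) (c ` ?I) (\<lambda>x. c (single a x))" if "a \<in> In" for a
  proof -
    have 0: "0 \<in> rep_space U (tail Q b)" if "b \<in> In" for b
      using subspace_0[OF fd_repD(2)[OF U]] In_arcs[OF that] by simp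
    have "single a x \<in> ?I" if "x \<in> rep_space U (tail Q a)" for x
      unfolding incoming_def using that \<open>a \<in> In\<close> 0 by (intro pi_space_single) auto
    then show ?thesis
      using linear_between_single[OF vector_space_axioms, of a]
      by (auto simp: linear_between_def L.add L.scale)
  qed
  show ?thesis
    unfolding fd_rep_def
  proof (intro conjI ballI)
    fix j assume "j \<in> verts Q"
    then show "finite_dim s (rep_space (coker_rep c U) j)"
      using fin fd_repD(1)[OF U] by (simp add: coker_rep_def)
  next
    fix a assume a: "a \<in> arcs Q"
    show "linear_between s s (rep_space (coker_rep c U) (tail Q a)) (rep_space (coker_rep c U) (head Q a))
        (rep_map (coker_rep c U) a)"
    proof (cases "a \<in> In")
      case True
      then show ?thesis using lin In_arcs by (simp add: coker_rep_def)
    next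
      case False
      then show ?thesis using fd_repD(3)[OF U, of a] a sink[OF a] not_In[OF a] by (simp add: coker_rep_def)
    qed
  qed
qed

text \<open>One half of the adjunction between the two reflection functors.\<close>

lemma hom_dim_coker_rep_le:
  assumes M: "fd_rep Q s M" and f: "Vector_Spaces.linear (fun_scale s) s f" "inj_on f (incoming (rep_space M))"
    and U: "fd_rep Q' s U" and c: "Vector_Spaces.linear (fun_scale s) s c"
      "\<And>x. x \<in> rep_space U i \<Longrightarrow> c (\<delta> U x) = 0"
  shows "hom_dim Q s s (coker_rep c U) M \<le> hom_dim Q' s s U (kernel_rep f M)"
proof -
  interpret f: Vector_Spaces.linear "fun_scale s" s f by (rule f(1))
  interpret c: Vector_Spaces.linear "fun_scale s" s c by (rule c(1))
  interpret H: vector_space "family_scale s :: 'k \<Rightarrow> ('v \<Rightarrow> 'b \<Rightarrow> 'b) \<Rightarrow> _"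
    by (rule vector_space_family_scale[OF vector_space_axioms])
  note vs = vector_space_axioms
  let ?IM = "incoming (rep_space M)" and ?IU = "incoming (rep_space U)"
  \<comment> \<open>Applying \<open>\<phi>\<close> at the neighbours after the maps of
    \<open>U\<close> gives a tuple in the direct sum for \<open>M\<close>. Embedded by
    \<open>f\<close>, it is the component at \<open>i\<close> of the transposed morphism
    \<open>\<Theta> \<phi>\<close>; the other components are kept.\<close>
  define \<gamma> where "\<gamma> \<phi> x = (\<lambda>a. if a \<in> In then \<phi> (tail Q a) (rep_map U a x) else 0)" for \<phi> :: "'v \<Rightarrow> 'b \<Rightarrow> 'b" and x
  define \<Theta> where "\<Theta> \<phi> = (\<lambda>j x. if j = i then if x \<in> rep_space U i then f (\<gamma> \<phi> x) else 0 else \<phi> j x)"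
    for \<phi> :: "'v \<Rightarrow> 'b \<Rightarrow> 'b"
  let ?H = "rep_hom Q s s (coker_rep c U) M" and ?H' = "rep_hom Q' s s U (kernel_rep f M)"
  have IU: "finite_dim (fun_scale s) ?IU" "F.subspace ?IU"
    using incoming_dim[of "rep_space U"] fd_repD(1)[OF U] by auto
  have U0: "0 \<in> rep_space U j" if "j \<in> verts Q" for j using subspace_0[OF fd_repD(2)[OF U]] that by simp
  have Umap: "rep_map U a x \<in> rep_space U (tail Q a)" "rep_map U a (x + y) = rep_map U a x + rep_map U a y"
    "rep_map U a (s k x) = s k (rep_map U a x)"
    if "a \<in> In" "x \<in> rep_space U i" "y \<in> rep_space U i" for a x y k
    using fd_repD(3)[OF U, of a] that In_arcs(1)[OF that(1)] by (auto simp: linear_between_def)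
  have inv: "the_inv_into ?IM f (f g) = g" if "g \<in> ?IM" for g using the_inv_into_f_f[OF f(2) that] .
  have \<phi>lin: "linear_between s s (rep_space U j) (rep_space M j) (\<phi> j)" if "\<phi> \<in> ?H" "j \<in> verts Q" "j \<noteq> i" for \<phi> j
    using that by (auto simp: rep_hom_def coker_rep_def)
  \<comment> \<open>The component at \<open>i\<close> is determined by the others, because the
    images of the summands span the cokernel. This serves twice: \<open>\<gamma> \<phi> x\<close>
    lies in the kernel of \<open>\<sigma> M\<close>, and \<open>\<Theta>\<close> is
    injective.\<close>
  have \<phi>c: "\<phi> i (c g) = (\<Sum>a\<in>In. rep_map M a (\<phi> (tail Q a) (g a)))" if \<phi>: "\<phi> \<in> ?H" and g: "g \<in> ?IU" for \<phi> g
  proof -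
    have lin: "linear_between s s (c ` ?IU) (rep_space M i) (\<phi> i)" using \<phi> i by (auto simp: rep_hom_def coker_rep_def)
    have sub: "subspace (c ` ?IU)"
      using linear_between_image_subspace[OF F.vector_space_axioms vs linear_imp_linear_between[OF c(1)] IU(2)] by blast
    have ga: "g a \<in> rep_space U (tail Q a)" if "a \<in> In" for a using g that by (auto simp: incoming_def pi_space_def)
    have "c g = (\<Sum>a\<in>In. c (single a (g a)))"
      using pi_space_decompose[OF finite_In g[unfolded incoming_def]] by (simp add: c.sum[symmetric])
    then have "\<phi> i (c g) = \<phi> i (\<Sum>a\<in>In. c (single a (g a)))" by simp
    also have "\<dots> = (\<Sum>a\<in>In. \<phi> i (c (single a (g a))))"
    proof (rule linear_between_sum[OF vs vs lin sub])
      fix a assume a: "a \<in> In"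
      have "single a (g a) \<in> ?IU"
        unfolding incoming_def using a ga U0 In_arcs(3) by (intro pi_space_single) auto
      then show "c (single a (g a)) \<in> c ` ?IU" by blast
    qed
    also have "\<dots> = (\<Sum>a\<in>In. rep_map M a (\<phi> (tail Q a) (g a)))"
    proof (rule sum.cong[OF refl])
      fix a assume a: "a \<in> In"
      have "\<forall>a\<in>arcs Q. \<forall>x\<in>rep_space (coker_rep c U) (tail Q a).
          \<phi> (head Q a) (rep_map (coker_rep c U) a x) = rep_map M a (\<phi> (tail Q a) x)"
        using \<phi> by (auto simp: rep_hom_def)
      from this[rule_format, OF In_arcs(1)[OF a], of "g a"]
      show "\<phi> i (c (single a (g a))) = rep_map M a (\<phi> (tail Q a) (g a))"
        using a ga[OF a] In_arcs[OF a] by (simp add: coker_rep_def)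
    qed
    finally show ?thesis .
  qed
  have \<gamma>I: "\<gamma> \<phi> x \<in> ?IM" and \<gamma>0: "\<sigma> M (\<gamma> \<phi> x) = 0" if \<phi>: "\<phi> \<in> ?H" and x: "x \<in> rep_space U i" for \<phi> x
  proof -
    show "\<gamma> \<phi> x \<in> ?IM"
      using \<phi>lin[OF \<phi> In_arcs(3,4)] Umap(1)[OF _ x x]
      by (auto simp: \<gamma>_def incoming_def pi_space_def linear_between_def)
    have "\<sigma> M (\<gamma> \<phi> x) = (\<Sum>a\<in>In. rep_map M a (\<phi> (tail Q a) (\<delta> U x a)))"
      unfolding \<sigma>_def by (intro sum.cong) (auto simp: \<gamma>_def \<delta>_def)
    also have "\<dots> = \<phi> i (c (\<delta> U x))"
      using \<phi>c[OF \<phi>, of "\<delta> U x"] \<delta>_linear[OF U] x by (auto simp: linear_between_def)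
    also have "\<dots> = \<phi> i (c 0)" using c(2)[OF x] by (simp add: c.zero)
    also have "\<dots> = (\<Sum>a\<in>In. rep_map M a (\<phi> (tail Q a) 0))"
      using \<phi>c[OF \<phi> F.subspace_0[OF IU(2)]] by simp
    also have "\<dots> = 0"
    proof (rule sum.neutral, rule ballI)
      fix a assume a: "a \<in> In"
      have "\<phi> (tail Q a) 0 = 0"
        using linear_between_0[OF vs vs \<phi>lin[OF \<phi>] fd_repD(2)[OF U]] In_arcs[OF a] by simp
      then show "rep_map M a (\<phi> (tail Q a) 0) = 0"
        using linear_between_0[OF vs vs fd_repD(3)[OF M] fd_repD(2)[OF M]] In_arcs[OF a] by simp
    qed
    finally show "\<sigma> M (\<gamma> \<phi> x) = 0" .
  qed
  have \<gamma>add: "\<gamma> \<phi> (x + y) = \<gamma> \<phi> x + \<gamma> \<phi> y" and \<gamma>scale: "\<gamma> \<phi> (s k x) = fun_scale s k (\<gamma> \<phi> x)"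
    if "\<phi> \<in> ?H" "x \<in> rep_space U i" "y \<in> rep_space U i" for \<phi> x y k
    using \<phi>lin[OF that(1) In_arcs(3,4)] Umap[OF _ that(2,3)]
      Umap(1)[OF _ that(3) that(2)]
    by (auto simp: \<gamma>_def fun_eq_iff fun_scale_apply linear_between_def)
  have "\<Theta> \<phi> \<in> ?H'" if \<phi>: "\<phi> \<in> ?H" for \<phi>
  proof -
    have "linear_between s s (rep_space U j) (rep_space (kernel_rep f M) j) (\<Theta> \<phi> j)" if j: "j \<in> verts Q" for j
    proof (cases "j = i")
      case True
      have "x + y \<in> rep_space U i" "s k x \<in> rep_space U i" if "x \<in> rep_space U i" "y \<in> rep_space U i" for x y k
        using that subspace_add subspace_scale fd_repD(2)[OF U] i by auto
      then show ?thesis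
        using \<gamma>I[OF \<phi>] \<gamma>0[OF \<phi>] \<gamma>add[OF \<phi>] \<gamma>scale[OF \<phi>]
        unfolding linear_between_def True
        by (auto simp: kernel_rep_def \<Theta>_def f.add f.scale)
    next
      case False
      then show ?thesis using \<phi>lin[OF \<phi> j False] by (simp add: \<Theta>_def[abs_def] kernel_rep_def)
    qed
    moreover have "\<Theta> \<phi> (head Q' a) (rep_map U a x) = rep_map (kernel_rep f M) a (\<Theta> \<phi> (tail Q' a) x)"
      if a: "a \<in> arcs Q" and x: "x \<in> rep_space U (tail Q' a)" for a x
    proof (cases "a \<in> In")
      case True
      then have "x \<in> rep_space U i" using x by simp
      then show ?thesis
        using True In_arcs(4)[OF True] inv[OF \<gamma>I[OF \<phi>]] by (simp add: \<Theta>_def kernel_rep_def \<gamma>_def)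
    next
      case False
      have "\<forall>a\<in>arcs Q. \<forall>x\<in>rep_space (coker_rep c U) (tail Q a).
          \<phi> (head Q a) (rep_map (coker_rep c U) a x) = rep_map M a (\<phi> (tail Q a) x)"
        using \<phi> by (auto simp: rep_hom_def)
      from this[rule_format, OF a, of x] show ?thesis
        using False a x sink[OF a] not_In[OF a False] by (simp add: \<Theta>_def kernel_rep_def coker_rep_def)
    qed
    moreover have "\<Theta> \<phi> j x = 0" if "j \<notin> verts Q \<or> x \<notin> rep_space U j" for j x
      using \<phi> that i by (auto simp: \<Theta>_def rep_hom_def coker_rep_def)
    ultimately show ?thesis by (simp add: rep_hom_def)
  qed
  moreover have "\<Theta> (\<phi> + \<psi>) = \<Theta> \<phi> + \<Theta> \<psi>" for \<phi> \<psi>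
  proof -
    have "\<gamma> (\<phi> + \<psi>) x = \<gamma> \<phi> x + \<gamma> \<psi> x" for x by (auto simp: \<gamma>_def)
    then show ?thesis by (intro ext) (simp add: \<Theta>_def f.add)
  qed
  moreover have "\<Theta> (family_scale s k \<phi>) = family_scale s k (\<Theta> \<phi>)" for \<phi> k
  proof -
    have "\<gamma> (family_scale s k \<phi>) x = fun_scale s k (\<gamma> \<phi> x)" for x
      by (auto simp: \<gamma>_def family_scale_def fun_scale_apply)
    moreover have fs: "family_scale s k \<psi> j x = s k (\<psi> j x)" for \<psi> :: "'v \<Rightarrow> 'b \<Rightarrow> 'b" and j x
      by (simp add: family_scale_def)
    ultimately have "\<Theta> (family_scale s k \<phi>) j x = s k (\<Theta> \<phi> j x)" for j x
      by (simp add: \<Theta>_def f.scale)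
    then show ?thesis by (intro ext) (simp add: fs)
  qed
  ultimately have lin: "linear_between (family_scale s) (family_scale s) ?H ?H' \<Theta>"
    by (simp add: linear_between_def)
  have "\<phi> = 0" if \<phi>: "\<phi> \<in> ?H" and 0: "\<Theta> \<phi> = 0" for \<phi>
  proof -
    have j: "\<phi> j x = 0" if "j \<noteq> i" for j x
      using fun_cong[OF fun_cong[OF 0, of j], of x] that by (simp add: \<Theta>_def)
    have "\<phi> i x = 0" for x
    proof (cases "x \<in> c ` ?IU")
      case True
      then obtain g where g: "g \<in> ?IU" "x = c g" by blast
      have "rep_map M a 0 = 0" if "a \<in> In" for a
        using linear_between_0[OF vs vs fd_repD(3)[OF M] fd_repD(2)[OF M]] In_arcs[OF that] by simp
      then show ?thesis using \<phi>c[OF \<phi> g(1)] g(2) j In_arcs(4) by simp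
    next
      case False
      then show ?thesis using \<phi> by (auto simp: rep_hom_def coker_rep_def)
    qed
    then have "\<phi> j x = 0" for j x using j by (cases "j = i") auto
    then show ?thesis by (simp add: fun_eq_iff)
  qed
  then show ?thesis
    unfolding hom_dim_def
    using dim_le_injective[OF H.vector_space_axioms H.vector_space_axioms lin]
      hom_dim_euler_form(1)[OF fin_digraph_axioms vs vs fd_rep_coker_rep[OF U c(1)] M]
      hom_dim_euler_form(1)[OF fin_digraph_reverse_at[OF fin_digraph_axioms] vs vs U fd_rep_kernel_rep[OF M f]]
    by blast
qed

end

section \<open>Transfer of the Hom bound and of subrepresentations along one reflection\<close>

lemma euler_form_cong:
  assumes "\<And>j. j \<in> verts Q \<Longrightarrow> d j = d' j" "\<And>j. j \<in> verts Q \<Longrightarrow> e j = e' j" "wf_digraph Q"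
  shows "euler_form Q d e = euler_form Q d' e'"
proof -
  interpret wf_digraph Q by fact
  have "(\<Sum>a\<in>arcs Q. int (d (tail Q a)) * int (e (head Q a))) = (\<Sum>a\<in>arcs Q. int (d' (tail Q a)) * int (e' (head Q a)))"
    using assms(1,2) by (intro sum.cong) auto
  moreover have "(\<Sum>i\<in>verts Q. int (d i) * int (e i)) = (\<Sum>i\<in>verts Q. int (d' i) * int (e' i))"
    using assms(1,2) by (intro sum.cong) auto
  ultimately show ?thesis unfolding euler_form_def by simp
qed

context sink_reflection
begin

lemma fin_digraph_Qd: "fin_digraph Qd" "wf_digraph Qd"
  using fin_digraph_delete_vertex[OF fin_digraph_axioms] fin_digraph_def by blast+

lemma fin_digraph_Q': "fin_digraph Q'"
  using fin_digraph_reverse_at[OF fin_digraph_axioms] .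

text \<open>The bound for \<open>M\<close> is tested on the cokernel representation and carried over
  by the adjunction. With the form of the quiver without \<open>i\<close>, the result serves both
  ways of proceeding: adding the neighbour terms gives the bound for the reflected vector, and
  \<open>U\<close> vanishing at \<open>i\<close> gives the bound after deletion.\<close>

lemma kernel_rep_hom_bound:
  assumes M: "fd_rep Q s M" and f: "Vector_Spaces.linear (fun_scale s) s f" "inj_on f (incoming (rep_space M))"
    and bound: "hom_bounded Q s s M e" and U: "fd_rep Q' s U"
  shows "euler_form Qd (dimension_vector s U) e - int (dimension_vector s U i) * int (e i)
    \<le> int (hom_dim Q' s s U (kernel_rep f M))"
proof -
  note vs = vector_space_axioms and fvs = F.vector_space_axioms
  let ?I = "incoming (rep_space U)" and ?L = "\<delta> U ` rep_space U i"
  have I: "finite_dim (fun_scale s) ?I" "F.dim ?I = (\<Sum>a\<in>In. dim (rep_space U (tail Q a)))"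
    using incoming_dim[of "rep_space U"] fd_repD(1)[OF U] by auto
  have Ui: "finite_dim s (rep_space U i)" "subspace (rep_space U i)" using fd_repD[OF U] i by auto
  have L: "F.subspace ?L" "?L \<subseteq> ?I"
    using linear_between_image_subspace[OF vs fvs \<delta>_linear[OF U] Ui(2)] \<delta>_linear[OF U]
    by (auto simp: linear_between_def)
  obtain c where c: "Vector_Spaces.linear (fun_scale s) s c" "{x\<in>?I. c x = 0} = ?L"
    using obtain_linear_with_kernel[OF fvs vs inf I(1) L] by blast
  let ?U = "coker_rep c U"
  \<comment> \<open>\<open>\<delta> U\<close> may have a kernel, so the cokernel can only be larger
    than expected; since \<open>e i\<close> is nonnegative this is the harmless direction.\<close>
  have "F.dim ?L \<le> dim (rep_space U i)"
    using rank_nullity(2)[OF vs fvs \<delta>_linear[OF U] Ui(1)] by simp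
  moreover have "F.dim ?I = F.dim ?L + dim (c ` ?I)"
    using rank_nullity(2)[OF fvs vs linear_imp_linear_between[OF c(1)] I(1), of UNIV] c(2) by simp
  ultimately have "(\<Sum>a\<in>In. int (dimension_vector s U (tail Q a))) \<le> int (dimension_vector s U i) + int (dimension_vector s ?U i)"
    unfolding of_nat_sum[symmetric] by (simp add: I(2) dimension_vector_def coker_rep_def)
  then have "(\<Sum>a\<in>In. int (dimension_vector s U (tail Q a))) * int (e i)
      \<le> (int (dimension_vector s U i) + int (dimension_vector s ?U i)) * int (e i)"
    by (rule mult_right_mono) simp
  moreover have "(\<Sum>a\<in>In. int (dimension_vector s ?U (tail Q a))) = (\<Sum>a\<in>In. int (dimension_vector s U (tail Q a)))"
    using In_arcs(4) by (intro sum.cong) (auto simp: dimension_vector_def coker_rep_def)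
  moreover have "euler_form Qd (dimension_vector s ?U) e = euler_form Qd (dimension_vector s U) e"
    by (rule euler_form_cong) (auto simp: dimension_vector_def coker_rep_def fin_digraph_Qd)
  moreover have "euler_form Q (dimension_vector s ?U) e \<le> int (hom_dim Q s s ?U M)"
    using bound fd_rep_coker_rep[OF U c(1)] by (simp add: hom_bounded_def)
  moreover have "hom_dim Q s s ?U M \<le> hom_dim Q' s s U (kernel_rep f M)"
    using c by (intro hom_dim_coker_rep_le[OF M f U]) auto
  ultimately show ?thesis
    unfolding euler_form_sink(1) by (simp add: algebra_simps)
qed

text \<open>The simple representation at the sink is projective: its morphisms to \<open>M\<close>
  are given by the image of a generator \<open>b\<close> in \<open>M\<close> at \<open>i\<close>,
  and its Euler form with \<open>e\<close> is \<open>e i\<close>.\<close>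

lemma dim_sink_ge:
  assumes M: "fd_rep Q s M" and bound: "hom_bounded Q s s M e"
  shows "e i \<le> dim (rep_space M i)"
proof -
  note vs = vector_space_axioms
  interpret H: vector_space "family_scale s :: 'k \<Rightarrow> ('v \<Rightarrow> 'b \<Rightarrow> 'b) \<Rightarrow> _"
    by (rule vector_space_family_scale[OF vs])
  have "\<exists>b :: 'b. b \<noteq> 0"
  proof (rule ccontr)
    assume "\<not> ?thesis"
    then have "UNIV = span {}" by auto
    then show False using inf finite_dim_span[of "{}"] by simp
  qed
  then obtain b :: 'b where b: "b \<noteq> 0" by blast
  define S :: "('v, 'a, 'b) quiver_rep" where
    "S = \<lparr>rep_space = (\<lambda>j. if j = i then span {b} else {0}), rep_map = (\<lambda>a x. 0)\<rparr>"
  have S0: "0 \<in> rep_space S j" for j by (simp add: S_def span_zero)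
  have "finite_dim s {0}" using finite_dim_span[of "{}"] by simp
  then have S: "fd_rep Q s S"
    using finite_dim_span[of "{b}"] S0 by (simp add: fd_rep_def linear_between_def) (simp add: S_def)
  have dS: "dimension_vector s S j = (if j = i then 1 else 0)" for j
    using dim_eq_card_independent[of "{b}"] dim_span[of "{b}"] dim_eq_card_independent[of "{}"] dim_span[of "{}"] b
    by (simp add: dimension_vector_def S_def independent_empty)
  have "euler_form Q (dimension_vector s S) e = int (e i)"
  proof -
    have "(\<Sum>j\<in>verts Q. int (dimension_vector s S j) * int (e j)) = int (e i)"
      using i by (simp add: dS if_distrib[of int] if_distrib[of "\<lambda>z. z * _"] cong: if_cong)
    moreover have "(\<Sum>a\<in>arcs Q. int (dimension_vector s S (tail Q a)) * int (e (head Q a))) = 0"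
      using sink by (intro sum.neutral) (simp add: dS)
    ultimately show ?thesis by (simp add: euler_form_def)
  qed
  then have "int (e i) \<le> int (hom_dim Q s s S M)" using bound S by (auto simp: hom_bounded_def)
  moreover have "hom_dim Q s s S M \<le> dim (rep_space M i)"
    unfolding hom_dim_def
  proof (rule dim_le_injective[OF H.vector_space_axioms vs])
    show "linear_between (family_scale s) s (rep_hom Q s s S M) (rep_space M i) (\<lambda>\<phi>. \<phi> i b)"
      using i span_base[of b "{b}"] by (auto simp: linear_between_def rep_hom_def family_scale_def S_def)
    show "finite_dim (family_scale s) (rep_hom Q s s S M)"
      using hom_dim_euler_form(1)[OF fin_digraph_axioms vs vs S M] .
    show "finite_dim s (rep_space M i)" using fd_repD(1)[OF M i] .
    fix \<phi> assume \<phi>: "\<phi> \<in> rep_hom Q s s S M" and 0: "\<phi> i b = 0"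
    have "\<phi> j x = 0" for j x
    proof (cases "j \<in> verts Q \<and> x \<in> rep_space S j")
      case True
      then have lin: "linear_between s s (rep_space S j) (rep_space M j) (\<phi> j)" using \<phi> by (auto simp: rep_hom_def)
      show ?thesis
      proof (cases "j = i")
        case True
        then obtain k where "x = s k b"
          using \<open>j \<in> verts Q \<and> x \<in> rep_space S j\<close> by (auto simp: S_def span_singleton)
        moreover have "b \<in> rep_space S i" by (simp add: S_def span_base)
        ultimately show ?thesis using lin True 0 by (auto simp: linear_between_def)
      next
        case False
        then show ?thesis
          using True linear_between_0[OF vs vs lin] fd_repD(2)[OF S] by (auto simp: S_def)
      qed
    next
      case False
      then show ?thesis using \<phi> by (auto simp: rep_hom_def)
    qed
    then show "\<phi> = 0" by (simp add: fun_eq_iff)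
  qed
  ultimately show ?thesis by linarith
qed

lemma obtain_kernel_embedding:
  assumes M: "fd_rep Q s M"
  obtains f where "Vector_Spaces.linear (fun_scale s) s f" "inj_on f (incoming (rep_space M))"
  using finite_dim_copy[OF F.vector_space_axioms vector_space_axioms inf, of "incoming (rep_space M)"]
    incoming_dim(1)[of "rep_space M"] fd_repD(1)[OF M] by blast

text \<open>A test representation of the smaller quiver is extended by 0 at \<open>i\<close>. Its
  cokernel reflection has the full direct sum of the neighbours at \<open>i\<close>, so that the
  terms with \<open>e i\<close> cancel in the Euler form.\<close>

lemma hom_bounded_delete_vertex:
  assumes M: "fd_rep Q s M" and bound: "hom_bounded Q s s M e"
  shows "hom_bounded Qd s s M e"
  unfolding hom_bounded_def
proof (intro allI impI)
  fix U :: "('v, 'a, 'b) quiver_rep" assume U: "fd_rep Qd s U"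
  note vs = vector_space_axioms
  interpret H: vector_space "family_scale s :: 'k \<Rightarrow> ('v \<Rightarrow> 'b \<Rightarrow> 'b) \<Rightarrow> _"
    by (rule vector_space_family_scale[OF vs])
  obtain f where f: "Vector_Spaces.linear (fun_scale s) s f" "inj_on f (incoming (rep_space M))"
    using obtain_kernel_embedding[OF M] by blast
  define V :: "('v, 'a, 'b) quiver_rep" where
    "V = \<lparr>rep_space = (rep_space U)(i := {0}), rep_map = (\<lambda>a x. if a \<in> In then 0 else rep_map U a x)\<rparr>"
  have fin0: "finite_dim s {0}" using finite_dim_span[of "{}"] by simp
  have V: "fd_rep Q' s V"
    unfolding fd_rep_def Q'_simps(1,2)
  proof (intro conjI ballI)
    fix j assume "j \<in> verts Q"
    then show "finite_dim s (rep_space V j)" using fin0 fd_repD(1)[OF U, of j] by (simp add: V_def)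
  next
    fix a assume a: "a \<in> arcs Q"
    show "linear_between s s (rep_space V (tail Q' a)) (rep_space V (head Q' a)) (rep_map V a)"
    proof (cases "a \<in> In")
      case True
      then have "0 \<in> rep_space U (tail Q a)" using subspace_0[OF fd_repD(2)[OF U]] In_arcs[OF True] by simp
      then show ?thesis using True In_arcs(4)[OF True] by (simp add: V_def linear_between_def)
    next
      case False
      then show ?thesis using fd_repD(3)[OF U, of a] a sink[OF a] not_In[OF a] by (simp add: V_def)
    qed
  qed
  have dV: "dimension_vector s V j = (if j = i then 0 else dimension_vector s U j)" for j
    using dim_eq_card_independent[of "{}"] dim_span[of "{}"]
    by (simp add: dimension_vector_def V_def independent_empty)
  have "euler_form Qd (dimension_vector s U) e = euler_form Qd (dimension_vector s V) e"
    by (rule euler_form_cong) (auto simp: dV fin_digraph_Qd)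
  also have "\<dots> \<le> int (hom_dim Q' s s V (kernel_rep f M))"
    using kernel_rep_hom_bound[OF M f bound V] dV[of i] by simp
  also have "\<dots> \<le> int (hom_dim Qd s s U M)"
  proof -
    \<comment> \<open>A morphism vanishes at \<open>i\<close>, where \<open>V\<close> is 0, and
      elsewhere the reflected representation agrees with \<open>M\<close>; the same family is
      therefore a morphism over the smaller quiver.\<close>
    have "rep_hom Q' s s V (kernel_rep f M) \<subseteq> rep_hom Qd s s U M"
    proof
      fix \<phi> assume \<phi>: "\<phi> \<in> rep_hom Q' s s V (kernel_rep f M)"
      have lin: "linear_between s s (rep_space V j) (rep_space (kernel_rep f M) j) (\<phi> j)" if "j \<in> verts Q" for j
        using \<phi> that by (simp add: rep_hom_def)
      have "\<phi> i 0 = 0" using linear_between_0[OF vs vs lin[OF i]] fd_repD(2)[OF V] i by simp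
      then have "\<phi> i x = 0" for x using \<phi> by (cases "x = 0") (auto simp: rep_hom_def V_def)
      then have "\<phi> j x = 0" if "j \<notin> verts Qd \<or> x \<notin> rep_space U j" for j x
        using \<phi> that by (cases "j = i") (auto simp: rep_hom_def V_def)
      moreover have "linear_between s s (rep_space U j) (rep_space M j) (\<phi> j)" if "j \<in> verts Qd" for j
        using lin[of j] that by (auto simp: V_def kernel_rep_def)
      moreover have "\<phi> (head Qd a) (rep_map U a x) = rep_map M a (\<phi> (tail Qd a) x)"
        if "a \<in> arcs Qd" "x \<in> rep_space U (tail Qd a)" for a x
      proof -
        have a: "a \<in> arcs Q" "a \<notin> In" using that by auto
        have "\<forall>a\<in>arcs Q. \<forall>x\<in>rep_space V (tail Q' a).
            \<phi> (head Q' a) (rep_map V a x) = rep_map (kernel_rep f M) a (\<phi> (tail Q' a) x)"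
          using \<phi> by (simp add: rep_hom_def)
        from this[rule_format, OF a(1), of x] show ?thesis
          using a that sink[OF a(1)] by (simp add: V_def kernel_rep_def)
      qed
      ultimately show "\<phi> \<in> rep_hom Qd s s U M" unfolding rep_hom_def by blast
    qed
    moreover have "finite_dim (family_scale s) (rep_hom Qd s s U M)"
      using hom_dim_euler_form(1)[OF fin_digraph_Qd(1) vs vs U fd_rep_delete_vertex[OF M]] .
    moreover have "H.subspace (rep_hom Q' s s V (kernel_rep f M))"
      using H.finite_dim_imp_subspace hom_dim_euler_form(1)[OF fin_digraph_Q' vs vs V fd_rep_kernel_rep[OF M f]] by blast
    ultimately show ?thesis unfolding hom_dim_def using H.finite_dim_subspace(2) by simp
  qed
  finally show "euler_form Qd (dimension_vector s U) e \<le> int (hom_dim Qd s s U M)" .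
qed

lemma hom_bounded_kernel_rep:
  assumes M: "fd_rep Q s M" and f: "Vector_Spaces.linear (fun_scale s) s f" "inj_on f (incoming (rep_space M))"
    and bound: "hom_bounded Q s s M e" and e: "int e' = (\<Sum>a\<in>In. int (e (tail Q a))) - int (e i)"
  shows "hom_bounded Q' s s (kernel_rep f M) (e(i := e'))"
  unfolding hom_bounded_def
proof (intro allI impI)
  fix U :: "('v, 'a, 'b) quiver_rep" assume U: "fd_rep Q' s U"
  let ?d = "dimension_vector s U"
  have "(\<Sum>a\<in>In. int ((e(i := e')) (tail Q a))) = (\<Sum>a\<in>In. int (e (tail Q a)))"
    using In_arcs(4) by (intro sum.cong) auto
  moreover have "euler_form Qd ?d (e(i := e')) = euler_form Qd ?d e"
    by (rule euler_form_cong) (auto simp: fin_digraph_Qd)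
  ultimately have "euler_form Q' ?d (e(i := e')) = euler_form Qd ?d e - int (?d i) * int (e i)"
    unfolding euler_form_sink(2) by (simp add: e algebra_simps)
  then show "euler_form Q' ?d (e(i := e')) \<le> int (hom_dim Q' s s U (kernel_rep f M))"
    using kernel_rep_hom_bound[OF M f bound U] by simp
qed

text \<open>The direct sum of the neighbouring spaces of \<open>N\<close> already has dimension at
  most \<open>e i\<close>, so its image fits in whatever \<open>N\<close> is.\<close>

lemma subrep_delete_vertex:
  assumes M: "fd_rep Q s M" and bound: "hom_bounded Q s s M e"
    and e: "(\<Sum>a\<in>In. int (e (tail Q a))) \<le> int (e i)"
    and N: "subrep Qd s N M" "\<forall>j\<in>verts Qd. dimension_vector s N j = e j"
  shows "\<exists>N. subrep Q s N M \<and> (\<forall>j\<in>verts Q. dimension_vector s N j = e j)"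
proof (rule extend_to_sink[OF M N _ dim_sink_ge[OF M bound]])
  let ?I = "incoming (rep_space N)"
  have fin: "finite_dim s (rep_space N j)" "rep_space N j \<subseteq> rep_space M j" if "j \<in> verts Q" "j \<noteq> i" for j
    using N(1) that by (auto simp: subrep_def fd_rep_def)
  have lin: "linear_between (fun_scale s) s ?I UNIV (\<sigma> M)"
    using linear_between_subset[OF \<sigma>_linear[OF M] incoming_mono] fin(2) by blast
  have "dim (\<sigma> M ` ?I) \<le> F.dim ?I"
    using rank_nullity(2)[OF F.vector_space_axioms vector_space_axioms lin incoming_dim(1)] fin(1) by auto
  also have "F.dim ?I = (\<Sum>a\<in>In. e (tail Q a))"
    using incoming_dim(2)[of "rep_space N"] fin(1) N(2) In_arcs by (auto simp: dimension_vector_def intro!: sum.cong)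
  also have "\<dots> \<le> e i"
  proof -
    have "int (\<Sum>a\<in>In. e (tail Q a)) \<le> int (e i)" using e by simp
    then show ?thesis by (simp only: of_nat_le_iff)
  qed
  finally show "dim (\<sigma> M ` ?I) \<le> e i" .
qed

text \<open>The space of \<open>N\<close> at \<open>i\<close> consists of tuples with entries in
  \<open>N\<close>, hence lies in the kernel of \<open>\<sigma> M\<close> restricted to them. That
  kernel has dimension at least \<open>e'\<close>, so by rank and nullity the image has dimension at
  most \<open>e i\<close>.\<close>

lemma subrep_kernel_rep:
  assumes M: "fd_rep Q s M" and f: "Vector_Spaces.linear (fun_scale s) s f" "inj_on f (incoming (rep_space M))"
    and bound: "hom_bounded Q s s M e" and e: "int e' = (\<Sum>a\<in>In. int (e (tail Q a))) - int (e i)"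
    and N: "subrep Q' s N (kernel_rep f M)" "\<forall>j\<in>verts Q'. dimension_vector s N j = (e(i := e')) j"
  shows "\<exists>N. subrep Q s N M \<and> (\<forall>j\<in>verts Q. dimension_vector s N j = e j)"
proof (rule extend_to_sink[where N = N and e = e, OF M _ _ _ dim_sink_ge[OF M bound]])
  let ?I = "incoming (rep_space N)" and ?K = "{g\<in>incoming (rep_space N). \<sigma> M g = 0}"
  note vs = vector_space_axioms and fvs = F.vector_space_axioms
  have Nrep: "fd_rep Q' s N" using N(1) by (simp add: subrep_def)
  have Nmap: "rep_map N a x = rep_map (kernel_rep f M) a x" if "a \<in> arcs Q" "x \<in> rep_space N (tail Q' a)" for a x
    using N(1) that by (simp add: subrep_def)
  have Nsub: "rep_space N j \<subseteq> rep_space M j" if "j \<in> verts Q" "j \<noteq> i" for j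
  proof -
    have "rep_space N j \<subseteq> rep_space (kernel_rep f M) j" using N(1) that(1) by (simp add: subrep_def)
    then show ?thesis using that(2) by (simp add: kernel_rep_def)
  qed
  have fin: "finite_dim s (rep_space N j)" if "j \<in> verts Q" for j using fd_repD(1)[OF Nrep] that by simp
  show "subrep Qd s N M"
    unfolding subrep_def fd_rep_def
  proof (intro conjI ballI)
    fix a assume "a \<in> arcs Qd"
    then have a: "a \<in> arcs Q" "a \<notin> In" by auto
    then show "linear_between s s (rep_space N (tail Qd a)) (rep_space N (head Qd a)) (rep_map N a)"
      using fd_repD(3)[OF Nrep, of a] by simp
    fix x assume "x \<in> rep_space N (tail Qd a)"
    then show "rep_map N a x = rep_map M a x" using Nmap[OF a(1), of x] a by (simp add: kernel_rep_def)
  qed (use fin Nsub in auto)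
  show "\<forall>j\<in>verts Qd. dimension_vector s N j = e j" using N(2) by auto
  have I: "finite_dim (fun_scale s) ?I" "F.dim ?I = (\<Sum>a\<in>In. e (tail Q a))" "F.subspace ?I"
    using incoming_dim[of "rep_space N"] fin N(2) In_arcs by (auto simp: dimension_vector_def intro!: sum.cong)
  have lin: "linear_between (fun_scale s) s ?I UNIV (\<sigma> M)"
    using linear_between_subset[OF \<sigma>_linear[OF M] incoming_mono] Nsub by blast
  have K: "finite_dim (fun_scale s) ?K"
    using F.finite_dim_subspace(1)[OF I(1) linear_between_kernel[OF fvs vs lin I(3)]] by blast
  have "rep_space N i \<subseteq> f ` ?K"
  proof
    fix y assume y: "y \<in> rep_space N i"
    then have "y \<in> rep_space (kernel_rep f M) i" using N(1) i by (auto simp: subrep_def)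
    then obtain g where g: "g \<in> incoming (rep_space M)" "\<sigma> M g = 0" "y = f g" by (auto simp: kernel_rep_def)
    have "g a \<in> rep_space N (tail Q a)" if a: "a \<in> In" for a
    proof -
      have "rep_map N a y \<in> rep_space N (tail Q a)"
        using fd_repD(3)[OF Nrep, of a] y a In_arcs(1)[OF a] by (simp add: linear_between_def)
      moreover have "rep_map N a y = g a"
        using Nmap[of a y] y a In_arcs(1)[OF a] g the_inv_into_f_f[OF f(2) g(1)] by (simp add: kernel_rep_def)
      ultimately show ?thesis by simp
    qed
    then have "g \<in> ?K" using g by (auto simp: incoming_def pi_space_def)
    then show "y \<in> f ` ?K" using g(3) by blast
  qed
  then have "dim (rep_space N i) \<le> dim (f ` ?K)"
    using finite_dim_subspace(2)[OF _ finite_dim_imp_subspace[OF fin[OF i]]]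
      rank_nullity(1)[OF fvs vs linear_imp_linear_between[OF f(1)] K] by blast
  also have "\<dots> \<le> F.dim ?K"
    using rank_nullity(2)[OF fvs vs linear_imp_linear_between[OF f(1)] K, of UNIV] by simp
  finally have "e' \<le> F.dim ?K" using N(2) i by (simp add: dimension_vector_def)
  moreover have "F.dim ?I = F.dim ?K + dim (\<sigma> M ` ?I)" using rank_nullity(2)[OF fvs vs lin I(1)] .
  moreover have "e' + e i = (\<Sum>a\<in>In. e (tail Q a))"
  proof -
    have "int (e' + e i) = int (\<Sum>a\<in>In. e (tail Q a))" using e by simp
    then show ?thesis by (simp only: of_nat_eq_iff)
  qed
  ultimately show "dim (\<sigma> M ` ?I) \<le> e i" using I(2) by linarith
qed

end

section \<open>The main induction\<close>

text \<open>Arrows run only from later to earlier entries. The first vertex is thus a sink, and once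
  it has been reversed into a source it can move to the end, making the second vertex the next
  sink.\<close>

definition admissible_order :: "('v, 'a) pre_digraph \<Rightarrow> 'v list \<Rightarrow> bool" where
  "admissible_order Q vs \<longleftrightarrow> distinct vs \<and> set vs = verts Q \<and>
     sorted_wrt (\<lambda>u w. \<forall>a\<in>arcs Q. \<not> (tail Q a = u \<and> head Q a = w)) vs"

lemma admissible_order_Cons:
  assumes Q: "wf_digraph Q" and noloop: "\<And>a. a \<in> arcs Q \<Longrightarrow> tail Q a \<noteq> head Q a"
    and adm: "admissible_order Q (v # vs)"
  shows "v \<in> verts Q" "\<And>a. a \<in> arcs Q \<Longrightarrow> tail Q a \<noteq> v"
    "admissible_order (delete_vertex Q v) vs" "admissible_order (reverse_at Q v) (vs @ [v])"
proof -
  interpret wf_digraph Q by fact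
  show v: "v \<in> verts Q" using adm by (auto simp: admissible_order_def)
  show sink: "tail Q a \<noteq> v" if a: "a \<in> arcs Q" for a
  proof
    assume t: "tail Q a = v"
    have "head Q a \<in> set (v # vs)"
      using head_in_verts[OF a] adm by (simp only: admissible_order_def)
    then have "head Q a \<in> set vs" using noloop[OF a] t by auto
    then show False using adm a t by (auto simp: admissible_order_def)
  qed
  show "admissible_order (delete_vertex Q v) vs"
    using adm unfolding admissible_order_def
    by (auto simp: delete_vertex_def elim!: sorted_wrt_mono_rel[rotated])
  have "sorted_wrt (\<lambda>u w. \<forall>a\<in>arcs Q. \<not> (tail Q a = u \<and> head Q a = w)) vs" "v \<notin> set vs"
    using adm by (auto simp: admissible_order_def)
  then have "sorted_wrt (\<lambda>u w. \<forall>a\<in>arcs Q. \<not> (tail (reverse_at Q v) a = u \<and> head (reverse_at Q v) a = w)) vs"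
    by (elim sorted_wrt_mono_rel[rotated]) (auto simp: reverse_at_def)
  moreover have "tail (reverse_at Q v) a = u \<Longrightarrow> head (reverse_at Q v) a \<noteq> v" if "a \<in> arcs Q" "u \<in> set vs" for a u
    using sink[OF that(1)] by (auto simp: reverse_at_def)
  ultimately show "admissible_order (reverse_at Q v) (vs @ [v])"
    using adm unfolding admissible_order_def
    by (auto simp: sorted_wrt_append) (auto simp: reverse_at_def)
qed

text \<open>Otherwise every vertex is the tail of an arrow, so there are at least as many arrows as
  vertices, and the Tits form is nonpositive on the all-one vector.\<close>

lemma exists_sink:
  assumes Q: "fin_digraph Q" and y: "subadditive_weight Q y" and "verts Q \<noteq> {}"
  shows "\<exists>v\<in>verts Q. \<forall>a\<in>arcs Q. tail Q a \<noteq> v"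
proof (rule ccontr)
  interpret fin_digraph Q by fact
  assume "\<not> ?thesis"
  then have "\<exists>a\<in>arcs Q. tail Q a = v" if "v \<in> verts Q" for v using that by blast
  then have "verts Q \<subseteq> tail Q ` arcs Q" by blast
  then have "card (verts Q) \<le> card (arcs Q)" by (meson card_image_le card_mono finite_arcs finite_imageI le_trans)
  moreover have "tits_form Q (\<lambda>v. 1) = 2 * int (card (verts Q)) - 2 * int (card (arcs Q))"
    using sum_nbr_sum[OF Q, of "\<lambda>v. 1::int" "\<lambda>v. 1"] by (simp add: tits_form_def sum_subtractf)
  ultimately have "real_of_int (tits_form Q (\<lambda>v. 1)) \<le> 0" by simp
  moreover have "0 < (\<Sum>v\<in>verts Q. real_of_int (2 * y v - nbr_sum Q y v) / real_of_int (y v) * (real_of_int 1)\<^sup>2)"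
    using y assms(3) by (intro sum_pos) (auto simp: subadditive_weight_def)
  ultimately show False using tits_form_lower_bound[OF Q y, of "\<lambda>v. 1"] by linarith
qed

lemma exists_admissible_order:
  assumes "fin_digraph Q" "subadditive_weight Q y"
  shows "\<exists>vs. admissible_order Q vs"
  using assms
proof (induction "card (verts Q)" arbitrary: Q)
  case 0
  then have "verts Q = {}" using fin_digraph.finite_verts by fastforce
  then have "admissible_order Q []" by (simp add: admissible_order_def)
  then show ?case by blast
next
  case (Suc n)
  interpret fin_digraph Q by fact
  obtain v where v: "v \<in> verts Q" "\<forall>a\<in>arcs Q. tail Q a \<noteq> v"
    using exists_sink[OF Suc.prems] Suc.hyps(2) by fastforce
  have "n = card (verts (delete_vertex Q v))" using Suc.hyps(2) v(1) by (simp add: delete_vertex_def)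
  then obtain vs where "admissible_order (delete_vertex Q v) vs"
    using Suc.hyps(1) fin_digraph_delete_vertex[OF Suc.prems(1)] subadditive_weight_delete_vertex[OF Suc.prems] by blast
  then have vs: "distinct vs" "set vs = verts Q - {v}"
    "sorted_wrt (\<lambda>u w. \<forall>a\<in>arcs (delete_vertex Q v). \<not> (tail Q a = u \<and> head Q a = w)) vs"
    by (auto simp: admissible_order_def delete_vertex_def)
  \<comment> \<open>Arrows of \<open>Q\<close> between entries of \<open>vs\<close> avoid
    \<open>v\<close> and so survive its deletion.\<close>
  have "sorted_wrt (\<lambda>u w. \<forall>a\<in>arcs Q. \<not> (tail Q a = u \<and> head Q a = w)) vs"
    by (rule sorted_wrt_mono_rel[OF _ vs(3)]) (use vs(2) in \<open>auto simp: delete_vertex_def\<close>)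
  then have "admissible_order Q (v # vs)"
    using vs v by (auto simp: admissible_order_def)
  then show ?case by blast
qed

text \<open>A nested induction: the outer one on the number of vertices, lowered by deletion, the
  inner one on a time at which the reflected vector becomes nonpositive, lowered by each reflection.
  Quiver, order, representation and dimension vector all vary, whereas the weight \<open>y\<close>
  stays the same.\<close>

lemma hom_bounded_imp_subrep_ordered:
  fixes Q :: "('v, 'a) pre_digraph" and s :: "'k::field \<Rightarrow> 'b::ab_group_add \<Rightarrow> 'b"
  assumes s: "vector_space s" "\<not> finite_dim s UNIV"
    and "fin_digraph Q" "subadditive_weight Q y" "admissible_order Q vs"
    and "fd_rep Q s M" "hom_bounded Q s s M e"
  shows "\<exists>N. subrep Q s N M \<and> (\<forall>i\<in>verts Q. dimension_vector s N i = e i)"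
  using assms(3-)
proof (induction "length vs" arbitrary: Q vs M e)
  case 0
  then have "verts Q = {}" by (simp add: admissible_order_def)
  moreover have "arcs Q = {}"
    using wf_digraph.tail_in_verts[of Q] 0 calculation fin_digraph_def by blast
  ultimately have "subrep Q s M M" by (simp add: subrep_def fd_rep_def)
  then show ?case using \<open>verts Q = {}\<close> by blast
next
  case (Suc n)
  have loc: "sink_reflection Q s v" "admissible_order (delete_vertex Q v) ws" "admissible_order (reverse_at Q v) (ws @ [v])"
    if "fin_digraph Q" "subadditive_weight Q y" "admissible_order Q (v # ws)" for Q :: "('v, 'a) pre_digraph" and v ws
  proof -
    have wf: "wf_digraph Q" using that(1) by (simp add: fin_digraph_def)
    note adm = admissible_order_Cons[OF wf subadditive_weight_no_loops[OF that(1,2)] that(3)]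
    show "sink_reflection Q s v"
      using that(1) s adm(1,2) by (simp add: sink_reflection_def sink_reflection_axioms_def)
    show "admissible_order (delete_vertex Q v) ws" by (rule adm(3))
    show "admissible_order (reverse_at Q v) (ws @ [v])" by (rule adm(4))
  qed
  \<comment> \<open>The inequality says that the reflected coordinate at \<open>v\<close> is
    nonpositive. Then the outer induction hypothesis applies to the quiver without
    \<open>v\<close>.\<close>
  have delete: "\<exists>N. subrep Q s N M \<and> (\<forall>i\<in>verts Q. dimension_vector s N i = e i)"
    if "nbr_sum Q (\<lambda>v. int (e v)) v \<le> int (e v)" "length ws = n" "fin_digraph Q" "subadditive_weight Q y"
      "admissible_order Q (v # ws)" "fd_rep Q s M" "hom_bounded Q s s M e"
    for Q :: "('v, 'a) pre_digraph" and v ws M e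
  proof -
    interpret sink_reflection Q s v using loc(1) that by blast
    have "\<exists>N. subrep Qd s N M \<and> (\<forall>i\<in>verts Qd. dimension_vector s N i = e i)"
      using that loc(2)[OF that(3-5)]
      by (intro Suc.hyps(1)[of ws]) (simp_all only: fin_digraph_Qd subadditive_weight_delete_vertex
          fd_rep_delete_vertex hom_bounded_delete_vertex)
    then show ?thesis
      using subrep_delete_vertex[OF that(6,7)] that(1) unfolding nbr_sum_sink by blast
  qed
  have "\<exists>N. subrep Q s N M \<and> (\<forall>i\<in>verts Q. dimension_vector s N i = e i)"
    if "stops (nbr_sum Q) (v # ws) (\<lambda>v. int (e v)) t" "length ws = n" "fin_digraph Q" "subadditive_weight Q y"
      "admissible_order Q (v # ws)" "fd_rep Q s M" "hom_bounded Q s s M e"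
    for t and Q :: "('v, 'a) pre_digraph" and v ws M e
    using that
  proof (induction t arbitrary: Q v ws M e)
    case (0 Q v ws M e)
    then show ?case by (intro delete[of Q e v ws M]) (auto simp: reflect_def)
  next
    case (Suc t Q v ws M e)
    show ?case
    proof (cases "nbr_sum Q (\<lambda>v. int (e v)) v \<le> int (e v)")
      case True
      then show ?thesis using Suc.prems by (intro delete[of Q e v ws M]) auto
    next
      case False
      interpret sink_reflection Q s v using loc(1) Suc.prems by blast
      define e' where "e' = nat (nbr_sum Q (\<lambda>v. int (e v)) v - int (e v))"
      have e': "int e' = nbr_sum Q (\<lambda>v. int (e v)) v - int (e v)" using False by (simp add: e'_def)
      obtain f where f: "Vector_Spaces.linear (fun_scale s) s f" "inj_on f (incoming (rep_space M))"
        using obtain_kernel_embedding[OF Suc.prems(6)] by blast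
      \<comment> \<open>This is the rotation performed by \<open>stops\<close>, and also the
        admissible order after reversal; the number of vertices, hence \<open>n\<close>, is
        kept.\<close>
      obtain v' ws' where vs': "ws @ [v] = v' # ws'" by (cases "ws @ [v]") auto
      have len: "length ws' = n" using arg_cong[OF vs', of length] Suc.prems(2) by simp
      have "(\<lambda>u. int ((e(v := e')) u)) = reflect (nbr_sum Q) v (\<lambda>v. int (e v))"
        by (auto simp: reflect_def e')
      then have st: "stops (nbr_sum Q') (v' # ws') (\<lambda>u. int ((e(v := e')) u)) t"
        using Suc.prems(1) by (simp add: nbr_sum_reverse_at vs' del: fun_upd_apply)
      have "\<exists>N. subrep Q' s N (kernel_rep f M) \<and> (\<forall>i\<in>verts Q'. dimension_vector s N i = (e(v := e')) i)"
      proof (rule Suc.IH[OF st len fin_digraph_Q'])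
        show "subadditive_weight Q' y" using subadditive_weight_reverse_at Suc.prems(4) .
        show "admissible_order Q' (v' # ws')" using loc(3)[OF Suc.prems(3-5)] unfolding vs' .
        show "fd_rep Q' s (kernel_rep f M)" using fd_rep_kernel_rep[OF Suc.prems(6) f] .
        show "hom_bounded Q' s s (kernel_rep f M) (e(v := e'))"
          using hom_bounded_kernel_rep[OF Suc.prems(6) f Suc.prems(7)] e' unfolding nbr_sum_sink .
      qed
      then show ?thesis
        using subrep_kernel_rep[OF Suc.prems(6) f Suc.prems(7) e'[unfolded nbr_sum_sink]] by blast
    qed
  qed
  moreover obtain v ws where vs: "vs = v # ws" "length ws = n" using Suc.hyps(2) by (cases vs) auto
  moreover obtain t where "stops (nbr_sum Q) (v # ws) (\<lambda>v. int (e v)) t"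
    using reflections_stop[OF Suc.prems(1,2), of vs "\<lambda>v. int (e v)"] Suc.prems(3) vs
    by (auto simp: admissible_order_def)
  ultimately show ?case using Suc.prems by blast
qed

lemma hom_bounded_imp_subrep:
  fixes Q :: "('v, 'a) pre_digraph" and s :: "'k::field \<Rightarrow> 'b::ab_group_add \<Rightarrow> 'b"
  assumes "vector_space s" "\<not> finite_dim s UNIV" "fin_digraph Q" "subadditive_weight Q y"
    and "fd_rep Q s M" "hom_bounded Q s s M e"
  shows "\<exists>N. subrep Q s N M \<and> (\<forall>i\<in>verts Q. dimension_vector s N i = e i)"
  using exists_admissible_order[OF assms(3,4)] hom_bounded_imp_subrep_ordered[OF assms(1-4) _ assms(5,6)] by blast

section \<open>Change of the ambient space\<close>

text \<open>Composition with \<open>\<psi>\<close> is injective on Hom. It is applied to the copying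
  of \<open>M\<close> into another ambient space and to the inclusion of a
  subrepresentation.\<close>

lemma hom_dim_mono_injective:
  fixes s :: "'k::field \<Rightarrow> 'b::ab_group_add \<Rightarrow> 'b" and t :: "'k \<Rightarrow> 'c::ab_group_add \<Rightarrow> 'c"
    and r :: "'k \<Rightarrow> 'd::ab_group_add \<Rightarrow> 'd" and U :: "('v, 'a, 'b) quiver_rep"
  assumes Q: "fin_digraph Q" and s: "vector_space s" and t: "vector_space t" and r: "vector_space r"
    and U: "fd_rep Q s U" and V: "fd_rep Q t V" and W: "fd_rep Q r W"
    and \<psi>: "\<psi> \<in> rep_hom Q t r V W" "\<And>i. i \<in> verts Q \<Longrightarrow> inj_on (\<psi> i) (rep_space V i)"
  shows "hom_dim Q s t U V \<le> hom_dim Q s r U W"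
proof -
  interpret fin_digraph Q by fact
  interpret T: vector_space t by fact
  interpret HT: vector_space "family_scale t :: 'k \<Rightarrow> ('v \<Rightarrow> 'b \<Rightarrow> 'c) \<Rightarrow> _"
    by (rule vector_space_family_scale[OF t])
  interpret HR: vector_space "family_scale r :: 'k \<Rightarrow> ('v \<Rightarrow> 'b \<Rightarrow> 'd) \<Rightarrow> _"
    by (rule vector_space_family_scale[OF r])
  interpret R: vector_space r by fact
  define \<Psi> where "\<Psi> \<phi> = (\<lambda>i x. if i \<in> verts Q \<and> x \<in> rep_space U i then \<psi> i (\<phi> i x) else 0)"
    for \<phi> :: "'v \<Rightarrow> 'b \<Rightarrow> 'c"
  have \<psi>lin: "linear_between t r (rep_space V i) (rep_space W i) (\<psi> i)" if "i \<in> verts Q" for i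
    using \<psi>(1) that by (simp add: rep_hom_def)
  have \<psi>map: "\<psi> (head Q a) (rep_map V a x) = rep_map W a (\<psi> (tail Q a) x)"
    if "a \<in> arcs Q" "x \<in> rep_space V (tail Q a)" for a x
    using \<psi>(1) that by (simp add: rep_hom_def)
  have \<phi>in: "\<phi> i x \<in> rep_space V i" if "\<phi> \<in> rep_hom Q s t U V" "i \<in> verts Q" "x \<in> rep_space U i" for \<phi> i x
    using that by (simp add: rep_hom_def linear_between_def)
  have "\<Psi> \<phi> \<in> rep_hom Q s r U W" if \<phi>: "\<phi> \<in> rep_hom Q s t U V" for \<phi>
  proof -
    have "linear_between s r (rep_space U i) (rep_space W i) (\<Psi> \<phi> i)" if i: "i \<in> verts Q" for i
    proof -
      interpret S: vector_space s by fact
      have "linear_between s t (rep_space U i) (rep_space V i) (\<phi> i)" using \<phi> i by (simp add: rep_hom_def)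
      then show ?thesis
        using \<psi>lin[OF i] i S.subspace_add[OF fd_repD(2)[OF U i]] S.subspace_scale[OF fd_repD(2)[OF U i]]
        by (simp add: linear_between_def \<Psi>_def)
    qed
    moreover have "\<Psi> \<phi> (head Q a) (rep_map U a x) = rep_map W a (\<Psi> \<phi> (tail Q a) x)"
      if a: "a \<in> arcs Q" and x: "x \<in> rep_space U (tail Q a)" for a x
    proof -
      have "rep_map U a x \<in> rep_space U (head Q a)" using fd_repD(3)[OF U a] x by (simp add: linear_between_def)
      moreover have "\<phi> (head Q a) (rep_map U a x) = rep_map V a (\<phi> (tail Q a) x)"
        using \<phi> a x by (simp add: rep_hom_def)
      ultimately show ?thesis using a x \<psi>map[OF a \<phi>in[OF \<phi> _ x]] by (simp add: \<Psi>_def)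
    qed
    ultimately show ?thesis by (simp add: rep_hom_def) (auto simp: \<Psi>_def)
  qed
  moreover have "\<Psi> (\<phi> + \<phi>') = \<Psi> \<phi> + \<Psi> \<phi>'"
    if "\<phi> \<in> rep_hom Q s t U V" "\<phi>' \<in> rep_hom Q s t U V" for \<phi> \<phi>'
    using \<psi>lin \<phi>in[OF that(1)] \<phi>in[OF that(2)] by (auto simp: \<Psi>_def fun_eq_iff linear_between_def)
  moreover have "\<Psi> (family_scale t k \<phi>) = family_scale r k (\<Psi> \<phi>)" if "\<phi> \<in> rep_hom Q s t U V" for \<phi> k
    using \<psi>lin \<phi>in[OF that] by (auto simp: \<Psi>_def fun_eq_iff linear_between_def family_scale_def)
  ultimately have lin: "linear_between (family_scale t) (family_scale r) (rep_hom Q s t U V) (rep_hom Q s r U W) \<Psi>"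
    by (simp add: linear_between_def)
  have "\<phi> = 0" if \<phi>: "\<phi> \<in> rep_hom Q s t U V" and 0: "\<Psi> \<phi> = 0" for \<phi>
  proof -
    have "\<phi> i x = 0" for i x
    proof (cases "i \<in> verts Q \<and> x \<in> rep_space U i")
      case True
      then have "\<psi> i (\<phi> i x) = 0" using fun_cong[OF fun_cong[OF 0, of i], of x] by (simp add: \<Psi>_def)
      moreover have "\<psi> i 0 = 0" "0 \<in> rep_space V i"
        using linear_between_0[OF t r \<psi>lin] fd_repD(2)[OF V] T.subspace_0 True by auto
      ultimately show ?thesis using inj_onD[OF \<psi>(2), of i "\<phi> i x" 0] \<phi>in[OF \<phi>] True by simp
    next
      case False
      then show ?thesis using \<phi> by (auto simp: rep_hom_def)
    qed
    then show ?thesis by (simp add: fun_eq_iff)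
  qed
  then show ?thesis
    unfolding hom_dim_def
    using dim_le_injective[OF HT.vector_space_axioms HR.vector_space_axioms lin]
      hom_dim_euler_form(1)[OF Q s t U V] hom_dim_euler_form(1)[OF Q s r U W] by blast
qed

text \<open>Preimages under the isomorphism return a subrepresentation found in the copy to the
  original ambient space.\<close>

lemma subrep_pullback:
  fixes s :: "'k::field \<Rightarrow> 'b::ab_group_add \<Rightarrow> 'b" and t :: "'k \<Rightarrow> 'c::ab_group_add \<Rightarrow> 'c"
  assumes Q: "fin_digraph Q" and s: "vector_space s" and t: "vector_space t"
    and V: "fd_rep Q s V" and W: "fd_rep Q t W" and iso: "rep_iso Q s t V W" and N: "subrep Q t N W"
  shows "\<exists>N'. subrep Q s N' V \<and> (\<forall>i\<in>verts Q. dimension_vector s N' i = dimension_vector t N i)"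
proof -
  interpret fin_digraph Q by fact
  interpret S: vector_space s by fact
  interpret T: vector_space t by fact
  obtain \<psi> where \<psi>: "\<psi> \<in> rep_hom Q s t V W" "\<And>i. i \<in> verts Q \<Longrightarrow> bij_betw (\<psi> i) (rep_space V i) (rep_space W i)"
    using iso by (auto simp: rep_iso_def)
  have \<psi>lin: "linear_between s t (rep_space V i) (rep_space W i) (\<psi> i)" if "i \<in> verts Q" for i
    using \<psi>(1) that by (simp add: rep_hom_def)
  have Nrep: "fd_rep Q t N" using N by (simp add: subrep_def)
  have NW: "rep_space N i \<subseteq> rep_space W i" if "i \<in> verts Q" for i using N that by (simp add: subrep_def)
  define N' where "N' = \<lparr>rep_space = (\<lambda>i. {x\<in>rep_space V i. \<psi> i x \<in> rep_space N i}), rep_map = rep_map V\<rparr>"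
  have sp: "rep_space N' i = {x\<in>rep_space V i. \<psi> i x \<in> rep_space N i}" for i by (simp add: N'_def)
  have fin: "finite_dim s (rep_space N' i)" if i: "i \<in> verts Q" for i
  proof (rule S.finite_dim_subspace(1)[OF fd_repD(1)[OF V i]])
    have "\<psi> i 0 = 0" using linear_between_0[OF s t \<psi>lin[OF i] fd_repD(2)[OF V i]] .
    then show "S.subspace (rep_space N' i)"
      using \<psi>lin[OF i] fd_repD(2)[OF V i] fd_repD(2)[OF Nrep i]
      unfolding sp by (auto simp: S.subspace_def T.subspace_def linear_between_def)
    show "rep_space N' i \<subseteq> rep_space V i" unfolding sp by blast
  qed
  have "linear_between s s (rep_space N' (tail Q a)) (rep_space N' (head Q a)) (rep_map V a)" if a: "a \<in> arcs Q" for a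
  proof (rule linear_between_subset[OF fd_repD(3)[OF V a]])
    show "rep_space N' (tail Q a) \<subseteq> rep_space V (tail Q a)" unfolding sp by blast
    fix x assume "x \<in> rep_space N' (tail Q a)"
    then have x: "x \<in> rep_space V (tail Q a)" "\<psi> (tail Q a) x \<in> rep_space N (tail Q a)" unfolding sp by auto
    have "\<psi> (head Q a) (rep_map V a x) = rep_map W a (\<psi> (tail Q a) x)" using \<psi>(1) a x(1) by (simp add: rep_hom_def)
    also have "\<dots> = rep_map N a (\<psi> (tail Q a) x)" using N a x(2) by (simp add: subrep_def)
    also have "\<dots> \<in> rep_space N (head Q a)" using fd_repD(3)[OF Nrep a] x(2) by (simp add: linear_between_def)
    finally show "rep_map V a x \<in> rep_space N' (head Q a)"
      using fd_repD(3)[OF V a] x(1) unfolding sp by (simp add: linear_between_def)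
  qed
  then have "subrep Q s N' V" using fin by (simp add: subrep_def fd_rep_def) (simp add: N'_def)
  moreover have "dimension_vector s N' i = dimension_vector t N i" if i: "i \<in> verts Q" for i
  proof -
    have sub: "rep_space N' i \<subseteq> rep_space V i" unfolding sp by blast
    have lin: "linear_between s t (rep_space N' i) (rep_space N i) (\<psi> i)"
      by (rule linear_between_subset[OF \<psi>lin[OF i] sub]) (simp add: sp)
    have img: "\<psi> i ` rep_space N' i = rep_space N i"
      using NW[OF i] \<psi>(2)[OF i] unfolding sp bij_betw_def by auto
    have "\<psi> i 0 = 0" "0 \<in> rep_space V i" "0 \<in> rep_space N' i"
      using linear_between_0[OF s t \<psi>lin[OF i] fd_repD(2)[OF V i]] S.subspace_0 fd_repD(2)[OF V i]
        S.finite_dim_imp_subspace[OF fin[OF i]] by auto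
    moreover have "inj_on (\<psi> i) (rep_space V i)" using \<psi>(2)[OF i] by (simp add: bij_betw_def)
    ultimately have "{x\<in>rep_space N' i. \<psi> i x = 0} = {0}"
      using sub inj_onD[of "\<psi> i" "rep_space V i" _ 0] by auto
    moreover have "S.dim {0} = 0" using S.dim_eq_card_independent[of "{}"] S.dim_span[of "{}"] by (simp add: S.independent_empty)
    ultimately show ?thesis
      using rank_nullity(2)[OF s t lin fin[OF i]] img by (simp add: dimension_vector_def)
  qed
  ultimately show ?thesis by blast
qed

section \<open>Reduction to indecomposable representations\<close>

lemma internal_direct_sum_commute:
  fixes V :: "('v, 'a, 'b::ab_group_add) quiver_rep"
  assumes "internal_direct_sum Q s V V1 V2"
  shows "internal_direct_sum Q s V V2 V1"
proof -
  have comm: "{x + y | x y. x \<in> A \<and> y \<in> B} = {x + y | x y. x \<in> B \<and> y \<in> A}" for A B :: "'b set"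
    by (rule Collect_cong) (metis add.commute)
  show ?thesis
    using assms by (simp add: internal_direct_sum_def Int_commute comm[of "rep_space V2 i" "rep_space V1 i" for i])
qed

text \<open>The projection along \<open>V2\<close> is picked by choice; uniqueness of the
  decomposition makes it linear and, both summands being stable under the maps of \<open>U\<close>,
  compatible with the arrows.\<close>

lemma internal_direct_sum_projection:
  fixes s :: "'k::field \<Rightarrow> 'b::ab_group_add \<Rightarrow> 'b"
  assumes Q: "fin_digraph Q" and s: "vector_space s" and U: "fd_rep Q s U"
    and sum: "internal_direct_sum Q s U V1 V2"
  shows "\<exists>p. (\<forall>i\<in>verts Q. linear_between s s (rep_space U i) (rep_space V1 i) (p i) \<and>
      (\<forall>x\<in>rep_space V1 i. p i x = x) \<and> (\<forall>x\<in>rep_space U i. p i x = 0 \<longleftrightarrow> x \<in> rep_space V2 i)) \<and>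
    (\<forall>a\<in>arcs Q. \<forall>x\<in>rep_space U (tail Q a). p (head Q a) (rep_map U a x) = rep_map U a (p (tail Q a) x))"
proof -
  interpret fin_digraph Q by fact
  interpret vector_space s by fact
  have V: "subrep Q s V1 U" "subrep Q s V2 U" using sum by (simp_all add: internal_direct_sum_def)
  then have V': "fd_rep Q s V1" "fd_rep Q s V2" by (simp_all add: subrep_def)
  have dec: "rep_space U i = {x + y | x y. x \<in> rep_space V1 i \<and> y \<in> rep_space V2 i}"
    "rep_space V1 i \<inter> rep_space V2 i = {0}" if "i \<in> verts Q" for i
    using sum that unfolding internal_direct_sum_def by blast+
  note sub1 = fd_repD(2)[OF V'(1)] and sub2 = fd_repD(2)[OF V'(2)] and subU = fd_repD(2)[OF U]
  have V1U: "x \<in> rep_space U i" if "i \<in> verts Q" "x \<in> rep_space V1 i" for i x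
    using V(1) that by (auto simp: subrep_def)
  have "\<exists>y. y \<in> rep_space V1 i \<and> x - y \<in> rep_space V2 i" if i: "i \<in> verts Q" and x: "x \<in> rep_space U i" for i x
  proof -
    obtain y z where "y \<in> rep_space V1 i" "z \<in> rep_space V2 i" "x = y + z"
      using x dec(1)[OF i] by auto
    then have "y \<in> rep_space V1 i \<and> x - y \<in> rep_space V2 i" by simp
    then show ?thesis ..
  qed
  then obtain p where p: "\<And>i x. i \<in> verts Q \<Longrightarrow> x \<in> rep_space U i \<Longrightarrow> p i x \<in> rep_space V1 i \<and> x - p i x \<in> rep_space V2 i"
    by metis
  have uniq: "p i x = y" if "i \<in> verts Q" "x \<in> rep_space U i" "y \<in> rep_space V1 i" "x - y \<in> rep_space V2 i" for i x y
  proof -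
    have "p i x - y \<in> rep_space V1 i" using p[OF that(1,2)] that(3) subspace_diff[OF sub1[OF that(1)]] by blast
    moreover have "(x - y) - (x - p i x) \<in> rep_space V2 i"
      using p[OF that(1,2)] that(4) subspace_diff[OF sub2[OF that(1)]] by blast
    then have "p i x - y \<in> rep_space V2 i" by (simp add: algebra_simps)
    ultimately have "p i x - y \<in> {0}" using dec(2)[OF that(1)] by blast
    then show ?thesis by simp
  qed
  show ?thesis
  proof (intro exI[of _ p] conjI ballI)
    fix i assume i: "i \<in> verts Q"
    have "p i (x + y) = p i x + p i y" if "x \<in> rep_space U i" "y \<in> rep_space U i" for x y
    proof (rule uniq[OF i])
      show "x + y \<in> rep_space U i" using that subspace_add[OF subU[OF i]] by blast
      show "p i x + p i y \<in> rep_space V1 i" using p[OF i] that subspace_add[OF sub1[OF i]] by blast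
      have "(x - p i x) + (y - p i y) \<in> rep_space V2 i" using p[OF i] that subspace_add[OF sub2[OF i]] by blast
      then show "x + y - (p i x + p i y) \<in> rep_space V2 i" by (simp add: algebra_simps)
    qed
    moreover have "p i (s c x) = s c (p i x)" if "x \<in> rep_space U i" for x c
    proof (rule uniq[OF i])
      show "s c x \<in> rep_space U i" using that subspace_scale[OF subU[OF i]] by blast
      show "s c (p i x) \<in> rep_space V1 i" using p[OF i] that subspace_scale[OF sub1[OF i]] by blast
      show "s c x - s c (p i x) \<in> rep_space V2 i"
        unfolding scale_right_diff_distrib[symmetric] using p[OF i] that subspace_scale[OF sub2[OF i]] by blast
    qed
    ultimately show "linear_between s s (rep_space U i) (rep_space V1 i) (p i)"
      using p[OF i] by (simp add: linear_between_def)
    show "p i x = x" if "x \<in> rep_space V1 i" for x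
      using uniq[OF i V1U[OF i that] that] subspace_0[OF sub2[OF i]] by simp
    show "p i x = 0 \<longleftrightarrow> x \<in> rep_space V2 i" if "x \<in> rep_space U i" for x
      using p[OF i that] uniq[OF i that subspace_0[OF sub1[OF i]]] by auto
  next
    fix a x assume a: "a \<in> arcs Q" and x: "x \<in> rep_space U (tail Q a)"
    have ins: "rep_map U a y \<in> rep_space V (head Q a)" if "subrep Q s V U" "y \<in> rep_space V (tail Q a)" for V y
    proof -
      have "rep_map V a y \<in> rep_space V (head Q a)"
        using that a fd_repD(3)[of Q s V a] by (simp add: subrep_def linear_between_def)
      then show ?thesis using that a by (simp add: subrep_def)
    qed
    have px: "p (tail Q a) x \<in> rep_space V1 (tail Q a)" "x - p (tail Q a) x \<in> rep_space V2 (tail Q a)" using p a x by auto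
    show "p (head Q a) (rep_map U a x) = rep_map U a (p (tail Q a) x)"
    proof (rule uniq)
      show "head Q a \<in> verts Q" using a by simp
      show "rep_map U a x \<in> rep_space U (head Q a)" using fd_repD(3)[OF U a] x by (simp add: linear_between_def)
      show "rep_map U a (p (tail Q a) x) \<in> rep_space V1 (head Q a)" using ins[OF V(1)] px(1) by blast
      have "rep_map U a (x - p (tail Q a) x) = rep_map U a x - rep_map U a (p (tail Q a) x)"
        using linear_between_diff[OF s s fd_repD(3)[OF U a] subU x V1U] px(1) a by simp
      then show "rep_map U a x - rep_map U a (p (tail Q a) x) \<in> rep_space V2 (head Q a)"
        using ins[OF V(2) px(2)] by simp
    qed
  qed
qed

text \<open>Rank and nullity are applied to the restriction of morphisms from \<open>U\<close> to
  \<open>V2\<close>: composing with the projection to \<open>V1\<close> embeds the morphisms on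
  \<open>V1\<close> in the kernel, and composing with the one to \<open>V2\<close> extends every
  morphism on \<open>V2\<close>.\<close>

lemma internal_direct_sum_dims:
  fixes s :: "'k::field \<Rightarrow> 'b::ab_group_add \<Rightarrow> 'b" and t :: "'k \<Rightarrow> 'c::ab_group_add \<Rightarrow> 'c"
    and U :: "('v, 'a, 'b) quiver_rep"
  assumes Q: "fin_digraph Q" and s: "vector_space s" and t: "vector_space t" and U: "fd_rep Q s U"
    and M: "fd_rep Q t M" and sum: "internal_direct_sum Q s U V1 V2"
  shows "i \<in> verts Q \<Longrightarrow> dimension_vector s U i = dimension_vector s V1 i + dimension_vector s V2 i"
    and "hom_dim Q s t V1 M + hom_dim Q s t V2 M \<le> hom_dim Q s t U M"
proof -
  interpret fin_digraph Q by fact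
  interpret S: vector_space s by fact
  interpret T: vector_space t by fact
  interpret H: vector_space "family_scale t :: 'k \<Rightarrow> ('v \<Rightarrow> 'b \<Rightarrow> 'c) \<Rightarrow> _"
    by (rule vector_space_family_scale[OF t])
  obtain p1 where P1: "\<forall>i\<in>verts Q. linear_between s s (rep_space U i) (rep_space V1 i) (p1 i) \<and>
      (\<forall>x\<in>rep_space V1 i. p1 i x = x) \<and> (\<forall>x\<in>rep_space U i. p1 i x = 0 \<longleftrightarrow> x \<in> rep_space V2 i)"
    "\<forall>a\<in>arcs Q. \<forall>x\<in>rep_space U (tail Q a). p1 (head Q a) (rep_map U a x) = rep_map U a (p1 (tail Q a) x)"
    using internal_direct_sum_projection[OF Q s U sum] by (elim exE conjE) (rule that)
  obtain p2 where P2: "\<forall>i\<in>verts Q. linear_between s s (rep_space U i) (rep_space V2 i) (p2 i) \<and>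
      (\<forall>x\<in>rep_space V2 i. p2 i x = x) \<and> (\<forall>x\<in>rep_space U i. p2 i x = 0 \<longleftrightarrow> x \<in> rep_space V1 i)"
    "\<forall>a\<in>arcs Q. \<forall>x\<in>rep_space U (tail Q a). p2 (head Q a) (rep_map U a x) = rep_map U a (p2 (tail Q a) x)"
    using internal_direct_sum_projection[OF Q s U internal_direct_sum_commute[OF sum]] by (elim exE conjE) (rule that)
  have p1: "\<And>i. i \<in> verts Q \<Longrightarrow> linear_between s s (rep_space U i) (rep_space V1 i) (p1 i)"
    "\<And>i x. i \<in> verts Q \<Longrightarrow> x \<in> rep_space V1 i \<Longrightarrow> p1 i x = x"
    "\<And>i x. i \<in> verts Q \<Longrightarrow> x \<in> rep_space U i \<Longrightarrow> p1 i x = 0 \<longleftrightarrow> x \<in> rep_space V2 i"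
    "\<And>a x. a \<in> arcs Q \<Longrightarrow> x \<in> rep_space U (tail Q a) \<Longrightarrow> p1 (head Q a) (rep_map U a x) = rep_map U a (p1 (tail Q a) x)"
    using P1 by simp_all
  have p2: "\<And>i. i \<in> verts Q \<Longrightarrow> linear_between s s (rep_space U i) (rep_space V2 i) (p2 i)"
    "\<And>i x. i \<in> verts Q \<Longrightarrow> x \<in> rep_space V2 i \<Longrightarrow> p2 i x = x"
    "\<And>a x. a \<in> arcs Q \<Longrightarrow> x \<in> rep_space U (tail Q a) \<Longrightarrow> p2 (head Q a) (rep_map U a x) = rep_map U a (p2 (tail Q a) x)"
    using P2 by simp_all
  have V: "subrep Q s V1 U" "subrep Q s V2 U" using sum by (simp_all add: internal_direct_sum_def)
  then have V': "fd_rep Q s V1" "fd_rep Q s V2" by (simp_all add: subrep_def)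
  have VU: "x \<in> rep_space U i" if "subrep Q s V U" "i \<in> verts Q" "x \<in> rep_space V i" for V i x
    using that by (auto simp: subrep_def)
  show "dimension_vector s U i = dimension_vector s V1 i + dimension_vector s V2 i" if i: "i \<in> verts Q" for i
  proof -
    have "p1 i ` rep_space U i = rep_space V1 i"
    proof
      show "p1 i ` rep_space U i \<subseteq> rep_space V1 i" using p1(1)[OF i] by (auto simp: linear_between_def)
      show "rep_space V1 i \<subseteq> p1 i ` rep_space U i"
      proof
        fix x assume x: "x \<in> rep_space V1 i"
        show "x \<in> p1 i ` rep_space U i" using p1(2)[OF i x, symmetric] VU[OF V(1) i x] by (rule image_eqI)
      qed
    qed
    moreover have "{x\<in>rep_space U i. p1 i x = 0} = rep_space V2 i"
      using p1(3)[OF i] VU[OF V(2) i] by blast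
    ultimately show ?thesis
      using rank_nullity(2)[OF s s p1(1)[OF i] fd_repD(1)[OF U i]] by (simp add: dimension_vector_def)
  qed
  let ?HU = "rep_hom Q s t U M"
  define E where "E p \<phi> = (\<lambda>i x. if i \<in> verts Q \<and> x \<in> rep_space U i then \<phi> i (p i x) else 0)"
    for p :: "'v \<Rightarrow> 'b \<Rightarrow> 'b" and \<phi> :: "'v \<Rightarrow> 'b \<Rightarrow> 'c"
  \<comment> \<open>Setting the restriction to 0 off \<open>V2\<close> keeps it in the normal form
    of \<open>rep_hom\<close>, so that it can be compared with morphisms on
    \<open>V2\<close>.\<close>
  define R where "R \<phi> = (\<lambda>i x. if i \<in> verts Q \<and> x \<in> rep_space V2 i then \<phi> i x else 0)" for \<phi> :: "'v \<Rightarrow> 'b \<Rightarrow> 'c"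
  have E: "E p \<phi> \<in> ?HU"
    if sub: "subrep Q s V U" and p: "\<And>i. i \<in> verts Q \<Longrightarrow> linear_between s s (rep_space U i) (rep_space V i) (p i)"
      "\<And>a x. a \<in> arcs Q \<Longrightarrow> x \<in> rep_space U (tail Q a) \<Longrightarrow> p (head Q a) (rep_map U a x) = rep_map U a (p (tail Q a) x)"
      and \<phi>: "\<phi> \<in> rep_hom Q s t V M" for V p \<phi>
  proof -
    have "linear_between s t (rep_space U i) (rep_space M i) (E p \<phi> i)" if i: "i \<in> verts Q" for i
    proof -
      have "linear_between s t (rep_space V i) (rep_space M i) (\<phi> i)" using \<phi> i by (simp add: rep_hom_def)
      then show ?thesis
        using p(1)[OF i] i S.subspace_add[OF fd_repD(2)[OF U i]] S.subspace_scale[OF fd_repD(2)[OF U i]]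
        by (simp add: linear_between_def E_def)
    qed
    moreover have "E p \<phi> (head Q a) (rep_map U a x) = rep_map M a (E p \<phi> (tail Q a) x)"
      if a: "a \<in> arcs Q" and x: "x \<in> rep_space U (tail Q a)" for a x
    proof -
      have px: "p (tail Q a) x \<in> rep_space V (tail Q a)" using p(1)[of "tail Q a"] a x by (simp add: linear_between_def)
      have "rep_map U a x \<in> rep_space U (head Q a)" using fd_repD(3)[OF U a] x by (simp add: linear_between_def)
      moreover have "\<phi> (head Q a) (rep_map V a (p (tail Q a) x)) = rep_map M a (\<phi> (tail Q a) (p (tail Q a) x))"
        using \<phi> a px by (simp add: rep_hom_def)
      moreover have "rep_map V a (p (tail Q a) x) = rep_map U a (p (tail Q a) x)" using sub a px by (simp add: subrep_def)
      ultimately show ?thesis using a x p(2)[OF a x] by (simp add: E_def)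
    qed
    ultimately show ?thesis by (simp add: rep_hom_def) (auto simp: E_def)
  qed
  have HU: "finite_dim (family_scale t) ?HU" "H.subspace ?HU"
    using hom_dim_euler_form(1)[OF Q s t U M] H.finite_dim_imp_subspace by blast+
  have R: "linear_between (family_scale t) (family_scale t) ?HU UNIV R"
    by (auto simp: linear_between_def R_def fun_eq_iff family_scale_def)
  let ?K = "{\<phi>\<in>?HU. R \<phi> = 0}"
  have K: "finite_dim (family_scale t) ?K"
    using H.finite_dim_subspace(1)[OF HU(1) linear_between_kernel[OF H.vector_space_axioms H.vector_space_axioms R HU(2)]] by blast
  have "hom_dim Q s t V1 M \<le> H.dim ?K"
    unfolding hom_dim_def
  proof (rule dim_le_injective[OF H.vector_space_axioms H.vector_space_axioms _ hom_dim_euler_form(1)[OF Q s t V'(1) M] K])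
    have "R (E p1 \<phi>) = 0" if \<phi>: "\<phi> \<in> rep_hom Q s t V1 M" for \<phi>
    proof -
      have "\<phi> i 0 = 0" if i: "i \<in> verts Q" for i
      proof -
        have "linear_between s t (rep_space V1 i) (rep_space M i) (\<phi> i)" using \<phi> i by (simp add: rep_hom_def)
        then show ?thesis using linear_between_0[OF s t _ fd_repD(2)[OF V'(1) i]] by blast
      qed
      moreover have "p1 i x = 0" if "i \<in> verts Q" "x \<in> rep_space V2 i" for i x
        using p1(3)[OF that(1) VU[OF V(2) that]] that(2) by simp
      ultimately show ?thesis by (auto simp: R_def E_def fun_eq_iff)
    qed
    then show "linear_between (family_scale t) (family_scale t) (rep_hom Q s t V1 M) ?K (E p1)"
      using E[OF V(1) p1(1,4)]
      by (auto simp: linear_between_def) (auto simp: E_def family_scale_def fun_eq_iff)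
    fix \<phi> assume \<phi>: "\<phi> \<in> rep_hom Q s t V1 M" and 0: "E p1 \<phi> = 0"
    have "\<phi> i x = 0" for i x
    proof (cases "i \<in> verts Q \<and> x \<in> rep_space V1 i")
      case True
      then show ?thesis
        using fun_cong[OF fun_cong[OF 0, of i], of x] p1(2)[of i x] VU[OF V(1), of i x] by (simp add: E_def)
    next
      case False
      then show ?thesis using \<phi> by (auto simp: rep_hom_def)
    qed
    then show "\<phi> = 0" by (simp add: fun_eq_iff)
  qed
  moreover have "hom_dim Q s t V2 M \<le> H.dim (R ` ?HU)"
    unfolding hom_dim_def
  proof (rule H.finite_dim_subspace(2))
    show "finite_dim (family_scale t) (R ` ?HU)"
      using rank_nullity(1)[OF H.vector_space_axioms H.vector_space_axioms R HU(1)] .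
    show "H.subspace (rep_hom Q s t V2 M)" using subspace_rep_hom[OF wf_digraph_axioms t M] .
    show "rep_hom Q s t V2 M \<subseteq> R ` ?HU"
    proof
      fix \<phi> assume \<phi>: "\<phi> \<in> rep_hom Q s t V2 M"
      have "\<phi> i x = R (E p2 \<phi>) i x" for i x
        using p2(2)[of i x] VU[OF V(2), of i x] \<phi> by (auto simp: R_def E_def rep_hom_def)
      then have "\<phi> = R (E p2 \<phi>)" by (simp add: fun_eq_iff)
      then show "\<phi> \<in> R ` ?HU" using E[OF V(2) p2(1,3) \<phi>] by (rule image_eqI)
    qed
  qed
  moreover have "H.dim ?HU = H.dim ?K + H.dim (R ` ?HU)"
    using rank_nullity(2)[OF H.vector_space_axioms H.vector_space_axioms R HU(1)] .
  ultimately show "hom_dim Q s t V1 M + hom_dim Q s t V2 M \<le> hom_dim Q s t U M"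
    unfolding hom_dim_def[of Q s t U] by linarith
qed

text \<open>Induction on the total dimension: a nonzero decomposable \<open>U\<close> splits into
  two nonzero, hence smaller, summands. The Euler form is additive in them and the Hom dimension at
  least superadditive.\<close>

lemma hom_bounded_indecomposable:
  fixes s :: "'k::field \<Rightarrow> 'b::ab_group_add \<Rightarrow> 'b" and t :: "'k \<Rightarrow> 'c::ab_group_add \<Rightarrow> 'c"
    and M :: "('v, 'a, 'c) quiver_rep"
  assumes Q: "fin_digraph Q" and s: "vector_space s" and t: "vector_space t" and M: "fd_rep Q t M"
    and bound: "\<And>U. indecomposable Q s U \<Longrightarrow> euler_form Q (dimension_vector s U) e \<le> int (hom_dim Q s t U M)"
  shows "hom_bounded Q s t M e"
proof -
  interpret fin_digraph Q by fact
  interpret S: vector_space s by fact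
  have "euler_form Q (dimension_vector s U) e \<le> int (hom_dim Q s t U M)" if "fd_rep Q s U" for U
    using that
  proof (induction "\<Sum>i\<in>verts Q. dimension_vector s U i" arbitrary: U rule: less_induct)
    case less
    note U = less.prems
    consider "zero_rep Q U" | "indecomposable Q s U"
      | V1 V2 where "internal_direct_sum Q s U V1 V2" "\<not> zero_rep Q V1" "\<not> zero_rep Q V2"
      using U unfolding indecomposable_def by blast
    then show ?case
    proof cases
      case 1
      have "S.dim {0} = 0"
        using S.dim_eq_card_independent[of "{}"] S.dim_span[of "{}"] by (simp add: S.independent_empty)
      then have "euler_form Q (dimension_vector s U) e = euler_form Q (\<lambda>i. 0) e"
        using 1 by (intro euler_form_cong) (auto simp: zero_rep_def dimension_vector_def wf_digraph_axioms)
      then show ?thesis by (simp add: euler_form_def)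
    next
      case 2
      then show ?thesis by (rule bound)
    next
      case 3
      note dims = internal_direct_sum_dims[OF Q s t U M 3(1)]
      have V: "fd_rep Q s V1" "fd_rep Q s V2" using 3(1) by (simp_all add: internal_direct_sum_def subrep_def)
      have pos: "0 < (\<Sum>i\<in>verts Q. dimension_vector s V i)" if V: "fd_rep Q s V" and nz: "\<not> zero_rep Q V" for V
      proof -
        obtain i where i: "i \<in> verts Q" "rep_space V i \<noteq> {0}" using nz by (auto simp: zero_rep_def)
        obtain B where B: "finite B" "S.span B = rep_space V i" "card B = S.dim (rep_space V i)"
          by (rule S.finite_dim_basis[OF fd_repD(1)[OF V i(1)]])
        have "B \<noteq> {}"
        proof
          assume "B = {}"
          then have "rep_space V i = S.span {}" using B(2) by (simp only:)
          then show False using i(2) by (simp only: S.span_empty)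
        qed
        then have "card B > 0" using B(1) by (simp add: card_gt_0_iff)
        then have "dimension_vector s V i > 0" by (simp add: dimension_vector_def B(3))
        moreover have "dimension_vector s V i \<le> (\<Sum>i\<in>verts Q. dimension_vector s V i)"
          by (rule member_le_sum[OF i(1)]) auto
        ultimately show ?thesis by linarith
      qed
      have "(\<Sum>i\<in>verts Q. dimension_vector s U i) = (\<Sum>i\<in>verts Q. dimension_vector s V1 i) + (\<Sum>i\<in>verts Q. dimension_vector s V2 i)"
        unfolding sum.distrib[symmetric] using dims(1) by (intro sum.cong) auto
      then have "euler_form Q (dimension_vector s V1) e \<le> int (hom_dim Q s t V1 M)"
        "euler_form Q (dimension_vector s V2) e \<le> int (hom_dim Q s t V2 M)"
        using pos[OF V(1) 3(2)] pos[OF V(2) 3(3)] less.hyps V by auto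
      moreover have "euler_form Q (dimension_vector s U) e = euler_form Q (dimension_vector s V1) e + euler_form Q (dimension_vector s V2) e"
      proof -
        have "euler_form Q (dimension_vector s U) e = euler_form Q (\<lambda>i. dimension_vector s V1 i + dimension_vector s V2 i) e"
          using dims(1) by (intro euler_form_cong) (auto simp: wf_digraph_axioms)
        also have "\<dots> = euler_form Q (dimension_vector s V1) e + euler_form Q (dimension_vector s V2) e"
          by (simp add: euler_form_def distrib_right sum.distrib)
        finally show ?thesis .
      qed
      ultimately show ?thesis using dims(2) by linarith
    qed
  qed
  then show ?thesis by (simp add: hom_bounded_def)
qed

text \<open>The Euler form bounds the morphisms into \<open>N\<close> from below, and the inclusion
  of \<open>N\<close> embeds these in the morphisms into \<open>M\<close>.\<close>

lemma subrep_imp_hom_bounded: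
  fixes s :: "'k::field \<Rightarrow> 'b::ab_group_add \<Rightarrow> 'b" and t :: "'k \<Rightarrow> 'c::ab_group_add \<Rightarrow> 'c"
    and M :: "('v, 'a, 'c) quiver_rep"
  assumes Q: "fin_digraph Q" and s: "vector_space s" and t: "vector_space t" and M: "fd_rep Q t M"
    and N: "subrep Q t N M" "\<And>i. i \<in> verts Q \<Longrightarrow> dimension_vector t N i = e i"
  shows "hom_bounded Q s t M e"
  unfolding hom_bounded_def
proof (intro allI impI)
  fix U :: "('v, 'a, 'b) quiver_rep" assume U: "fd_rep Q s U"
  interpret fin_digraph Q by fact
  interpret T: vector_space t by fact
  have Nrep: "fd_rep Q t N" using N(1) by (simp add: subrep_def)
  define \<iota> where "\<iota> i x = (if i \<in> verts Q \<and> x \<in> rep_space N i then x else 0)" for i and x :: 'c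
  have "linear_between t t (rep_space N i) (rep_space M i) (\<iota> i)" if i: "i \<in> verts Q" for i
    using N(1) i T.subspace_add[OF fd_repD(2)[OF Nrep i]] T.subspace_scale[OF fd_repD(2)[OF Nrep i]]
    by (auto simp: linear_between_def \<iota>_def subrep_def)
  moreover have "\<iota> (head Q a) (rep_map N a x) = rep_map M a (\<iota> (tail Q a) x)"
    if "a \<in> arcs Q" "x \<in> rep_space N (tail Q a)" for a x
    using N(1) that fd_repD(3)[OF Nrep that(1)] by (simp add: \<iota>_def subrep_def linear_between_def)
  ultimately have "\<iota> \<in> rep_hom Q t t N M" by (simp add: rep_hom_def) (auto simp: \<iota>_def)
  then have "hom_dim Q s t U N \<le> hom_dim Q s t U M"
    by (rule hom_dim_mono_injective[OF Q s t t U Nrep M]) (auto simp: \<iota>_def inj_on_def)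
  moreover have "euler_form Q (dimension_vector s U) e = euler_form Q (dimension_vector s U) (dimension_vector t N)"
    using N(2) by (intro euler_form_cong) (auto simp: wf_digraph_axioms)
  ultimately show "euler_form Q (dimension_vector s U) e \<le> int (hom_dim Q s t U M)"
    using hom_dim_euler_form(2)[OF Q s t U Nrep] by linarith
qed

theorem theorem1p1:
  fixes Q :: "('v, 'a) pre_digraph"
    and sM :: "'k::alg_closed_field \<Rightarrow> 'm::ab_group_add \<Rightarrow> 'm"
    and sU :: "'k \<Rightarrow> 'u::ab_group_add \<Rightarrow> 'u"
    and M :: "('v, 'a, 'm) quiver_rep"
    and e :: "'v \<Rightarrow> nat"
  assumes "dynkin_quiver Q"
    and "vector_space sM" and "fd_rep Q sM M"
    and "vector_space sU" and "\<not> finite_dim sU UNIV"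
  shows "((\<exists>N. subrep Q sM N M \<and> (\<forall>i\<in>verts Q. dimension_vector sM N i = e i)) \<longleftrightarrow>
         (\<forall>U. fd_rep Q sU U \<longrightarrow>
            int (hom_dim Q sU sM U M) \<ge> euler_form Q (dimension_vector sU U) e)) \<and>
         ((\<exists>N. subrep Q sM N M \<and> (\<forall>i\<in>verts Q. dimension_vector sM N i = e i)) \<longleftrightarrow>
         (\<forall>U. indecomposable Q sU U \<longrightarrow>
            int (hom_dim Q sU sM U M) \<ge> euler_form Q (dimension_vector sU U) e))"
    (is "(?sub \<longleftrightarrow> ?all) \<and> (_ \<longleftrightarrow> ?indec)")
proof -
  have Q: "fin_digraph Q" "wf_digraph Q" using assms(1) by (auto simp: dynkin_quiver_def fin_digraph_def)
  obtain y where y: "subadditive_weight Q y" using dynkin_quiver_weight[OF assms(1)] by blast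
  have all: "?all \<longleftrightarrow> hom_bounded Q sU sM M e" by (simp add: hom_bounded_def)
  have "?sub" if bound: "hom_bounded Q sU sM M e"
  proof -
    \<comment> \<open>The ambient space of \<open>M\<close> may be too small for its reflections. In
      the copy, reflections of \<open>M\<close> and of test representations share one infinite
      dimensional space.\<close>
    obtain M' where M': "fd_rep Q sU M'" "rep_iso Q sM sU M M'"
      using fd_rep_copy[OF Q(2) assms(2,4,5,3)] by blast
    then obtain \<psi> where \<psi>: "\<psi> \<in> rep_hom Q sM sU M M'" "\<And>i. i \<in> verts Q \<Longrightarrow> inj_on (\<psi> i) (rep_space M i)"
      by (auto simp: rep_iso_def bij_betw_def)
    have "hom_bounded Q sU sU M' e"
      using bound hom_dim_mono_injective[OF Q(1) assms(4,2,4) _ assms(3) M'(1) \<psi>]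
      unfolding hom_bounded_def by (meson of_nat_le_iff order_trans)
    then obtain N where "subrep Q sU N M'" "\<forall>i\<in>verts Q. dimension_vector sU N i = e i"
      using hom_bounded_imp_subrep[OF assms(4,5) Q(1) y M'(1)] by blast
    then show ?sub using subrep_pullback[OF Q(1) assms(2,4,3) M'] by fastforce
  qed
  moreover have "hom_bounded Q sU sM M e" if ?sub
    using that subrep_imp_hom_bounded[OF Q(1) assms(4,2,3)] by blast
  moreover have "hom_bounded Q sU sM M e" if ?indec
    using hom_bounded_indecomposable[OF Q(1) assms(4,2,3)] that by blast
  \<comment> \<open>This closes the circle of implications between the subrepresentation and the two
    bounds.\<close>
  moreover have ?indec if ?all using that by (simp add: indecomposable_def)
  ultimately show ?thesis unfolding all by blast
qed

end
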